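(* Let $p$ be a prime, $n\ge 1$, $F$ a field and $K/F$ a cyclic Galois extension of degree $p^n$ with group $G=\langle\sigma\rangle$. Suppose that either (i) $\xi_p\notin F$, or (ii) $p=2$, $n=1$ and $-1\notin N_{K/F}(K^\times)$. Then the $\mathbb{F}_p[G]$-module $J=K^\times/K^{\times p}$ decomposes as \[ J=Y_n\oplus Y_{n-1}\oplus\cdots\oplus Y_0, \] where each $Y_i$ is a direct sum of cyclic $\mathbb{F}_p[G]$-modules of $\mathbb{F}_p$-dimension $p^i$, and moreover $[K_i^\times]=J^{H_i}$ for all $0\le i\le n$.
   Context: For $0\le i\le n$, $K_i$ denotes the unique intermediate field of $K/F$ with $[K_i:F]=p^i$ and $H_i=\mathrm{Gal}(K/K_i)$. $J=K^\times/K^{\times p}$ is written multiplicatively and regarded as an $\mathbb{F}_p[G]$-module via the Galois action; $[\gamma]$ denotes the class of $\gamma\in K^\times$. For a subgroup $A\subset K^\times$, $[A]=AK^{\times p}/K^{\times p}\subset J$; in particular $[K_i^\times]$ is the image of $K_i^\times$ in $J$. $J^{H}$ denotes the elements fixed by the subgroup $H$. $\xi_p$ denotes a primitive $p$-th root of unity in an algebraic closure of $F$ when $\mathrm{char}\,F\ne p$; the condition "$\xi_p\notin F$" is understood to hold also when $\mathrm{char}\,F=p$. *)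

theory Defs
  imports
    "HOL-Algebra.Algebra"
    "HOL-Number_Theory.Residues"
    "Jordan_Normal_Form.Missing_VectorSpace"
begin

section \<open>Galois extensions\<close>

text \<open>As for \<^const>\<open>BijGroup\<close>, automorphisms are extensional functions on
  \<^term>\<open>carrier K\<close>, so that equality of automorphisms is equality of functions.\<close>

definition galois_group :: "('a, 'b) ring_scheme \<Rightarrow> 'a set \<Rightarrow> ('a \<Rightarrow> 'a) monoid" where
  "galois_group K F = (BijGroup (carrier K))
     \<lparr>carrier := {g \<in> ring_iso K K \<inter> extensional (carrier K). \<forall>x\<in>F. g x = x}\<rparr>"

definition galois_extension :: "('a, 'b) ring_scheme \<Rightarrow> 'a set \<Rightarrow> bool" where
  "galois_extension K F \<longleftrightarrow> field K \<and> subfield F K \<and>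
     (\<forall>x\<in>carrier K. \<not> (ring.transcendental K F x)) \<and>
     {x \<in> carrier K. \<forall>g\<in>carrier (galois_group K F). g x = x} = F"

text \<open>The norm of a finite Galois extension.\<close>

definition galois_norm :: "('a, 'b) ring_scheme \<Rightarrow> 'a set \<Rightarrow> 'a \<Rightarrow> 'a" where
  "galois_norm K F x = (\<Otimes>\<^bsub>K\<^esub>g\<in>carrier (galois_group K F). g x)"

text \<open>The intermediate field of degree \<open>d\<close> over \<open>F\<close>; only meaningful where it is unique,
  as in a cyclic extension whose degree is divisible by \<open>d\<close>.\<close>

definition intermediate_field :: "('a, 'b) ring_scheme \<Rightarrow> 'a set \<Rightarrow> nat \<Rightarrow> 'a set" where
  "intermediate_field K F d = (THE L. subfield L K \<and> F \<subseteq> L \<and> ring.dimension K d F L)"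

text \<open>For \<open>m\<close> the characteristic of \<open>K\<close>, a prime, there are none.\<close>

definition primitive_root_of_unity :: "('a, 'b) ring_scheme \<Rightarrow> nat \<Rightarrow> 'a \<Rightarrow> bool" where
  "primitive_root_of_unity K m z \<longleftrightarrow> z \<in> carrier K \<and> z [^]\<^bsub>K\<^esub> m = \<one>\<^bsub>K\<^esub> \<and>
     (\<forall>k. 0 < k \<and> k < m \<longrightarrow> z [^]\<^bsub>K\<^esub> k \<noteq> \<one>\<^bsub>K\<^esub>)"


section \<open>Group rings and modules over them\<close>

text \<open>The group ring \<open>R[G]\<close> of a finite group \<open>G\<close>: functions from \<open>G\<close> to \<open>R\<close>
  under convolution.\<close>

definition group_ring :: "('r, 'x) ring_scheme \<Rightarrow> ('g, 'y) monoid_scheme \<Rightarrow> ('g \<Rightarrow> 'r) ring" where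
  "group_ring R G =
     \<lparr>carrier = carrier G \<rightarrow>\<^sub>E carrier R,
      monoid.mult = (\<lambda>a b. \<lambda>g\<in>carrier G.
        \<Oplus>\<^bsub>R\<^esub>h\<in>carrier G. a h \<otimes>\<^bsub>R\<^esub> b (inv\<^bsub>G\<^esub> h \<otimes>\<^bsub>G\<^esub> g)),
      one = (\<lambda>g\<in>carrier G. if g = \<one>\<^bsub>G\<^esub> then \<one>\<^bsub>R\<^esub> else \<zero>\<^bsub>R\<^esub>),
      ring.zero = (\<lambda>g\<in>carrier G. \<zero>\<^bsub>R\<^esub>),
      ring.add = (\<lambda>a b. \<lambda>g\<in>carrier G. a g \<oplus>\<^bsub>R\<^esub> b g)\<rparr>"

definition group_ring_scalar :: "('r, 'x) ring_scheme \<Rightarrow> ('g, 'y) monoid_scheme \<Rightarrow> 'r \<Rightarrow> 'g \<Rightarrow> 'r" where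
  "group_ring_scalar R G c = (\<lambda>g\<in>carrier G. if g = \<one>\<^bsub>G\<^esub> then c else \<zero>\<^bsub>R\<^esub>)"

text \<open>The underlying \<open>k\<close>-vector space, \<open>k\<close> a field, of the submodule \<open>N\<close> of a
  \<open>k[G]\<close>-module \<open>M\<close>.\<close>

definition underlying_space ::
  "('k, 'x) ring_scheme \<Rightarrow> ('g, 'y) monoid_scheme \<Rightarrow> ('g \<Rightarrow> 'k, 'm) module \<Rightarrow> 'm set \<Rightarrow> ('k, 'm) module" where
  "underlying_space k G M N =
     \<lparr>carrier = N, monoid.mult = monoid.mult M, one = one M, ring.zero = ring.zero M, ring.add = ring.add M,
      smult = (\<lambda>c x. group_ring_scalar k G c \<odot>\<^bsub>M\<^esub> x)\<rparr>"

text \<open>The conjunct \<^const>\<open>vectorspace.fin_dim\<close> is needed because \<^const>\<open>vectorspace.dim\<close>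
  is unspecified on infinite-dimensional spaces.\<close>

definition submodule_dim ::
  "('k, 'x) ring_scheme \<Rightarrow> ('g, 'y) monoid_scheme \<Rightarrow> ('g \<Rightarrow> 'k, 'm) module \<Rightarrow> 'm set \<Rightarrow> nat \<Rightarrow> bool" where
  "submodule_dim k G M N d \<longleftrightarrow> vectorspace.fin_dim k (underlying_space k G M N) \<and>
     vectorspace.dim k (underlying_space k G M N) = d"

definition cyclic_submodule ::
  "('r, 'x) ring_scheme \<Rightarrow> ('r, 'm, 'y) module_scheme \<Rightarrow> 'm set \<Rightarrow> bool" where
  "cyclic_submodule R M N \<longleftrightarrow> (\<exists>x\<in>carrier M. N = (\<lambda>r. r \<odot>\<^bsub>M\<^esub> x) ` carrier R)"

text \<open>\<open>S\<close> is the internal direct sum of the submodules \<open>N i\<close>, \<open>i \<in> I\<close>: every element of \<open>S\<close>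
  is the sum of exactly one finitely supported family of elements of the \<open>N i\<close>, and every
  such sum lies in \<open>S\<close>. The index set may be infinite or empty.\<close>

definition internal_direct_sum ::
  "('r, 'x) ring_scheme \<Rightarrow> ('r, 'm, 'y) module_scheme \<Rightarrow> 'i set \<Rightarrow> ('i \<Rightarrow> 'm set) \<Rightarrow> 'm set \<Rightarrow> bool" where
  "internal_direct_sum R M I N S \<longleftrightarrow> (\<forall>i\<in>I. Module.submodule (N i) R M) \<and>
     bij_betw (\<lambda>x. \<Oplus>\<^bsub>M\<^esub>i\<in>{i \<in> I. x i \<noteq> \<zero>\<^bsub>M\<^esub>}. x i)
       {x \<in> \<Pi>\<^sub>E i\<in>I. N i. finite {i \<in> I. x i \<noteq> \<zero>\<^bsub>M\<^esub>}} S"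


section \<open>The module of power classes\<close>

definition power_subgroup :: "nat \<Rightarrow> ('a, 'b) ring_scheme \<Rightarrow> 'a set" where
  "power_subgroup p K = (\<lambda>x. x [^]\<^bsub>K\<^esub> p) ` carrier (mult_of K)"

definition power_class_group :: "nat \<Rightarrow> ('a, 'b) ring_scheme \<Rightarrow> 'a set monoid" where
  "power_class_group p K = mult_of K Mod power_subgroup p K"

text \<open>The power classes represented by an element of \<open>L - {0}\<close>, for a subfield \<open>L\<close> of \<open>K\<close>.\<close>

definition classes_of :: "nat \<Rightarrow> ('a, 'b) ring_scheme \<Rightarrow> 'a set \<Rightarrow> 'a set set" where
  "classes_of p K L = (\<lambda>x. power_subgroup p K #>\<^bsub>mult_of K\<^esub> x) ` (L - {\<zero>\<^bsub>K\<^esub>})"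

text \<open>For \<open>p\<close> prime and \<open>K/F\<close> finite Galois with group \<open>G\<close>, the group of \<open>p\<close>-th power classes as
  a module over \<open>group_ring (residue_ring p) G\<close>. The group is multiplicative, but
  becomes the additive group of the module record; the ring multiplication fields of that
  record play no role. An automorphism \<open>g\<close> preserves the subgroup of \<open>p\<close>-th powers, so the
  image of the coset of \<open>x\<close> under \<open>g\<close> is the coset of \<open>g x\<close>. A coefficient in
  \<open>{0..p - 1}\<close> acts as an exponent.\<close>

definition power_class_module ::
  "nat \<Rightarrow> ('a, 'b) ring_scheme \<Rightarrow> 'a set \<Rightarrow> (('a \<Rightarrow> 'a) \<Rightarrow> int, 'a set) module" where
  "power_class_module p K F =
     \<lparr>carrier = carrier (power_class_group p K),
      monoid.mult = undefined, one = undefined,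
      ring.zero = \<one>\<^bsub>power_class_group p K\<^esub>,
      ring.add = monoid.mult (power_class_group p K),
      smult = (\<lambda>a c. \<Otimes>\<^bsub>power_class_group p K\<^esub>g\<in>carrier (galois_group K F).
        (g ` c) [^]\<^bsub>power_class_group p K\<^esub> a g)\<rparr>"

definition fixed_classes :: "nat \<Rightarrow> ('a, 'b) ring_scheme \<Rightarrow> ('a \<Rightarrow> 'a) set \<Rightarrow> 'a set set" where
  "fixed_classes p K H = {c \<in> carrier (power_class_group p K). \<forall>h\<in>H. h ` c = c}"

end

theory Submission
  imports Defs "HOL-Computational_Algebra.Polynomial"
begin

text \<open>
  Write \<open>T = \<sigma> - 1\<close> on the power classes \<open>J\<close>. Since \<open>p\<close> annihilates \<open>J\<close>, \<open>T\<^sup>q = \<sigma>\<^sup>q - 1\<close> and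
  \<open>T\<^bsup>q-1\<^esup> = 1 + \<sigma> + \<dots> + \<sigma>\<^bsup>q-1\<^esup>\<close> for every power \<open>q\<close> of \<open>p\<close>.

  If \<open>h\<close> generates \<open>H\<^sub>i\<close> and fixes the class of \<open>\<gamma>\<close>, then \<open>h \<gamma> = \<gamma> \<lambda>\<^sup>p\<close>, and the norm of \<open>\<lambda>\<close> to \<open>K\<^sub>i\<close>
  is a \<open>p\<close>-th root of unity. The hypotheses force it to be \<open>1\<close>, so Hilbert 90 moves \<open>\<gamma>\<close> into \<open>K\<^sub>i\<close>
  modulo \<open>p\<close>-th powers.

  The dimensions of the cyclic summands are the numbers \<open>m\<close> at which \<open>ker T \<inter> im T\<^bsup>m-1\<^esup>\<close> drops, so it
  suffices that this space does not change for \<open>p\<^bsup>i-1\<^esup> < m \<le> p\<^sup>i\<close>. This is vacuous in case (ii). In case (i),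
  let \<open>\<rho>\<close> be the \<open>p\<^bsup>i-1\<^esup>\<close>-th power of \<open>\<sigma>\<close>, and suppose that \<open>\<rho> - 1\<close> maps the class of \<open>\<delta>\<close> to a class fixed
  by \<open>\<sigma>\<close>. We may take \<open>\<delta>\<close> in \<open>K\<^sub>i\<close> and get \<open>\<rho> \<delta> = \<delta> f \<lambda>\<^sup>p\<close> with \<open>f\<close> in \<open>F\<close>. Taking norms to \<open>K\<^bsub>i-1\<^esub>\<close> shows
  that \<open>f\<close> is the norm of \<open>\<mu> = \<lambda>\<^bsup>-1\<^esup>\<close>. Now \<open>\<sigma> \<mu> / \<mu>\<close> has norm \<open>1\<close>, hence equals \<open>\<rho> \<nu> / \<nu>\<close> by Hilbert 90,
  which means that \<open>\<mu>\<close> is the product of the \<open>\<sigma>\<^sup>k \<nu>\<close>, \<open>k < p\<^bsup>i-1\<^esup>\<close>, and some \<open>b\<close> in \<open>F\<close>. So \<open>f\<close> is \<open>b\<^sup>p\<close> times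
  the norm of \<open>\<nu>\<close> from \<open>K\<^sub>i\<close> to \<open>F\<close>, and its class is the image of the class of \<open>\<nu>\<close> under the
  \<open>(p\<^sup>i - 1)\<close>-th power of \<open>T\<close>.
\<close>

section \<open>Elementary abelian groups with a nilpotent endomorphism\<close>

lemma (in comm_monoid) finprod_lessThan_Suc_shift:
  assumes "\<And>j. j < Suc n \<Longrightarrow> f j \<in> carrier G"
  shows "finprod G f {..<Suc n} = f 0 \<otimes> finprod G (\<lambda>j. f (Suc j)) {..<n}"
proof -
  have "finprod G f (insert 0 (Suc ` {..<n})) = f 0 \<otimes> finprod G f (Suc ` {..<n})"
    using assms by (intro finprod_insert) auto
  also have "finprod G f (Suc ` {..<n}) = finprod G (\<lambda>j. f (Suc j)) {..<n}"
    using assms by (intro finprod_reindex) auto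
  finally show ?thesis by (simp add: lessThan_Suc_eq_insert_0)
qed

section \<open>Independent families of subgroups and internal direct sums\<close>

context comm_group
begin

text \<open>Directness of the sum of the \<open>N i\<close>. Products over finite \<open>J\<close>
  stand for finitely supported families, so infinitely many summands are covered.\<close>

definition independent_family :: "'i set \<Rightarrow> ('i \<Rightarrow> 'a set) \<Rightarrow> bool" where
  "independent_family I N \<longleftrightarrow> (\<forall>J y. finite J \<and> J \<subseteq> I \<and> (\<forall>j\<in>J. y j \<in> N j) \<and> finprod G y J = \<one>
     \<longrightarrow> (\<forall>j\<in>J. y j = \<one>))"

lemma independent_familyD:
  assumes "independent_family I N" "finite J" "J \<subseteq> I" "\<And>j. j \<in> J \<Longrightarrow> y j \<in> N j" "finprod G y J = \<one>" "j \<in> J"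
  shows "y j = \<one>"
  using assms unfolding independent_family_def by blast

lemma finprod_cong_one:
  assumes "finite B" "A \<subseteq> B" "\<And>i. i \<in> B \<Longrightarrow> f i \<in> carrier G" "\<And>i. i \<in> B - A \<Longrightarrow> f i = \<one>"
  shows "finprod G f A = finprod G f B"
proof -
  have "finprod G f B = finprod G f (A \<union> (B - A))" using assms(2) by (simp add: Un_absorb1)
  also have "\<dots> = finprod G f A \<otimes> finprod G f (B - A)"
    using assms finite_subset by (intro finprod_Un_disjoint) auto
  also have "finprod G f (B - A) = \<one>" using assms(4) by (intro finprod_one_eqI) auto
  finally show ?thesis using assms by (simp add: finprod_closed Pi_iff subset_iff)
qed

lemma finprod_in_subgroup:
  assumes "subgroup H G" "\<And>i. i \<in> I \<Longrightarrow> f i \<in> H"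
  shows "finprod G f I \<in> H"
  using assms(2)
proof (induction I rule: infinite_finite_induct)
  case (infinite A) then show ?case using assms(1) by (simp add: subgroup.one_closed)
next
  case empty then show ?case using assms(1) by (simp add: subgroup.one_closed)
next
  case (insert x F)
  have "f \<in> insert x F \<rightarrow> carrier G" using insert.prems subgroup.mem_carrier[OF assms(1)] by auto
  then show ?case using insert assms(1) by (simp add: Pi_iff subgroup.m_closed)
qed

text \<open>The extra clauses make \<open>y\<close> total: it has values in the group everywhere and
  is trivial off \<open>J\<close>, so two such products extend to \<open>J1 \<union> J2\<close> and
  multiply there.\<close>

lemma generate_Union_finprod:
  assumes N: "\<And>i. i \<in> I \<Longrightarrow> subgroup (N i) G"
    and s: "s \<in> generate G (\<Union>i\<in>I. N i)"
  obtains J y where "finite J" "J \<subseteq> I" "\<forall>i. y i \<in> carrier G" "\<forall>i\<in>I. y i \<in> N i"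
    "\<forall>i. i \<notin> J \<longrightarrow> y i = \<one>" "s = finprod G y J"
proof -
  have "\<exists>J y. finite J \<and> J \<subseteq> I \<and> (\<forall>i. y i \<in> carrier G) \<and> (\<forall>i\<in>I. y i \<in> N i) \<and>
    (\<forall>i. i \<notin> J \<longrightarrow> y i = \<one>) \<and> s = finprod G y J"
    using s
  proof (induction rule: generate.induct)
    case one
    then show ?case
      using N by (intro exI[of _ "{}"] exI[of _ "\<lambda>_. \<one>"]) (auto simp: subgroup.one_closed)
  next
    case (incl h)
    then obtain i where i: "i \<in> I" "h \<in> N i" by auto
    then have "h \<in> carrier G" using N subgroup.mem_carrier by metis
    with i show ?case using N
      by (intro exI[of _ "{i}"] exI[of _ "\<lambda>j. if j = i then h else \<one>"]) (auto simp: subgroup.one_closed)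
  next
    case (inv h)
    then obtain i where i: "i \<in> I" "h \<in> N i" by auto
    then have "h \<in> carrier G" using N subgroup.mem_carrier by metis
    with i show ?case using N
      by (intro exI[of _ "{i}"] exI[of _ "\<lambda>j. if j = i then inv h else \<one>"])
        (auto simp: subgroup.one_closed subgroup.m_inv_closed)
  next
    case (eng h1 h2)
    obtain J1 y1 where
      1: "finite J1" "J1 \<subseteq> I" "\<forall>i. y1 i \<in> carrier G" "\<forall>i\<in>I. y1 i \<in> N i" "\<forall>i. i \<notin> J1 \<longrightarrow> y1 i = \<one>" "h1 = finprod G y1 J1"
      using eng.IH(1) by (elim exE conjE)
    obtain J2 y2 where
      2: "finite J2" "J2 \<subseteq> I" "\<forall>i. y2 i \<in> carrier G" "\<forall>i\<in>I. y2 i \<in> N i" "\<forall>i. i \<notin> J2 \<longrightarrow> y2 i = \<one>" "h2 = finprod G y2 J2"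
      using eng.IH(2) by (elim exE conjE)
    have "h1 = finprod G y1 (J1 \<union> J2)" unfolding 1(6) using 1 2 by (intro finprod_cong_one) auto
    moreover have "h2 = finprod G y2 (J1 \<union> J2)"
      unfolding 2(6) using 1 2 by (intro finprod_cong_one) auto
    ultimately have "h1 \<otimes> h2 = finprod G (\<lambda>i. y1 i \<otimes> y2 i) (J1 \<union> J2)"
      using 1(3) 2(3) by (simp add: finprod_multf Pi_iff)
    then show ?case using 1 2 N
      by (intro exI[of _ "J1 \<union> J2"] exI[of _ "\<lambda>i. y1 i \<otimes> y2 i"]) (auto simp: subgroup.m_closed)
  qed
  then show thesis using that by (elim exE conjE)
qed

text \<open>This has the shape of the bijection in \<open>internal_direct_sum\<close>. Injectivity
  comes from the quotient of two families with equal product, surjectivity from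
  \<open>generate_Union_finprod\<close>.\<close>

lemma independent_family_bij_betw:
  assumes N: "\<And>i. i \<in> I \<Longrightarrow> subgroup (N i) G" and ind: "independent_family I N"
  shows "bij_betw (\<lambda>x. finprod G x {i \<in> I. x i \<noteq> \<one>})
    {x \<in> \<Pi>\<^sub>E i\<in>I. N i. finite {i \<in> I. x i \<noteq> \<one>}} (generate G (\<Union>i\<in>I. N i))"
  unfolding bij_betw_def
proof
  have Nc: "x \<in> N i \<Longrightarrow> i \<in> I \<Longrightarrow> x \<in> carrier G" for x i using N subgroup.mem_carrier by metis
  show "inj_on (\<lambda>x. finprod G x {i \<in> I. x i \<noteq> \<one>}) {x \<in> \<Pi>\<^sub>E i\<in>I. N i. finite {i \<in> I. x i \<noteq> \<one>}}"
  proof (rule inj_onI, clarsimp)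
    fix x y
    assume x: "x \<in> (\<Pi>\<^sub>E i\<in>I. N i)" "finite {i \<in> I. x i \<noteq> \<one>}"
      and y: "y \<in> (\<Pi>\<^sub>E i\<in>I. N i)" "finite {i \<in> I. y i \<noteq> \<one>}"
      and eq: "finprod G x {i \<in> I. x i \<noteq> \<one>} = finprod G y {i \<in> I. y i \<noteq> \<one>}"
    \<comment> \<open>Both products are extended to the union of the two supports, so that the
      families can be divided pointwise.\<close>
    let ?J = "{i \<in> I. x i \<noteq> \<one>} \<union> {i \<in> I. y i \<noteq> \<one>}"
    have xN: "x i \<in> N i" and yN: "y i \<in> N i" if "i \<in> I" for i using x y that by auto
    have xc: "x i \<in> carrier G" and yc: "y i \<in> carrier G"
      if "i \<in> I" for i using Nc xN yN that by auto
    have "finprod G x {i \<in> I. x i \<noteq> \<one>} = finprod G x ?J"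
      using x y xc by (intro finprod_cong_one) auto
    moreover have "finprod G y {i \<in> I. y i \<noteq> \<one>} = finprod G y ?J"
      using x y yc by (intro finprod_cong_one) auto
    ultimately have e: "finprod G x ?J = finprod G y ?J" using eq by simp
    have "finprod G (\<lambda>i. x i \<otimes> inv (y i)) ?J \<otimes> finprod G y ?J = finprod G (\<lambda>i. x i \<otimes> inv (y i) \<otimes> y i) ?J"
      using xc yc by (subst finprod_multf) auto
    also have "\<dots> = finprod G x ?J" using xc yc by (intro finprod_cong') (auto simp: m_assoc)
    finally have "finprod G (\<lambda>i. x i \<otimes> inv (y i)) ?J = finprod G x ?J \<otimes> inv (finprod G y ?J)"
      using xc yc by (intro inv_solve_right[THEN iffD2]) (auto intro!: finprod_closed)
    also have "\<dots> = \<one>" unfolding e using yc by (intro r_inv finprod_closed) auto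
    finally have one: "\<forall>i\<in>?J. x i \<otimes> inv (y i) = \<one>"
      using x(2) y(2) xN yN N
      by (intro ballI independent_familyD[OF ind, of ?J "\<lambda>i. x i \<otimes> inv (y i)"])
        (auto intro!: subgroup.m_closed subgroup.m_inv_closed)
    have eq': "x i = y i" if "i \<in> ?J" for i
    proof -
      have i: "i \<in> I" using that by auto
      have "x i \<otimes> inv (y i) = \<one>" using one that by blast
      then show ?thesis using xc[OF i] yc[OF i] inv_solve_right[of \<one> "x i" "y i"] by simp
    qed
    have "x i = y i" if "i \<in> I" for i using eq'[of i] that by (cases "x i = \<one> \<and> y i = \<one>") auto
    then show "x = y" using x(1) y(1) by (meson PiE_ext)
  qed
  show "(\<lambda>x. finprod G x {i \<in> I. x i \<noteq> \<one>}) ` {x \<in> \<Pi>\<^sub>E i\<in>I. N i. finite {i \<in> I. x i \<noteq> \<one>}} = generate G (\<Union>i\<in>I. N i)"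
  proof (intro equalityI subsetI)
    fix s assume "s \<in> (\<lambda>x. finprod G x {i \<in> I. x i \<noteq> \<one>}) ` {x \<in> \<Pi>\<^sub>E i\<in>I. N i. finite {i \<in> I. x i \<noteq> \<one>}}"
    then obtain x where x: "x \<in> (\<Pi>\<^sub>E i\<in>I. N i)" "s = finprod G x {i \<in> I. x i \<noteq> \<one>}" by auto
    have "subgroup (generate G (\<Union>i\<in>I. N i)) G" using Nc by (intro generate_is_subgroup) blast
    moreover have "x i \<in> generate G (\<Union>i\<in>I. N i)" if "i \<in> {i \<in> I. x i \<noteq> \<one>}" for i
      using x(1) that by (intro generate.incl) auto
    ultimately show "s \<in> generate G (\<Union>i\<in>I. N i)" unfolding x(2) by (rule finprod_in_subgroup)
  next
    fix s assume s: "s \<in> generate G (\<Union>i\<in>I. N i)"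
    obtain J y where J: "finite J" "J \<subseteq> I" "\<forall>i. y i \<in> carrier G" "\<forall>i\<in>I. y i \<in> N i"
      "\<forall>i. i \<notin> J \<longrightarrow> y i = \<one>" "s = finprod G y J"
      by (rule generate_Union_finprod[OF N s])
    let ?x = "restrict y I"
    have "{i \<in> I. ?x i \<noteq> \<one>} \<subseteq> J" using J(5) by auto
    then have fin: "finite {i \<in> I. ?x i \<noteq> \<one>}" using J(1) finite_subset by blast
    have "finprod G ?x {i \<in> I. ?x i \<noteq> \<one>} = finprod G y {i \<in> I. ?x i \<noteq> \<one>}"
      using J(3) by (intro finprod_cong') auto
    also have "\<dots> = finprod G y J"
    proof (rule finprod_cong_one[OF J(1)])
      show "{i \<in> I. ?x i \<noteq> \<one>} \<subseteq> J" using J(5) by auto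
      show "y i = \<one>" if "i \<in> J - {i \<in> I. ?x i \<noteq> \<one>}" for i using that J(2) by auto
    qed (use J(3) in blast)
    finally have "s = finprod G ?x {i \<in> I. ?x i \<noteq> \<one>}" using J(6) by simp
    then show "s \<in> (\<lambda>x. finprod G x {i \<in> I. x i \<noteq> \<one>}) ` {x \<in> \<Pi>\<^sub>E i\<in>I. N i. finite {i \<in> I. x i \<noteq> \<one>}}"
      using fin J(4) by (intro image_eqI[of _ _ ?x]) auto
  qed
qed

text \<open>Two equal summands with distinct indices would give the relation
  \<open>x \<otimes> inv x = \<one>\<close> with \<open>x \<noteq> \<one>\<close>. This allows the
  summands to be indexed by themselves.\<close>

lemma independent_family_inj_on:
  assumes N: "\<And>i. i \<in> I \<Longrightarrow> subgroup (N i) G" and nt: "\<And>i. i \<in> I \<Longrightarrow> \<exists>x\<in>N i. x \<noteq> \<one>"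
    and ind: "independent_family I N"
  shows "inj_on N I"
proof (rule inj_onI, rule ccontr)
  fix i j assume ij: "i \<in> I" "j \<in> I" "N i = N j" "i \<noteq> j"
  obtain x where x: "x \<in> N i" "x \<noteq> \<one>" using nt ij by blast
  then have xc: "x \<in> carrier G" using N ij subgroup.mem_carrier by metis
  let ?y = "\<lambda>k. if k = i then x else inv x"
  have "finprod G ?y {i, j} = \<one>" using ij xc by auto
  then have "?y i = \<one>"
    using ij x N
      by (intro independent_familyD[OF ind, of "{i,j}" ?y]) (auto simp: subgroup.m_inv_closed)
  then show False using x by simp
qed

lemma independent_family_image:
  assumes "independent_family I N" "inj_on N I" "\<And>i. i \<in> I \<Longrightarrow> N i \<subseteq> carrier G"
  shows "independent_family (N ` I) (\<lambda>M. M)"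
  unfolding independent_family_def
proof (intro allI impI, elim conjE)
  fix J y assume J: "finite J" "J \<subseteq> N ` I" "\<forall>M\<in>J. y M \<in> M" "finprod G y J = \<one>"
  obtain J' where J': "J' \<subseteq> I" "J = N ` J'" using J(2) by (metis subset_imageE)
  have inj: "inj_on N J'" using assms(2) J'(1) inj_on_subset by blast
  have f: "finite J'" using finite_imageD[of N J'] J(1) J'(2) inj by simp
  have "y \<in> N ` J' \<rightarrow> carrier G" using J(3) J' assms(3) by blast
  then have "finprod G (\<lambda>i. y (N i)) J' = finprod G y J"
    unfolding J'(2) by (rule finprod_reindex[OF _ inj, symmetric])
  then have "y (N i) = \<one>" if "i \<in> J'" for i
    using independent_familyD[OF assms(1) f J'(1) _ _ that, of "\<lambda>i. y (N i)"] J(3,4) J'(2) by simp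
  then show "\<forall>j\<in>J. y j = \<one>" unfolding J'(2) by blast
qed

end

section \<open>Abelian groups of exponent \<open>p\<close> as vector spaces over the field with
  \<open>p\<close> elements\<close>

locale elementary_abelian = comm_group A for A (structure) +
  fixes p :: nat
  assumes prime_p: "Factorial_Ring.prime p"
    and exponent: "x \<in> carrier A \<Longrightarrow> x [^] p = \<one>"
begin

lemma coprime_int_prime:
  assumes "\<not> int p dvd k"
  shows "coprime k (int p)"
proof -
  have "Factorial_Ring.prime (int p)" using prime_p by simp
  then show ?thesis using assms prime_imp_coprime coprime_commute by blast
qed

lemma int_pow_dvd:
  assumes "x \<in> carrier A" "int p dvd k"
  shows "x [^] k = \<one>"
proof -
  obtain l where "k = int p * l" using assms(2) by blast
  then have "x [^] k = (x [^] int p) [^] l" using assms(1) by (simp add: int_pow_pow)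
  then show ?thesis using assms(1) exponent by (simp add: int_pow_int)
qed

lemma int_pow_eq_one_iff:
  assumes "x \<in> carrier A" "x \<noteq> \<one>"
  shows "x [^] k = \<one> \<longleftrightarrow> int p dvd k"
proof
  assume k: "x [^] k = \<one>"
  show "int p dvd k"
  proof (rule ccontr)
    assume "\<not> int p dvd k"
    then have "coprime k (int p)" by (rule coprime_int_prime)
    then obtain u v where uv: "u * k + v * int p = 1" by (metis bezout_int coprime_imp_gcd_eq_1)
    have "x = x [^] (u * k + v * int p)" unfolding uv using assms by simp
    also have "\<dots> = (x [^] k) [^] u \<otimes> x [^] (v * int p)"
      using assms by (simp add: int_pow_mult int_pow_pow mult.commute)
    also have "\<dots> = \<one>" using k assms int_pow_dvd by simp
    finally show False using assms by simp
  qed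
qed (use assms int_pow_dvd in auto)

lemma subgroup_int_pow_mem:
  assumes "subgroup H A" "x \<in> carrier A" "x [^] (k::int) \<in> H" "\<not> int p dvd k"
  shows "x \<in> H"
proof -
  have "coprime k (int p)" using assms(4) by (rule coprime_int_prime)
  then obtain u v where uv: "u * k + v * int p = 1" by (metis bezout_int coprime_imp_gcd_eq_1)
  have "x = x [^] (u * k + v * int p)" unfolding uv using assms by simp
  also have "\<dots> = (x [^] k) [^] u"
    using assms int_pow_dvd[of x "v * int p"] by (simp add: int_pow_mult int_pow_pow mult.commute)
  finally show ?thesis using subgroup_int_pow_closed[OF assms(1) assms(3)] by metis
qed

text \<open>Over the field with \<open>p\<close> elements, \<open>B\<close> maps to a basis of the
  span of \<open>S\<close> modulo \<open>H\<close>; vanishing of a coefficient is divisibility of an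
  integer exponent by \<open>p\<close>. Zorn's lemma gives a maximal subset independent modulo
  \<open>H\<close>, and maximality forces spanning.\<close>

lemma complement_basis:
  assumes H: "subgroup H A" and S: "S \<subseteq> carrier A"
  obtains B where "B \<subseteq> S"
    "\<forall>J c. finite J \<and> J \<subseteq> B \<and> finprod A (\<lambda>b. b [^] (c b :: int)) J \<in> H \<longrightarrow> (\<forall>b\<in>J. int p dvd c b)"
    "S \<subseteq> generate A (H \<union> B)"
proof -
  define P where "P B \<longleftrightarrow> B \<subseteq> S \<and> (\<forall>J c. finite J \<and> J \<subseteq> B \<and>
     finprod A (\<lambda>b. b [^] (c b :: int)) J \<in> H \<longrightarrow> (\<forall>b\<in>J. int p dvd c b))" for B
  have "\<exists>M\<in>Collect P. \<forall>Z\<in>Collect P. M \<subseteq> Z \<longrightarrow> Z = M"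
  proof (rule subset_Zorn_nonempty)
    have "P {}" unfolding P_def by auto
    then show "Collect P \<noteq> {}" by blast
  next
    fix \<C> assume C: "\<C> \<noteq> {}" "subset.chain (Collect P) \<C>"
    then have CP: "\<And>B. B \<in> \<C> \<Longrightarrow> P B" unfolding subset.chain_def by blast
    have "P (\<Union>\<C>)" unfolding P_def
    proof (intro conjI allI impI, goal_cases)
      case 1 then show ?case using CP unfolding P_def by blast
    next
      case (2 J c)
      \<comment> \<open>A relation is finite, so it already lives in one member of the
        chain.\<close>
      then obtain B where "B \<in> \<C>" "J \<subseteq> B"
        using finite_subset_Union_chain[OF _ _ C] by metis
      then show ?case using CP[of B] 2 unfolding P_def by blast
    qed
    then show "\<Union>\<C> \<in> Collect P" by simp
  qed
  then obtain B where B: "P B" and max: "\<And>Z. P Z \<Longrightarrow> B \<subseteq> Z \<Longrightarrow> Z = B" by auto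
  have BS: "B \<subseteq> S" using B P_def by blast
  have Bc: "B \<subseteq> carrier A" using BS S by blast
  have HB: "H \<union> B \<subseteq> carrier A" using Bc subgroup.subset[OF H] by blast
  note gen = generate_is_subgroup[OF HB]
  have "s \<in> generate A (H \<union> B)" if s: "s \<in> S" for s
  proof (rule ccontr)
    assume ns: "s \<notin> generate A (H \<union> B)"
    have sB: "s \<notin> B" using ns generate.incl[of s "H \<union> B" A] by auto
    have sc: "s \<in> carrier A" using s S by blast
    have "P (insert s B)" unfolding P_def
    proof (intro conjI allI impI, goal_cases)
      case 1 then show ?case using s BS by blast
    next
      case (2 J c)
      let ?f = "\<lambda>b. b [^] (c b :: int)"
      have J: "finite J" "J \<subseteq> insert s B" "finprod A ?f J \<in> H" using 2 by auto
      have fJ: "finite (J - {s})" "J - {s} \<subseteq> B" using J by auto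
      have fc: "?f b \<in> carrier A" if "b \<in> J" for b using that J Bc sc by auto
      show ?case
      proof (cases "s \<in> J")
        case False
        then have "J \<subseteq> B" using J by blast
        then show ?thesis using B J unfolding P_def by blast
      next
        case True
        have sp: "finprod A ?f J = ?f s \<otimes> finprod A ?f (J - {s})"
          using J fc True finprod_insert[of "J - {s}" s ?f] by (simp add: insert_absorb Pi_iff)
        have g: "finprod A ?f (J - {s}) \<in> generate A (H \<union> B)"
          using fJ
            by (intro finprod_in_subgroup[OF gen] subgroup_int_pow_closed[OF gen] generate.incl) auto
        have "?f s = finprod A ?f J \<otimes> inv (finprod A ?f (J - {s}))"
          unfolding sp using fc True by (simp add: m_assoc finprod_closed Pi_iff)
        also have "\<dots> \<in> generate A (H \<union> B)"
          using g J(3)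
            by (intro subgroup.m_closed[OF gen] subgroup.m_inv_closed[OF gen]) (auto intro: generate.incl)
        \<comment> \<open>A power of \<open>s\<close> lies in the span; an exponent prime to
          \<open>p\<close> is invertible modulo \<open>p\<close> and would put \<open>s\<close>
          itself there.\<close>
        finally have "int p dvd c s" using subgroup_int_pow_mem[OF gen sc] ns by blast
        moreover from this have "finprod A ?f (J - {s}) = finprod A ?f J"
          unfolding sp using fc sc int_pow_dvd by (simp add: finprod_closed Pi_iff)
        then have "\<forall>b\<in>J - {s}. int p dvd c b" using B fJ J(3) unfolding P_def by metis
        ultimately show ?thesis by blast
      qed
    qed
    then show False using max[of "insert s B"] sB by blast
  qed
  then have "S \<subseteq> generate A (H \<union> B)" by blast
  with B show thesis unfolding P_def by (elim conjE) (rule that)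
qed

end

section \<open>An endomorphism and the action of polynomials in it\<close>

locale elementary_abelian_endo = elementary_abelian +
  fixes T :: "'a \<Rightarrow> 'a"
  assumes T_hom: "T \<in> hom A A"
begin

lemma T_closed [simp]: "x \<in> carrier A \<Longrightarrow> T x \<in> carrier A"
  using T_hom by (rule hom_in_carrier)

lemma T_mult: "x \<in> carrier A \<Longrightarrow> y \<in> carrier A \<Longrightarrow> T (x \<otimes> y) = T x \<otimes> T y"
  using T_hom by (rule hom_mult)

lemma T_one [simp]: "T \<one> = \<one>"
  using T_hom is_group by (simp add: hom_one)

lemma T_int_pow: "x \<in> carrier A \<Longrightarrow> T (x [^] (k::int)) = T x [^] k"
  using T_hom is_group by (simp add: hom_int_pow)

lemma Tpow_closed [simp]: "x \<in> carrier A \<Longrightarrow> (T ^^ k) x \<in> carrier A"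
  by (induction k) auto

lemma Tpow_one [simp]: "(T ^^ k) \<one> = \<one>"
  by (induction k) auto

lemma Tpow_mult: "x \<in> carrier A \<Longrightarrow> y \<in> carrier A \<Longrightarrow> (T ^^ k) (x \<otimes> y) = (T ^^ k) x \<otimes> (T ^^ k) y"
  by (induction k) (auto simp: T_mult)

lemma Tpow_hom: "T ^^ k \<in> hom A A"
  by (rule homI) (auto simp: Tpow_mult)

lemma Tpow_int_pow: "x \<in> carrier A \<Longrightarrow> (T ^^ k) (x [^] (c::int)) = (T ^^ k) x [^] c"
  by (induction k) (auto simp: T_int_pow)

lemma Tpow_inv: "x \<in> carrier A \<Longrightarrow> (T ^^ k) (inv x) = inv ((T ^^ k) x)"
  using Tpow_int_pow[of x k "-1"] by (simp add: int_pow_neg)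

lemma Tpow_finprod:
  assumes "\<And>i. i \<in> I \<Longrightarrow> y i \<in> carrier A"
  shows "(T ^^ k) (finprod A y I) = finprod A (\<lambda>i. (T ^^ k) (y i)) I"
  using assms by (induction I rule: infinite_finite_induct) (auto simp: Tpow_mult Pi_iff)

lemma generate_T_stable:
  assumes "H \<subseteq> carrier A" "\<And>y. y \<in> H \<Longrightarrow> T y \<in> H" "y \<in> generate A H"
  shows "T y \<in> generate A H"
  using assms(3)
proof (induction rule: generate.induct)
  case (inv h)
  then have "T (inv h) = inv (T h)" using Tpow_inv[of h 1] assms(1) by auto
  then show ?case using assms(2)[OF inv] by (simp add: generate.inv)
next
  case (eng h1 h2)
  then show ?case using generate_in_carrier[OF assms(1)] by (simp add: T_mult generate.eng)
qed (auto intro: generate.one generate.incl assms(2))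

text \<open>The action of \<open>\<int>[X]\<close> on \<open>A\<close> in which the indeterminate acts as \<open>T\<close>.\<close>

definition act :: "int poly \<Rightarrow> 'a \<Rightarrow> 'a" where
  "act f x = fold_coeffs (\<lambda>a y. x [^] a \<otimes> T y) f \<one>"

lemma act_0 [simp]: "act 0 x = \<one>"
  by (simp add: act_def)

lemma act_pCons:
  assumes "x \<in> carrier A"
  shows "act (pCons a f) x = x [^] a \<otimes> T (act f x)"
  using assms by (cases "a = 0 \<and> f = 0") (auto simp: act_def)

lemma act_closed [simp]: "x \<in> carrier A \<Longrightarrow> act f x \<in> carrier A"
  by (induction f) (auto simp: act_pCons)

lemma act_add: "x \<in> carrier A \<Longrightarrow> act (f + g) x = act f x \<otimes> act g x"
proof (induction f g rule: poly_induct2)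
  case 0 then show ?case by simp
next
  case (pCons a f b g)
  then show ?case by (simp add: act_pCons int_pow_mult T_mult m_ac)
qed

lemma act_smult: "x \<in> carrier A \<Longrightarrow> act (smult c f) x = act f x [^] c"
  by (induction f) (auto simp: act_pCons int_pow_distrib int_pow_pow T_int_pow mult.commute)

lemma act_one [simp]: "x \<in> carrier A \<Longrightarrow> act 1 x = x"
  by (simp add: act_pCons one_pCons)

lemma act_mult:
  assumes "x \<in> carrier A"
  shows "act (f * g) x = act f (act g x)"
proof (induction f)
  case 0 then show ?case by simp
next
  case (pCons a f)
  have "pCons a f * g = smult a g + pCons 0 (f * g)" by simp
  then show ?case using assms pCons by (simp add: act_add act_smult act_pCons)
qed

lemma act_group_one [simp]: "act f \<one> = \<one>"
  by (induction f) (auto simp: act_pCons)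

lemma act_X_mult: "x \<in> carrier A \<Longrightarrow> act (pCons 0 f) x = T (act f x)"
  by (simp add: act_pCons)

lemma act_monom: "x \<in> carrier A \<Longrightarrow> act (monom 1 k) x = (T ^^ k) x"
  by (induction k) (auto simp: act_pCons monom_0 monom_Suc)

lemma act_T: "x \<in> carrier A \<Longrightarrow> T (act f x) = act f (T x)"
  by (induction f) (auto simp: act_pCons T_mult T_int_pow)

lemma act_Tpow: "x \<in> carrier A \<Longrightarrow> (T ^^ k) (act f x) = act f ((T ^^ k) x)"
  by (induction k) (auto simp: act_T)

text \<open>The exponent \<open>p\<close> makes the action of integer polynomials factor through
  reduction modulo \<open>p\<close>, so polynomial congruences become identities of
  operators.\<close>

lemma act_dvd:
  assumes "x \<in> carrier A" "[:int p:] dvd f - g"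
  shows "act f x = act g x"
proof -
  obtain h where h: "f - g = [:int p:] * h" using assms(2) by blast
  have "f = g + [:int p:] * h" using h by (metis add.commute diff_add_cancel)
  then have "act f x = act g x \<otimes> act h x [^] int p"
    using assms(1) by (simp add: act_add act_smult)
  then show ?thesis using assms(1) int_pow_dvd[of "act h x" "int p"] by simp
qed

text \<open>Frobenius modulo \<open>p\<close>: the inner binomial coefficients are divisible by
  \<open>p\<close>.\<close>

lemma binomial_dvd: "[:int p:] dvd (1 + f) ^ p - (1 + f ^ p :: int poly)"
proof -
  have p: "p > 0" using prime_p by (simp add: prime_gt_0_nat)
  have e: "{..p} = insert 0 (insert p {1..<p})" using p by auto
  have "(1 + f) ^ p = (f + 1) ^ p" by (simp add: add.commute)
  also have "\<dots> = (\<Sum>k\<le>p. of_nat (p choose k) * f ^ k)" by (simp add: binomial_ring)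
  also have "\<dots> = 1 + f ^ p + (\<Sum>k\<in>{1..<p}. of_nat (p choose k) * f ^ k)"
    unfolding e using p by simp
  finally have "(1 + f) ^ p - (1 + f ^ p) = (\<Sum>k\<in>{1..<p}. of_nat (p choose k) * f ^ k)" by simp
  also have "[:int p:] dvd \<dots>"
  proof (rule dvd_sum)
    fix k assume k: "k \<in> {1..<p}"
    then have "p dvd (p choose k)" using prime_p by (intro dvd_choose_prime) auto
    then obtain m where "p choose k = p * m" by blast
    then have "(of_nat (p choose k) :: int poly) = [:int p:] * of_nat m"
      by (simp add: of_nat_poly)
    then show "[:int p:] dvd of_nat (p choose k) * f ^ k" by (simp only: dvd_triv_left dvd_mult2)
  qed
  finally show ?thesis .
qed

text \<open>Each induction step raises the previous congruence to the \<open>p\<close>-th power and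
  applies Frobenius. When X acts as S - 1, the polynomial \<open>[:1, 1:]\<close> acts as S.\<close>

lemma power_dvd_diff: "[:int p:] dvd [:1, 1:] ^ (p ^ i) - (1 + monom 1 (p ^ i))"
proof (induction i)
  case 0 then show ?case by (simp add: monom_0 monom_Suc one_pCons)
next
  case (Suc i)
  let ?f = "[:1, 1:] ^ (p ^ i) :: int poly" and ?g = "1 + monom 1 (p ^ i) :: int poly"
  have "?f - ?g dvd ?f ^ p - ?g ^ p" by (simp add: power_diff_sumr2)
  then have 1: "[:int p:] dvd ?f ^ p - ?g ^ p" using Suc dvd_trans by blast
  have 2: "[:int p:] dvd ?g ^ p - (1 + monom 1 (p ^ i) ^ p)" by (rule binomial_dvd)
  have "[:int p:] dvd ?f ^ p - (1 + monom 1 (p ^ i) ^ p)"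
    using dvd_add[OF 1 2] by (simp only: diff_add_cancel add_diff_eq)
  then show ?case by (simp add: monom_power mult.commute flip: power_mult)
qed

text \<open>For \<open>q = p ^ i\<close>, multiplying the geometric sum by X gives (1 + X)^q - 1,
  which is congruent to X^q. Cancelling X only shifts coefficients, so divisibility by
  \<open>p\<close> survives.\<close>

lemma geometric_dvd_diff:
  "[:int p:] dvd (\<Sum>k<p ^ i. [:1, 1:] ^ k) - monom 1 (p ^ i - 1)"
proof -
  have p: "p ^ i > 0" using prime_p by (simp add: prime_gt_0_nat)
  let ?h = "(\<Sum>k<p ^ i. [:1, 1:] ^ k) - monom 1 (p ^ i - 1) :: int poly"
  have "[:0,1:] * (\<Sum>k<p ^ i. [:1, 1:] ^ k) = ([:1,1:] ^ (p ^ i) - 1 :: int poly)"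
    using power_diff_1_eq[of "[:1,1:] :: int poly" "p ^ i"] by (simp add: one_pCons)
  moreover have "[:0,1:] * monom 1 (p ^ i - 1) = (monom 1 (p ^ i) :: int poly)"
    using p by (simp flip: monom_Suc)
  moreover have "pCons 0 ?h = [:0,1:] * ?h" by simp
  ultimately have "pCons 0 ?h = [:1,1:] ^ (p ^ i) - (1 + monom 1 (p ^ i))"
    by (simp only: right_diff_distrib diff_diff_eq)
  then have "[:int p:] dvd pCons 0 ?h" using power_dvd_diff by simp
  then have "int p dvd coeff ?h k" for k
    unfolding const_poly_dvd_iff by (metis coeff_pCons_Suc)
  then show ?thesis unfolding const_poly_dvd_iff by blast
qed

lemma act_eq_finprod:
  assumes "x \<in> carrier A" "(T ^^ d) x = \<one>"
  shows "act f x = finprod A (\<lambda>k. (T ^^ k) x [^] coeff f k) {..<d}"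
  using assms
proof (induction d arbitrary: f x)
  case 0 then show ?case by simp
next
  case (Suc d)
  obtain a g where f: "f = pCons a g" by (rule pCons_cases)
  have x: "x \<in> carrier A" "T x \<in> carrier A" using Suc.prems by auto
  have "act f x = x [^] a \<otimes> act g (T x)" unfolding f using x by (simp add: act_pCons act_T)
  also have "act g (T x) = finprod A (\<lambda>k. (T ^^ k) (T x) [^] coeff g k) {..<d}"
    using Suc.prems x by (intro Suc.IH) (simp_all add: funpow_swap1)
  also have "\<dots> = finprod A (\<lambda>k. (T ^^ Suc k) x [^] coeff f (Suc k)) {..<d}"
    unfolding f by (simp add: funpow_swap1)
  also have "x [^] a \<otimes> \<dots> = finprod A (\<lambda>k. (T ^^ k) x [^] coeff f k) {..<Suc d}"
    using x f by (subst finprod_lessThan_Suc_shift) auto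
  finally show ?case .
qed

text \<open>The annihilator of \<open>x\<close> modulo \<open>p\<close> is generated by X^d.
  Applying the highest power of \<open>T\<close> that does not kill \<open>x\<close> isolates the
  constant coefficient, which must vanish modulo \<open>p\<close>; the other coefficients form a
  relation for \<open>T x\<close>, with \<open>d\<close> lowered by one.\<close>

lemma act_eq_one_imp_dvd:
  assumes "x \<in> carrier A" "(T ^^ d) x = \<one>" "(T ^^ (d - 1)) x \<noteq> \<one>" "act f x = \<one>" "k < d"
  shows "int p dvd coeff f k"
  using assms
proof (induction d arbitrary: f x k)
  case 0 then show ?case by simp
next
  case (Suc d)
  obtain a g where f: "f = pCons a g" by (rule pCons_cases)
  have x: "x \<in> carrier A" "T x \<in> carrier A" using Suc.prems by auto
  have "\<one> = (T ^^ d) (act f x)" using Suc.prems by simp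
  also have "\<dots> = act f ((T ^^ d) x)"
    using x by (simp only: act_Tpow)
  also have "\<dots> = (T ^^ d) x [^] a \<otimes> T (act g ((T ^^ d) x))"
    unfolding f using x by (simp add: act_pCons)
  also have "T (act g ((T ^^ d) x)) = act g ((T ^^ Suc d) x)"
    using x by (simp add: act_T)
  also have "\<dots> = \<one>" using Suc.prems by simp
  finally have "(T ^^ d) x [^] a = \<one>" using x by simp
  then have a: "int p dvd a" using int_pow_eq_one_iff[of "(T ^^ d) x" a] Suc.prems x by simp
  show ?case
  proof (cases k)
    case 0 then show ?thesis using a f by simp
  next
    case (Suc j)
    have "act f x = T (act g x)" unfolding f using x a by (simp add: act_pCons int_pow_dvd)
    also have "\<dots> = act g (T x)" using x by (simp add: act_T)
    finally have g1: "act g (T x) = \<one>" using Suc.prems(4) by simp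
    have dj: "j < d" using Suc Suc.prems(5) by simp
    then obtain e where e: "d = Suc e" by (cases d) auto
    have "(T ^^ (d - 1)) (T x) = (T ^^ d) x" unfolding e by (simp add: funpow_swap1)
    then have "int p dvd coeff g j"
      using Suc.prems x g1 dj by (intro Suc.IH[of "T x" g j]) (simp_all add: funpow_swap1)
    then show ?thesis using Suc f by simp
  qed
qed

text \<open>Linear independence of the chain x, T x, ..., T^(d-1) x, obtained by reading the
  exponents as coefficients of a polynomial that kills \<open>x\<close>.\<close>

lemma finprod_Tpow_eq_one:
  assumes "x \<in> carrier A" "(T ^^ d) x = \<one>" "(T ^^ (d - 1)) x \<noteq> \<one>"
    and "finprod A (\<lambda>k. (T ^^ k) x [^] (c k :: int)) {..<d} = \<one>" "k < d"
  shows "int p dvd c k"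
proof -
  define f where "f = Poly (map c [0..<d])"
  have cf: "coeff f k = c k"
    if "k < d" for k unfolding f_def using that by (simp add: nth_default_def)
  have "act f x = finprod A (\<lambda>k. (T ^^ k) x [^] c k) {..<d}"
    unfolding act_eq_finprod[OF assms(1,2)] using cf assms(1) by (intro finprod_cong') auto
  then have "int p dvd coeff f k" using assms by (intro act_eq_one_imp_dvd[of x d]) auto
  then show ?thesis using cf assms(5) by simp
qed

lemma inj_on_Tpow:
  assumes "x \<in> carrier A" "(T ^^ d) x = \<one>" "(T ^^ (d - 1)) x \<noteq> \<one>"
  shows "inj_on (\<lambda>k. (T ^^ k) x) {..<d}"
proof -
  have "\<not> (T ^^ i) x = (T ^^ j) x" if ij: "i < j" "j < d" for i j
  proof
    assume eq: "(T ^^ i) x = (T ^^ j) x"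
    have "act (monom 1 i + smult (-1) (monom 1 j)) x = (T ^^ i) x \<otimes> (T ^^ j) x [^] (-1::int)"
      using assms(1) by (simp only: act_add act_smult act_monom)
    also have "\<dots> = \<one>" unfolding eq using assms(1) by (simp add: int_pow_neg)
    finally have "int p dvd coeff (monom 1 i + smult (-1) (monom 1 j)) i"
      by (rule act_eq_one_imp_dvd[OF assms]) (use ij in simp)
    then show False using ij prime_p by auto
  qed
  then show ?thesis by (intro inj_onI) (metis lessThan_iff nat_neq_iff)
qed

section \<open>Cyclic submodules and the decomposition into them\<close>

definition cyc :: "'a \<Rightarrow> 'a set" where
  "cyc x = range (\<lambda>f. act f x)"

lemma cyc_subgroup:
  assumes x: "x \<in> carrier A"
  shows "subgroup (cyc x) A"
proof (rule subgroupI)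
  show "cyc x \<subseteq> carrier A" unfolding cyc_def using x by auto
  show "cyc x \<noteq> {}" unfolding cyc_def by auto
  show "inv a \<in> cyc x" if a: "a \<in> cyc x" for a
  proof -
    obtain f where "a = act f x" using a unfolding cyc_def by blast
    then have "inv a = act (smult (-1) f) x"
      using x by (simp add: act_smult int_pow_neg del: smult_minus_left)
    then show ?thesis unfolding cyc_def by blast
  qed
  show "a \<otimes> b \<in> cyc x" if ab: "a \<in> cyc x" "b \<in> cyc x" for a b
  proof -
    obtain f where "a = act f x" using ab(1) unfolding cyc_def by blast
    moreover obtain g where "b = act g x" using ab(2) unfolding cyc_def by blast
    ultimately have "a \<otimes> b = act (f + g) x" using x by (simp only: act_add)
    then show ?thesis unfolding cyc_def by blast
  qed
qed

lemma cyc_self: "x \<in> carrier A \<Longrightarrow> x \<in> cyc x"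
  unfolding cyc_def by (intro range_eqI[of _ _ 1]) simp

lemma cyc_T:
  assumes x: "x \<in> carrier A" and y: "y \<in> cyc x"
  shows "T y \<in> cyc x"
proof -
  obtain f where "y = act f x" using y unfolding cyc_def by blast
  then have "T y = act (pCons 0 f) x" using x by (simp only: act_X_mult)
  then show ?thesis unfolding cyc_def by blast
qed

lemma cyc_finprod:
  assumes "x \<in> carrier A" "(T ^^ d) x = \<one>" "y \<in> cyc x"
  shows "\<exists>c :: nat \<Rightarrow> int. y = finprod A (\<lambda>k. (T ^^ k) x [^] c k) {..<d}"
  using assms act_eq_finprod[OF assms(1,2)] unfolding cyc_def by blast

lemma Tpow_stable:
  assumes "\<And>y. y \<in> H \<Longrightarrow> T y \<in> H" "y \<in> H"
  shows "(T ^^ k) y \<in> H"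
  using assms by (induction k) auto

text \<open>Modulo \<open>p\<close>, \<open>cyc x\<close> is the quotient of the polynomial ring by
  X^d, where the elements killed by X are the multiples of X^(d-1). Induction on \<open>k\<close>
  shows that the polynomial giving \<open>y\<close> can be taken divisible by X^k.\<close>

lemma cyc_Int_kernel:
  assumes x: "x \<in> carrier A" and d: "(T ^^ d) x = \<one>" "(T ^^ (d - 1)) x \<noteq> \<one>"
    and y: "y \<in> cyc x" "T y = \<one>"
  shows "\<exists>c. y = (T ^^ (d - 1)) x [^] (c::int)"
proof -
  have d0: "d > 0" using d by (cases d) auto
  have "\<exists>f. y = act (monom 1 k * f) x" if "k \<le> d - 1" for k
    using that
  proof (induction k)
    case 0 then show ?case using y(1) unfolding cyc_def by (auto simp: monom_0)
  next
    case (Suc k)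
    then obtain f where f: "y = act (monom 1 k * f) x" by auto
    obtain a g where f': "f = pCons a g" by (rule pCons_cases)
    have sp: "monom 1 j * pCons a g = smult a (monom 1 j) + monom 1 (Suc j) * g" for j
      by (simp add: monom_Suc)
    \<comment> \<open>This exponent moves the lowest coefficient \<open>a\<close> to degree
      \<open>d - 1\<close> and all others to degrees that kill \<open>x\<close>; as
      \<open>?j \<ge> 1\<close>, the same power of \<open>T\<close> kills \<open>y\<close>.\<close>
    let ?j = "d - 1 - k"
    have j: "?j = Suc (?j - 1)" "?j + k = d - 1" using Suc.prems by auto
    have "\<one> = (T ^^ (?j - 1)) (T y)" using y by simp
    also have "\<dots> = (T ^^ ?j) y" by (subst j(1)) (simp only: funpow_Suc_right o_apply)
    also have "\<dots> = act (monom 1 ?j) (act (monom 1 k * f) x)"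
      unfolding f using x by (simp only: act_monom act_closed)
    also have "\<dots> = act (monom 1 ?j * monom 1 k * f) x"
      using x by (simp only: act_mult mult.assoc)
    also have "monom 1 ?j * monom 1 k = (monom 1 (d - 1) :: int poly)"
      using j(2) by (simp add: mult_monom)
    also have "act (monom 1 (d - 1) * f) x = act (monom 1 (d - 1)) x [^] a \<otimes> act (monom 1 (Suc (d - 1)) * g) x"
      unfolding f' sp using x by (simp only: act_add act_smult)
    also have "act (monom 1 (Suc (d - 1)) * g) x = act g (act (monom 1 d) x)"
      using x d0 by (simp add: act_mult[symmetric] mult.commute)
    also have "\<dots> = \<one>" using x d by (simp add: act_monom)
    finally have "(T ^^ (d - 1)) x [^] a = \<one>" using x by (simp add: act_monom)
    then have "int p dvd a" using int_pow_eq_one_iff[of "(T ^^ (d - 1)) x" a] d(2) x by simp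
    then have "act (monom 1 k) x [^] a = \<one>" using x by (intro int_pow_dvd) auto
    then have "y = act (monom 1 (Suc k) * g) x"
      unfolding f f' sp using x by (simp add: act_add act_smult)
    then show ?case by blast
  qed
  then obtain f where f: "y = act (monom 1 (d - 1) * f) x" by blast
  obtain a g where f': "f = pCons a g" by (rule pCons_cases)
  have "monom 1 (d - 1) * pCons a g = smult a (monom 1 (d - 1)) + g * monom 1 d"
    using d0 by (cases d) (simp_all add: monom_Suc mult.commute)
  then have "y = act (monom 1 (d - 1)) x [^] a \<otimes> act g (act (monom 1 d) x)"
    unfolding f f' using x by (simp only: act_add act_smult act_mult)
  then show ?thesis using x d(1) by (auto simp: act_monom)
qed

text \<open>If \<open>T ^^ Suc k\<close> kills every factor of a relation, the images under
  \<open>T ^^ k\<close> form a relation between elements killed by \<open>T\<close>, so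
  \<open>T ^^ k\<close> kills every factor too. Descent from \<open>k = M\<close> ends at the
  factors themselves.\<close>

lemma independent_family_socle:
  assumes N: "\<And>i. i \<in> I \<Longrightarrow> subgroup (N i) A" "\<And>i y. i \<in> I \<Longrightarrow> y \<in> N i \<Longrightarrow> T y \<in> N i"
    and nil: "\<And>x. x \<in> carrier A \<Longrightarrow> (T ^^ M) x = \<one>"
    and soc: "independent_family I (\<lambda>i. {y \<in> N i. T y = \<one>})"
  shows "independent_family I N"
  unfolding independent_family_def
proof (intro allI impI, elim conjE)
  fix J y assume J: "finite J" "J \<subseteq> I" and y: "\<forall>j\<in>J. y j \<in> N j" "finprod A y J = \<one>"
  have yc: "y j \<in> carrier A"
    if "j \<in> J" for j using subgroup.mem_carrier[OF N(1)] that J(2) y(1) by blast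
  have "(\<forall>j\<in>J. (T ^^ k) (y j) = \<one>) \<Longrightarrow> (\<forall>j\<in>J. y j = \<one>)" for k
  proof (induction k)
    case 0 then show ?case by simp
  next
    case (Suc k)
    have "(T ^^ k) (y j) = \<one>" if j: "j \<in> J" for j
    proof (rule independent_familyD[OF soc J _ _ j, of "\<lambda>j. (T ^^ k) (y j)"])
      show "(T ^^ k) (y i) \<in> {y \<in> N i. T y = \<one>}" if i: "i \<in> J" for i
      proof -
        have "i \<in> I" using i J by blast
        then have "(T ^^ k) (y i) \<in> N i" using Tpow_stable[of "N i" "y i" k] N(2) y(1) i by blast
        then show ?thesis using Suc.prems i by simp
      qed
      show "(\<Otimes>j\<in>J. (T ^^ k) (y j)) = \<one>"
        using Tpow_finprod[of J y k] yc y(2) by simp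
    qed
    then show ?case using Suc.IH by blast
  qed
  from this[of M] show "\<forall>j\<in>J. y j = \<one>" using nil yc by blast
qed

text \<open>By \<open>socle\<close>, elements of \<open>ker T\<close> in the image of
  \<open>T ^^ (p ^ (i - 1))\<close> already lie in the image of \<open>T ^^ (p ^ i - 1)\<close>, so
  only chain lengths \<open>p ^ i\<close> occur. Lifts of bases of the successive quotients of the
  resulting filtration of \<open>ker T\<close> generate the summands; independence is tested on
  \<open>ker T\<close>, and spanning goes by induction on the nilpotency order.\<close>

theorem cyclic_decomposition:
  assumes nil: "\<And>x. x \<in> carrier A \<Longrightarrow> (T ^^ (p ^ n)) x = \<one>"
    and socle: "\<And>i d. \<lbrakk>1 \<le> i; i \<le> n; d \<in> carrier A; T ((T ^^ (p ^ (i - 1))) d) = \<one>\<rbrakk>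
      \<Longrightarrow> \<exists>e\<in>carrier A. (T ^^ (p ^ i - 1)) e = (T ^^ (p ^ (i - 1))) d"
  obtains B :: "nat \<Rightarrow> 'a set" where
    "\<And>i. i \<le> n \<Longrightarrow> B i \<subseteq> carrier A"
    "\<And>i x. \<lbrakk>i \<le> n; x \<in> B i\<rbrakk> \<Longrightarrow> (T ^^ (p ^ i)) x = \<one> \<and> (T ^^ (p ^ i - 1)) x \<noteq> \<one>"
    "\<And>i. i \<le> n \<Longrightarrow> independent_family (B i) cyc"
    "independent_family {0..n} (\<lambda>i. generate A (\<Union>x\<in>B i. cyc x))"
    "generate A (\<Union>i\<in>{0..n}. generate A (\<Union>x\<in>B i. cyc x)) = carrier A"
proof -
  have p1: "p ^ i \<ge> 1" for i using prime_p by (simp add: prime_gt_0_nat Suc_leI)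
  have pmono: "i \<le> j \<Longrightarrow> p ^ i \<le> p ^ j" for i j using p1[of 1] by (simp add: power_increasing)
  \<comment> \<open>For \<open>i \<le> n\<close>, \<open>V i\<close> collects the last terms of
    chains e, T e, ... of \<open>p ^ i\<close> terms that end in \<open>ker T\<close>; these sets
    decrease with \<open>i\<close>. The value \<open>{\<one>}\<close> beyond \<open>n\<close> closes
    the filtration.\<close>
  define V where "V i = (if i \<le> n then {z \<in> carrier A. T z = \<one> \<and> (\<exists>e\<in>carrier A. z = (T ^^ (p ^ i - 1)) e)} else {\<one>})" for i
  have Vc: "V i \<subseteq> carrier A" for i unfolding V_def by auto
  have Vsub: "subgroup (V i) A" for i
  proof (rule subgroupI)
    show "V i \<subseteq> carrier A" by (rule Vc)
    have "\<one> \<in> V i" unfolding V_def by (auto intro!: bexI[of _ \<one>])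
    then show "V i \<noteq> {}" by blast
    show "inv a \<in> V i" if a: "a \<in> V i" for a
    proof (cases "i \<le> n")
      case True
      then obtain e where "e \<in> carrier A" "a = (T ^^ (p ^ i - 1)) e" "T a = \<one>"
        using a unfolding V_def by auto
      then show ?thesis
        using True Tpow_inv[of e "p ^ i - 1"] Tpow_inv[of a 1]
          unfolding V_def by (auto intro: bexI[of _ "inv e"])
    qed (use a V_def in auto)
    show "a \<otimes> b \<in> V i" if a: "a \<in> V i" and b: "b \<in> V i" for a b
    proof (cases "i \<le> n")
      case True
      obtain e where e: "e \<in> carrier A" "a = (T ^^ (p ^ i - 1)) e" "T a = \<one>"
        using True a unfolding V_def by auto
      obtain e' where e': "e' \<in> carrier A" "b = (T ^^ (p ^ i - 1)) e'" "T b = \<one>"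
        using True b unfolding V_def by auto
      have "a \<otimes> b = (T ^^ (p ^ i - 1)) (e \<otimes> e')" "T (a \<otimes> b) = \<one>"
        using e e' by (simp_all add: Tpow_mult T_mult)
      then show ?thesis unfolding V_def using True e e' by auto
    qed (use a b V_def in auto)
  qed
  have Vmono: "V j \<subseteq> V i" if ij: "i \<le> j" for i j
  proof (cases "j \<le> n")
    case False
    then have "V j = {\<one>}" unfolding V_def by simp
    then show ?thesis using Vsub[of i] by (simp add: subgroup.one_closed)
  next
    case True
    show ?thesis
    proof
      fix z assume "z \<in> V j"
      then obtain e where z: "z \<in> carrier A" "T z = \<one>" "e \<in> carrier A" "z = (T ^^ (p ^ j - 1)) e"
        unfolding V_def using True by auto
      have "p ^ j - 1 = (p ^ i - 1) + (p ^ j - p ^ i)" using pmono[OF ij] p1[of i] by simp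
      then have "z = (T ^^ (p ^ i - 1)) ((T ^^ (p ^ j - p ^ i)) e)"
        using z(4) by (simp only: funpow_add o_apply)
      moreover have "i \<le> n" using ij True by simp
      ultimately show "z \<in> V i" unfolding V_def using z by auto
    qed
  qed
  \<comment> \<open>\<open>C\<close> is a basis of \<open>V i\<close> modulo
    \<open>V (Suc i)\<close>.\<close>
  define D where "D i C \<longleftrightarrow> C \<subseteq> V i \<and> (\<forall>J c. finite J \<and> J \<subseteq> C \<and>
      finprod A (\<lambda>b. b [^] (c b :: int)) J \<in> V (Suc i) \<longrightarrow> (\<forall>b\<in>J. int p dvd c b)) \<and>
      V i \<subseteq> generate A (V (Suc i) \<union> C)" for i C
  have "\<exists>C. D i C" for i
  proof -
    obtain C where "C \<subseteq> V i"
      "\<forall>J c. finite J \<and> J \<subseteq> C \<and> finprod A (\<lambda>b. b [^] (c b :: int)) J \<in> V (Suc i) \<longrightarrow> (\<forall>b\<in>J. int p dvd c b)"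
      "V i \<subseteq> generate A (V (Suc i) \<union> C)"
      by (rule complement_basis[OF Vsub[of "Suc i"] Vc[of i]])
    then have "D i C" unfolding D_def by (intro conjI)
    then show ?thesis ..
  qed
  then obtain C where C: "\<And>i. D i (C i)" by metis
  have CV: "C i \<subseteq> V i" and Cind: "\<lbrakk>finite J; J \<subseteq> C i; finprod A (\<lambda>b. b [^] (c b :: int)) J \<in> V (Suc i); b \<in> J\<rbrakk> \<Longrightarrow> int p dvd c b"
    and Cgen: "V i \<subseteq> generate A (V (Suc i) \<union> C i)" for i J c b
    subgoal using C[of i] unfolding D_def by (elim conjE)
    subgoal
      using C[of i, unfolded D_def, THEN conjunct2, THEN conjunct1, rule_format, of J c b] by simp
    subgoal using C[of i] unfolding D_def by (elim conjE)
    done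
  \<comment> \<open>\<open>\<beta> i\<close> leads from the start of a chain of length
    \<open>p ^ i\<close> to its end; \<open>g i\<close> chooses a start for each basis
    element.\<close>
  define \<beta> where "\<beta> i = T ^^ (p ^ i - 1)" for i
  define g where "g i b = (SOME e. e \<in> carrier A \<and> \<beta> i e = b)" for i b
  have g: "g i b \<in> carrier A" "\<beta> i (g i b) = b" if "i \<le> n" "b \<in> C i" for i b
  proof -
    have "\<exists>e. e \<in> carrier A \<and> \<beta> i e = b" using CV[of i] that unfolding V_def \<beta>_def by auto
    then have "g i b \<in> carrier A \<and> \<beta> i (g i b) = b" unfolding g_def by (rule someI_ex)
    then show "g i b \<in> carrier A" "\<beta> i (g i b) = b" by auto
  qed
  define B where "B i = g i ` C i" for i
  have Bc: "B i \<subseteq> carrier A" if "i \<le> n" for i unfolding B_def using g that by auto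
  have BC: "\<beta> i x \<in> C i" "g i (\<beta> i x) = x"
    if "i \<le> n" "x \<in> B i" for i x using that g unfolding B_def by auto
  have BV: "\<beta> i x \<in> V i" if "i \<le> n" "x \<in> B i" for i x using BC(1)[OF that] CV by blast
  have \<beta>c: "\<beta> i x \<in> carrier A" if "i \<le> n" "x \<in> B i" for i x using BV[OF that] Vc by blast
  \<comment> \<open>The independence of \<open>C i\<close> modulo \<open>V (Suc i)\<close>, carried
    back along the injection \<open>\<beta> i\<close> to the chosen starts.\<close>
  have Bind: "int p dvd c x" if i: "i \<le> n" and J: "finite J" "J \<subseteq> B i"
    and V: "finprod A (\<lambda>x. \<beta> i x [^] (c x :: int)) J \<in> V (Suc i)" and x: "x \<in> J" for i J c x
  proof -
    have J': "\<And>x. x \<in> J \<Longrightarrow> x \<in> B i" using J by blast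
    have inj: "inj_on (\<beta> i) J" by (rule inj_on_inverseI[of _ "g i"]) (use BC i J' in auto)
    have "finprod A (\<lambda>b. b [^] c (g i b)) (\<beta> i ` J) = finprod A (\<lambda>x. \<beta> i x [^] c (g i (\<beta> i x))) J"
      using \<beta>c[OF i J'] by (intro finprod_reindex[OF _ inj]) auto
    also have "\<dots> = finprod A (\<lambda>x. \<beta> i x [^] c x) J"
      using \<beta>c[OF i J'] BC(2)[OF i J'] by (intro finprod_cong') auto
    finally have "int p dvd c (g i (\<beta> i x))"
      using V J BC(1)[OF i J'] x by (intro Cind[of "\<beta> i ` J" i "\<lambda>b. c (g i b)" "\<beta> i x"]) auto
    then show ?thesis using BC(2)[OF i J'[OF x]] by simp
  qed
  have Bnil: "(T ^^ (p ^ i)) x = \<one> \<and> (T ^^ (p ^ i - 1)) x \<noteq> \<one>"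
    if i: "i \<le> n" and x: "x \<in> B i" for i x
  proof
    have "(T ^^ (p ^ i)) x = T (\<beta> i x)" unfolding \<beta>_def using p1[of i] by (cases "p ^ i") auto
    also have "\<dots> = \<one>" using BV[OF i x] i unfolding V_def by auto
    finally show "(T ^^ (p ^ i)) x = \<one>" .
    show "(T ^^ (p ^ i - 1)) x \<noteq> \<one>"
    proof
      assume "(T ^^ (p ^ i - 1)) x = \<one>"
      then have "finprod A (\<lambda>x. \<beta> i x [^] (1::int)) {x} \<in> V (Suc i)"
        using Vsub by (simp add: \<beta>_def subgroup.one_closed)
      then have "int p dvd 1" using x by (intro Bind[OF i, of "{x}" "\<lambda>_. 1" x]) auto
      then show False using prime_p by auto
    qed
  qed
  have cycB: "\<exists>c. y = \<beta> i x [^] (c::int)" if "i \<le> n" "x \<in> B i" "y \<in> cyc x" "T y = \<one>" for i x y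
    unfolding \<beta>_def using that Bnil[of i x] Bc[of i] by (intro cyc_Int_kernel) auto
  have cycsub: "subgroup (cyc x) A"
    if "i \<le> n" "x \<in> B i" for i x using Bc that by (intro cyc_subgroup) auto
  \<comment> \<open>It suffices to look at \<open>ker T\<close>, where \<open>cyc x\<close> consists
    of powers of \<open>\<beta> i x\<close>; a relation between these has the value
    \<open>\<one>\<close>, an element of \<open>V (Suc i)\<close>.\<close>
  have ind: "independent_family (B i) cyc" if i: "i \<le> n" for i
  proof (rule independent_family_socle[OF _ _ nil])
    show "subgroup (cyc x) A" if "x \<in> B i" for x using cycsub[OF i that] .
    show "T y \<in> cyc x" if "x \<in> B i" "y \<in> cyc x" for x y using Bc[OF i] that by (intro cyc_T) auto
    show "independent_family (B i) (\<lambda>x. {y \<in> cyc x. T y = \<one>})"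
      unfolding independent_family_def
    proof (intro allI impI ballI, elim conjE)
      fix J y x assume J: "finite J" "J \<subseteq> B i" and y: "\<forall>x\<in>J. y x \<in> {y \<in> cyc x. T y = \<one>}" "finprod A y J = \<one>"
        and x: "x \<in> J"
      have "\<forall>x\<in>J. \<exists>c. y x = \<beta> i x [^] (c::int)" using cycB[OF i] y(1) J by blast
      then obtain c where c: "\<And>x. x \<in> J \<Longrightarrow> y x = \<beta> i x [^] (c x::int)" by metis
      have bc: "\<And>x. x \<in> J \<Longrightarrow> \<beta> i x \<in> carrier A" using \<beta>c[OF i] J by blast
      have "finprod A (\<lambda>x. \<beta> i x [^] c x) J = finprod A y J"
        using c bc by (intro finprod_cong') auto
      then have "int p dvd c x"
        using J y(2) x Vsub by (intro Bind[OF i, of J c]) (auto simp: subgroup.one_closed)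
      then show "y x = \<one>" using c[OF x] bc[OF x] int_pow_dvd by simp
    qed
  qed
  define Y where "Y i = generate A (\<Union>x\<in>B i. cyc x)" for i
  have cycc: "(\<Union>x\<in>B i. cyc x) \<subseteq> carrier A" if "i \<le> n" for i
    using subgroup.subset[OF cycsub[OF that]] by blast
  have Ysub: "subgroup (Y i) A"
    if "i \<le> n" for i unfolding Y_def by (rule generate_is_subgroup[OF cycc[OF that]])
  have YT: "T y \<in> Y i" if i: "i \<le> n" and y: "y \<in> Y i" for i y
  proof -
    have "T z \<in> (\<Union>x\<in>B i. cyc x)" if z: "z \<in> (\<Union>x\<in>B i. cyc x)" for z
    proof -
      obtain x where x: "x \<in> B i" "z \<in> cyc x" using z by blast
      have "T z \<in> cyc x" using x Bc[OF i] by (intro cyc_T) auto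
      then show ?thesis using x by blast
    qed
    from generate_T_stable[OF cycc[OF i] this] show ?thesis using y unfolding Y_def by blast
  qed
  \<comment> \<open>By directness, an element of \<open>Y i\<close> killed by \<open>T\<close> has
    all its components killed by \<open>T\<close>.\<close>
  have Ysoc: "\<exists>J c. finite J \<and> J \<subseteq> B i \<and> y = finprod A (\<lambda>x. \<beta> i x [^] (c x :: int)) J"
    if i: "i \<le> n" and y: "y \<in> Y i" "T y = \<one>" for i y
  proof -
    obtain J u where J: "finite J" "J \<subseteq> B i" "\<forall>x\<in>B i. u x \<in> cyc x" "y = finprod A u J"
      using y(1) unfolding Y_def by (rule generate_Union_finprod[OF cycsub[OF i], rotated])
    have uc: "x \<in> J \<Longrightarrow> u x \<in> carrier A" for x using J cycc[OF i] by blast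
    have "finprod A (\<lambda>x. T (u x)) J = \<one>" using y(2) J(4) Tpow_finprod[of J u 1] uc by simp
    then have "T (u x) = \<one>" if "x \<in> J" for x
      using J that Bc[OF i]
        by (intro independent_familyD[OF ind[OF i] J(1,2), of "\<lambda>x. T (u x)"] cyc_T) auto
    then have "\<forall>x\<in>J. \<exists>c. u x = \<beta> i x [^] (c::int)" using cycB[OF i] J by blast
    then obtain c where c: "\<And>x. x \<in> J \<Longrightarrow> u x = \<beta> i x [^] (c x::int)" by metis
    have "finprod A (\<lambda>x. \<beta> i x [^] c x) J = y" unfolding J(4)
      using c \<beta>c[OF i] J by (intro finprod_cong') auto
    then show ?thesis using J by blast
  qed
  have indY: "independent_family {0..n} Y"
  proof (rule independent_family_socle[OF _ _ nil])
    show "subgroup (Y i) A" if "i \<in> {0..n}" for i using that by (intro Ysub) simp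
    show "T y \<in> Y i" if "i \<in> {0..n}" "y \<in> Y i" for i y using that by (intro YT) auto
    show "independent_family {0..n} (\<lambda>i. {y \<in> Y i. T y = \<one>})"
      unfolding independent_family_def
    proof (intro allI impI, elim conjE, rule ccontr)
      fix J z assume J: "finite J" "J \<subseteq> {0..n}" and z: "\<forall>i\<in>J. z i \<in> {y \<in> Y i. T y = \<one>}" "finprod A z J = \<one>"
        and neg: "\<not> (\<forall>i\<in>J. z i = \<one>)"
      \<comment> \<open>At the least index \<open>i\<close> with a nontrivial term, all later terms
        lie in \<open>V (Suc i)\<close>, hence so does \<open>z i\<close>; independence modulo
        \<open>V (Suc i)\<close> then makes it trivial.\<close>
      define i where "i = (LEAST i. i \<in> J \<and> z i \<noteq> \<one>)"
      have "i \<in> J \<and> z i \<noteq> \<one>" unfolding i_def by (rule LeastI_ex) (use neg in blast)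
      then have i: "i \<in> J" "z i \<noteq> \<one>" "i \<le> n" using J by auto
      have min: "z j = \<one>"
        if "j \<in> J" "j < i" for j using not_less_Least[of j "\<lambda>i. i \<in> J \<and> z i \<noteq> \<one>"] that i_def by blast
      have zV: "z j \<in> V j" if j: "j \<in> J" for j
      proof -
        have jn: "j \<le> n" using J j by auto
        have "z j \<in> Y j" "T (z j) = \<one>" using z j by auto
        then obtain L c where "L \<subseteq> B j" "z j = finprod A (\<lambda>x. \<beta> j x [^] (c x :: int)) L"
          using Ysoc[OF jn] by blast
        then show ?thesis using BV[OF jn]
          by (auto intro!: finprod_in_subgroup[OF Vsub] subgroup_int_pow_closed[OF Vsub])
      qed
      have zc: "z j \<in> carrier A" if "j \<in> J" for j using zV[OF that] Vc by blast
      have r: "finprod A z (J - {i}) \<in> V (Suc i)"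
      proof (rule finprod_in_subgroup[OF Vsub])
        fix j assume j: "j \<in> J - {i}"
        show "z j \<in> V (Suc i)"
        proof (cases "j < i")
          case True then show ?thesis using min j Vsub by (simp add: subgroup.one_closed)
        next
          case False then have "Suc i \<le> j" using j by auto
          then show ?thesis using zV[of j] Vmono j by blast
        qed
      qed
      have rc: "finprod A z (J - {i}) \<in> carrier A" using r Vc by blast
      have "finprod A z (insert i (J - {i})) = z i \<otimes> finprod A z (J - {i})"
        using J(1) i(1) zc by (intro finprod_insert) auto
      then have "z i \<otimes> finprod A z (J - {i}) = \<one>" using z(2) i(1) by (simp add: insert_absorb)
      then have "inv (finprod A z (J - {i})) = z i" using rc zc[OF i(1)] by (rule inv_equality)
      then have "z i = inv (finprod A z (J - {i}))" by simp
      then have zi: "z i \<in> V (Suc i)" using r Vsub by (simp add: subgroup.m_inv_closed)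
      have "z i \<in> Y i" "T (z i) = \<one>" using z i by auto
      then obtain L c where L: "finite L" "L \<subseteq> B i" "z i = finprod A (\<lambda>x. \<beta> i x [^] (c x :: int)) L"
        using Ysoc[OF i(3)] by blast
      have "\<beta> i x [^] c x = \<one>" if "x \<in> L" for x
        using Bind[OF i(3) L(1,2) _ that] zi L \<beta>c[OF i(3)] that by (intro int_pow_dvd) auto
      then have "z i = \<one>" unfolding L(3) by (intro finprod_one_eqI) auto
      then show False using i by simp
    qed
  qed
  define M where "M = generate A (\<Union>i\<in>{0..n}. Y i)"
  have YM: "(\<Union>i\<in>{0..n}. Y i) \<subseteq> carrier A" by (intro UN_least subgroup.subset[OF Ysub]) simp
  have Msub: "subgroup M A" unfolding M_def by (rule generate_is_subgroup[OF YM])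
  have cycM: "y \<in> M" if "i \<le> n" "x \<in> B i" "y \<in> cyc x" for i x y
  proof -
    have "y \<in> Y i" unfolding Y_def using that by (intro generate.incl) auto
    then show ?thesis unfolding M_def using that by (intro generate.incl) auto
  qed
  \<comment> \<open>In the induction step \<open>T ^^ l\<close> maps \<open>v\<close> into
    \<open>ker T\<close>; once this image is matched by that of some \<open>m\<close> in
    \<open>M\<close>, \<open>v \<otimes> inv m\<close> is killed by \<open>T ^^ l\<close>.\<close>
  have span: "l \<le> p ^ n \<Longrightarrow> v \<in> carrier A \<Longrightarrow> (T ^^ l) v = \<one> \<Longrightarrow> v \<in> M" for l v
  proof (induction l arbitrary: v)
    case 0 then show ?case using Msub by (simp add: subgroup.one_closed)
  next
    case (Suc l)
    \<comment> \<open>Minimality gives \<open>p ^ (i - 1) \<le> l\<close> for \<open>i > 0\<close>,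
      so \<open>socle\<close> applies to \<open>z\<close>, while \<open>l \<le> p ^ i - 1\<close>
      makes the chain ends in \<open>C j\<close>, \<open>i \<le> j \<le> n\<close>, values of
      \<open>T ^^ l\<close>.\<close>
    define i where "i = (LEAST i. Suc l \<le> p ^ i)"
    have iP: "Suc l \<le> p ^ i" unfolding i_def by (rule LeastI[of _ n]) (use Suc.prems in simp)
    have i: "i \<le> n" unfolding i_def by (rule Least_le) (use Suc.prems in simp)
    define z where "z = (T ^^ l) v"
    have zc: "z \<in> carrier A" "T z = \<one>" unfolding z_def using Suc.prems by auto
    have zV: "z \<in> V i"
    proof (cases "i = 0")
      case True then show ?thesis unfolding V_def using zc by (auto intro!: bexI[of _ z])
    next
      case False
      have "\<not> Suc l \<le> p ^ (i - 1)"
        using not_less_Least[of "i - 1" "\<lambda>i. Suc l \<le> p ^ i"] False i_def by simp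
      then have "l = p ^ (i - 1) + (l - p ^ (i - 1))" by simp
      then have zz: "z = (T ^^ (p ^ (i - 1))) ((T ^^ (l - p ^ (i - 1))) v)"
        unfolding z_def by (metis funpow_add o_apply)
      have "\<exists>e\<in>carrier A. (T ^^ (p ^ i - 1)) e = z"
        unfolding zz by (rule socle) (use False i Suc.prems zc zz in auto)
      then show ?thesis unfolding V_def using zc i by auto
    qed
    have gh: "group_hom A A (T ^^ l)"
      using Tpow_hom is_group by (simp add: group_hom_def group_hom_axioms_def)
    have Hsub: "subgroup ((T ^^ l) ` M) A" by (rule group_hom.subgroup_img_is_subgroup[OF gh Msub])
    have "i \<le> Suc n" using i by simp
    \<comment> \<open>Descent from \<open>V (Suc n)\<close>: each \<open>V j\<close> is generated by
      \<open>V (Suc j)\<close> and \<open>C j\<close>, and every \<open>b\<close> in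
      \<open>C j\<close> is the image under \<open>T ^^ l\<close> of an element of
      \<open>cyc (g j b)\<close>.\<close>
    then have "V i \<subseteq> (T ^^ l) ` M"
    proof (induction rule: inc_induct)
      case base
      have "V (Suc n) = {\<one>}" unfolding V_def by simp
      then show ?case using subgroup.one_closed[OF Hsub] by simp
    next
      case (step j)
      then have jn: "j \<le> n" by simp
      have "b \<in> (T ^^ l) ` M" if b: "b \<in> C j" for b
      proof -
        have x: "g j b \<in> B j" unfolding B_def using b by simp
        have xc: "g j b \<in> carrier A" using g jn b by blast
        have "p ^ j - 1 = l + (p ^ j - 1 - l)" using iP pmono[OF step.hyps(1)] by simp
        then have "b = (T ^^ l) ((T ^^ (p ^ j - 1 - l)) (g j b))"
          using g(2)[OF jn b] unfolding \<beta>_def by (metis funpow_add o_apply)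
        moreover have "(T ^^ (p ^ j - 1 - l)) (g j b) \<in> cyc (g j b)"
          using xc by (intro Tpow_stable cyc_T cyc_self)
        ultimately show ?thesis using cycM[OF jn x] by blast
      qed
      then have "generate A (V (Suc j) \<union> C j) \<subseteq> (T ^^ l) ` M"
        using step.IH by (intro generate_subgroup_incl[OF _ Hsub]) auto
      then show ?case using Cgen[of j] by blast
    qed
    then obtain m where m: "m \<in> M" "z = (T ^^ l) m" using zV by blast
    have mc: "m \<in> carrier A" using m(1) subgroup.mem_carrier[OF Msub] by blast
    have "(T ^^ l) (v \<otimes> inv m) = z \<otimes> inv z"
      using Suc.prems mc m(2) z_def by (simp add: Tpow_mult Tpow_inv)
    also have "\<dots> = \<one>" using zc by simp
    finally have "v \<otimes> inv m \<in> M" using Suc.prems mc by (intro Suc.IH) auto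
    then have "v \<otimes> inv m \<otimes> m \<in> M" using m(1) subgroup.m_closed[OF Msub] by blast
    then show ?case using Suc.prems mc by (simp add: m_assoc)
  qed
  have "M = carrier A" using span[of "p ^ n"] nil subgroup.subset[OF Msub] by blast
  then show thesis using that[of B] Bc Bnil ind indY unfolding M_def Y_def by blast
qed

end

text \<open>The product of the first \<open>k\<close> conjugates of \<open>x\<close>, a norm when
  \<open>k\<close> is the order of \<open>s\<close>. A bare monoid suffices as domain, so that it
  serves both the field and its group of power classes.\<close>

primrec iterated_norm :: "('a, 'b) monoid_scheme \<Rightarrow> ('a \<Rightarrow> 'a) \<Rightarrow> nat \<Rightarrow> 'a \<Rightarrow> 'a" where
  "iterated_norm R s 0 x = \<one>\<^bsub>R\<^esub>"
| "iterated_norm R s (Suc k) x = x \<otimes>\<^bsub>R\<^esub> s (iterated_norm R s k x)"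

section \<open>The operator S - 1 and its powers\<close>

locale elementary_abelian_auto = elementary_abelian +
  fixes S :: "'a \<Rightarrow> 'a"
  assumes S_hom: "S \<in> hom A A"
begin

text \<open>The operator S - 1 in multiplicative notation.\<close>

definition shift :: "'a \<Rightarrow> 'a" where
  "shift x = S x \<otimes> inv x"

lemma S_closed [simp]: "x \<in> carrier A \<Longrightarrow> S x \<in> carrier A"
  using S_hom by (rule hom_in_carrier)

lemma shift_hom: "shift \<in> hom A A"
  using S_hom by (intro homI) (auto simp: shift_def hom_mult[OF S_hom] inv_mult_group m_ac)

sublocale T: elementary_abelian_endo A p shift
  by unfold_locales (rule shift_hom)

lemma Spow_closed [simp]: "x \<in> carrier A \<Longrightarrow> (S ^^ k) x \<in> carrier A"
  by (induction k) auto

lemma shift_eq_iff: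
  "x \<in> carrier A \<Longrightarrow> shift x = \<one> \<longleftrightarrow> S x = x"
  unfolding shift_def by (metis S_closed inv_closed inv_equality inv_inv r_inv)

lemma S_eq: "x \<in> carrier A \<Longrightarrow> S x = x \<otimes> shift x"
  using m_lcomm[of x "S x" "inv x"] by (simp add: shift_def)

lemma act_pow:
  assumes x: "x \<in> carrier A"
  shows "T.act ([:1, 1:] ^ k) x = (S ^^ k) x"
proof (induction k)
  case 0 then show ?case using x by simp
next
  case (Suc k)
  have "T.act [:1, 1:] y = S y" if "y \<in> carrier A" for y
    using that S_eq[of y] by (simp add: T.act_pCons)
  then show ?case using x Suc by (simp add: T.act_mult del: mult_pCons_left mult_pCons_right)
qed

text \<open>Frobenius for S = 1 + \<open>shift\<close>: modulo \<open>p\<close>, only the two outer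
  binomial terms of its \<open>p ^ i\<close>-th power remain.\<close>

lemma shift_pow_prime_power:
  assumes x: "x \<in> carrier A"
  shows "(shift ^^ (p ^ i)) x = (S ^^ (p ^ i)) x \<otimes> inv x"
proof -
  have "(S ^^ (p ^ i)) x = T.act ([:1, 1:] ^ (p ^ i)) x" by (simp only: act_pow[OF x])
  also have "\<dots> = T.act (1 + monom 1 (p ^ i)) x" by (rule T.act_dvd[OF x T.power_dvd_diff])
  also have "\<dots> = x \<otimes> (shift ^^ (p ^ i)) x" using x by (simp only: T.act_add T.act_one T.act_monom)
  finally show ?thesis using x by (simp add: m_comm[of x] m_assoc)
qed

text \<open>The geometric sum 1 + S + ... + S^(q-1), \<open>q = p ^ i\<close>, is congruent modulo
  \<open>p\<close> to (S - 1)^(q-1), and its value at \<open>x\<close> is the iterated norm.\<close>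

lemma shift_pow_norm:
  assumes x: "x \<in> carrier A"
  shows "(shift ^^ (p ^ i - 1)) x = iterated_norm A S (p ^ i) x"
proof -
  have "T.act (\<Sum>k<j. [:1, 1:] ^ k) x = iterated_norm A S j x" for j
  proof (induction j)
    case 0 then show ?case by simp
  next
    case (Suc j)
    have "(\<Sum>k<Suc j. [:1, 1:] ^ k) = 1 + [:1, 1:] * (\<Sum>k<j. [:1, 1:] ^ k :: int poly)"
      by (simp only: sum.lessThan_Suc_shift power_0 power_Suc sum_distrib_left)
    then have "T.act (\<Sum>k<Suc j. [:1, 1:] ^ k) x = x \<otimes> T.act ([:1, 1:] ^ 1) (iterated_norm A S j x)"
      using x by (simp only: T.act_add T.act_one T.act_mult Suc power_one_right)
    also have "T.act ([:1, 1:] ^ 1) (iterated_norm A S j x) = S (iterated_norm A S j x)"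
      using act_pow[of "iterated_norm A S j x" 1] x unfolding Suc[symmetric] by simp
    finally show ?case by simp
  qed
  then have "iterated_norm A S (p ^ i) x = T.act (\<Sum>k<p ^ i. [:1, 1:] ^ k) x" by simp
  also have "\<dots> = T.act (monom 1 (p ^ i - 1)) x" by (rule T.act_dvd[OF x T.geometric_dvd_diff])
  finally show ?thesis using x by (simp only: T.act_monom)
qed

text \<open>\<open>shift\<close> is nilpotent on \<open>x\<close>, because its
  \<open>p ^ n\<close>-th power is that of \<open>S\<close> minus the identity; its last nontrivial
  iterate at \<open>x\<close> is fixed by \<open>S\<close>.\<close>

lemma S_fixed_element:
  assumes x: "x \<in> carrier A" "x \<noteq> \<one>" "(S ^^ (p ^ n)) x = x"
  shows "\<exists>y\<in>carrier A. y \<noteq> \<one> \<and> S y = y"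
proof -
  define k where "k = (LEAST k. (shift ^^ k) x = \<one>)"
  have "(shift ^^ (p ^ n)) x = \<one>" using x shift_pow_prime_power[of x n] by simp
  then have k: "(shift ^^ k) x = \<one>" unfolding k_def by (rule LeastI)
  then obtain j where j: "k = Suc j" using x(2) by (cases k) auto
  have "(shift ^^ j) x \<noteq> \<one>" using not_less_Least[of j "\<lambda>k. (shift ^^ k) x = \<one>"] j k_def by simp
  moreover have "S ((shift ^^ j) x) = (shift ^^ j) x"
    using k j x by (simp add: shift_eq_iff[symmetric])
  ultimately show ?thesis using x by (intro bexI[of _ "(shift ^^ j) x"]) auto
qed

end

section \<open>Automorphisms of fields\<close>

context field
begin

lemma finsum_lessThan_Suc:
  assumes "\<And>j. j < Suc n \<Longrightarrow> f j \<in> carrier R"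
  shows "(\<Oplus>j\<in>{..<Suc n}. f j) = f n \<oplus> (\<Oplus>j\<in>{..<n}. f j)"
  unfolding lessThan_Suc using assms by (intro finsum_insert) auto

text \<open>Gaussian elimination on the last equation: unless its coefficients all vanish, it
  determines one unknown in terms of the others.\<close>

lemma homogeneous_system:
  assumes "finite J" "d < card J" "\<And>i j. i < d \<Longrightarrow> j \<in> J \<Longrightarrow> a i j \<in> carrier R"
  shows "\<exists>c. (\<forall>j\<in>J. c j \<in> carrier R) \<and> (\<exists>j\<in>J. c j \<noteq> \<zero>) \<and> (\<forall>i<d. (\<Oplus>j\<in>J. a i j \<otimes> c j) = \<zero>)"
  using assms
proof (induction d arbitrary: J a)
  case 0
  then obtain k where "k \<in> J" by fastforce
  then show ?case by (intro exI[of _ "\<lambda>_. \<one>"]) auto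
next
  case (Suc d)
  show ?case
  proof (cases "\<forall>j\<in>J. a d j = \<zero>")
    case True
    have "\<exists>c. (\<forall>j\<in>J. c j \<in> carrier R) \<and> (\<exists>j\<in>J. c j \<noteq> \<zero>) \<and> (\<forall>i<d. (\<Oplus>j\<in>J. a i j \<otimes> c j) = \<zero>)"
      using Suc.prems by (intro Suc.IH) auto
    then obtain c where c: "\<forall>j\<in>J. c j \<in> carrier R" "\<exists>j\<in>J. c j \<noteq> \<zero>" "\<forall>i<d. (\<Oplus>j\<in>J. a i j \<otimes> c j) = \<zero>"
      by (elim exE conjE)
    have "(\<Oplus>j\<in>J. a d j \<otimes> c j) = \<zero>" using True c(1) by (intro add.finprod_one_eqI) auto
    then show ?thesis using c less_Suc_eq by (intro exI[of _ c]) auto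
  next
    case False
    then obtain k where k: "k \<in> J" "a d k \<noteq> \<zero>" by blast
    have ac: "a i j \<in> carrier R" if "i < Suc d" "j \<in> J" for i j using Suc.prems that by blast
    define q where "q = inv (a d k)"
    have q: "q \<in> carrier R" "a d k \<otimes> q = \<one>"
      unfolding q_def using k ac[of d k] by (auto simp: field_Units)
    \<comment> \<open>Row \<open>i\<close> minus the multiple of row \<open>d\<close> that clears
      the coefficient at the pivot \<open>k\<close>.\<close>
    define b where "b i j = a i j \<ominus> a i k \<otimes> q \<otimes> a d j" for i j
    have "\<exists>c. (\<forall>j\<in>J - {k}. c j \<in> carrier R) \<and> (\<exists>j\<in>J - {k}. c j \<noteq> \<zero>) \<and> (\<forall>i<d. (\<Oplus>j\<in>J - {k}. b i j \<otimes> c j) = \<zero>)"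
      using Suc.prems k(1) q(1) unfolding b_def by (intro Suc.IH) auto
    then obtain c where c: "\<forall>j\<in>J - {k}. c j \<in> carrier R" "\<exists>j\<in>J - {k}. c j \<noteq> \<zero>"
      "\<forall>i<d. (\<Oplus>j\<in>J - {k}. b i j \<otimes> c j) = \<zero>" by (elim exE conjE)
    define w where "w = (\<Oplus>j\<in>J - {k}. a d j \<otimes> c j)"
    have w: "w \<in> carrier R" unfolding w_def using c(1) ac by (intro finsum_closed) auto
    \<comment> \<open>The value at the pivot is dictated by equation \<open>d\<close>.\<close>
    define e where "e = c(k := \<ominus> (q \<otimes> w))"
    have ec: "\<forall>j\<in>J. e j \<in> carrier R" unfolding e_def using c(1) q w by auto
    have split: "(\<Oplus>j\<in>J. a i j \<otimes> e j) = a i k \<otimes> (\<ominus> (q \<otimes> w)) \<oplus> (\<Oplus>j\<in>J - {k}. a i j \<otimes> c j)"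
      if i: "i < Suc d" for i
    proof -
      have "(\<Oplus>j\<in>insert k (J - {k}). a i j \<otimes> e j) = a i k \<otimes> e k \<oplus> (\<Oplus>j\<in>J - {k}. a i j \<otimes> e j)"
        using Suc.prems(1) k(1) ec ac[OF i] by (intro finsum_insert) auto
      also have "(\<Oplus>j\<in>J - {k}. a i j \<otimes> e j) = (\<Oplus>j\<in>J - {k}. a i j \<otimes> c j)"
        using c(1) ac[OF i] unfolding e_def by (intro finsum_cong') auto
      finally show ?thesis using k(1) unfolding e_def by (simp add: insert_absorb)
    qed
    have "(\<Oplus>j\<in>J. a i j \<otimes> e j) = \<zero>" if i: "i < Suc d" for i
    proof (cases "i = d")
      case True
      have "a d k \<otimes> (\<ominus> (q \<otimes> w)) = \<ominus> ((a d k \<otimes> q) \<otimes> w)" 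
        using ac[of d k] k q w by (simp add: r_minus m_assoc[symmetric])
      then show ?thesis using split[of d] True q w unfolding w_def[symmetric] by (simp add: l_neg)
    next
      case False
      then have id: "i < d" using i by simp
      have f: "(\<lambda>j. a i k \<otimes> q \<otimes> (a d j \<otimes> c j)) \<in> J - {k} \<rightarrow> carrier R" 
        using c(1) ac[of d] ac[of i k] k q id by auto
      have "(\<Oplus>j\<in>J - {k}. a i j \<otimes> c j) = (\<Oplus>j\<in>J - {k}. b i j \<otimes> c j \<oplus> a i k \<otimes> q \<otimes> (a d j \<otimes> c j))"
      proof (intro finsum_cong')
        fix j assume j: "j \<in> J - {k}"
        have "a i j \<in> carrier R" "a i k \<in> carrier R" "a d j \<in> carrier R" "c j \<in> carrier R"
          using j c(1) ac[of i] ac[of d] id k by auto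
        then show "a i j \<otimes> c j = b i j \<otimes> c j \<oplus> a i k \<otimes> q \<otimes> (a d j \<otimes> c j)"
          unfolding b_def using q(1) by algebra
      qed (use c(1) ac id k q b_def in auto)
      also have "\<dots> = (\<Oplus>j\<in>J - {k}. b i j \<otimes> c j) \<oplus> (\<Oplus>j\<in>J - {k}. a i k \<otimes> q \<otimes> (a d j \<otimes> c j))"
        using c(1) ac id k q b_def by (intro finsum_addf f) auto
      also have "(\<Oplus>j\<in>J - {k}. a i k \<otimes> q \<otimes> (a d j \<otimes> c j)) = a i k \<otimes> q \<otimes> w"
        unfolding w_def
          using c(1) ac[of d] ac[of i k] k q id Suc.prems(1) by (intro finsum_rdistr[symmetric]) auto
      also have "(\<Oplus>j\<in>J - {k}. b i j \<otimes> c j) = \<zero>" using c(3) id by blast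
      finally have "(\<Oplus>j\<in>J. a i j \<otimes> e j) = a i k \<otimes> (\<ominus> (q \<otimes> w)) \<oplus> (\<zero> \<oplus> a i k \<otimes> q \<otimes> w)"
        using split[OF i] by simp
      also have "\<dots> = \<zero>" using ac[of i k] id k q(1) w by (simp add: r_minus m_assoc l_neg)
      finally show ?thesis .
    qed
    moreover have "\<exists>j\<in>J. e j \<noteq> \<zero>" using c(2) unfolding e_def by auto
    ultimately show ?thesis using ec by (intro exI[of _ e]) blast
  qed
qed

text \<open>Subtracting \<open>f r y\<close> times the relation at \<open>x\<close> from the
  relation at \<open>x \<otimes> y\<close> removes the last character \<open>f r\<close>; a
  \<open>y\<close> with \<open>f i y \<noteq> f r y\<close> then forces \<open>c i = \<zero>\<close>
  by induction.\<close>

lemma independence_of_characters: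
  fixes r :: nat
  assumes L: "\<And>x y. x \<in> L \<Longrightarrow> y \<in> L \<Longrightarrow> x \<otimes> y \<in> L"
    and f: "\<And>j x. j < r \<Longrightarrow> x \<in> L \<Longrightarrow> f j x \<in> carrier R"
      "\<And>j x y. j < r \<Longrightarrow> x \<in> L \<Longrightarrow> y \<in> L \<Longrightarrow> f j (x \<otimes> y) = f j x \<otimes> f j y"
    and nz: "\<And>j. j < r \<Longrightarrow> \<exists>x\<in>L. f j x \<noteq> \<zero>"
    and distinct: "\<And>i j. i < j \<Longrightarrow> j < r \<Longrightarrow> \<exists>x\<in>L. f i x \<noteq> f j x"
    and c: "\<And>j. j < r \<Longrightarrow> c j \<in> carrier R"
    and rel: "\<And>x. x \<in> L \<Longrightarrow> (\<Oplus>j\<in>{..<r}. c j \<otimes> f j x) = \<zero>"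
    and j: "j < r"
  shows "c j = \<zero>"
  using f nz distinct c rel j
proof (induction r arbitrary: c j)
  case 0 then show ?case by simp
next
  case (Suc r)
  note fc = Suc.prems(1) and fm = Suc.prems(2) and cc = Suc.prems(5)
  have small: "c i = \<zero>" if i: "i < r" for i
  proof -
    obtain y where y: "y \<in> L" "f i y \<noteq> f r y" using Suc.prems(4)[OF i] by auto
    have "c i \<otimes> (f i y \<ominus> f r y) = \<zero>"
    proof (rule Suc.IH[of "\<lambda>j. c j \<otimes> (f j y \<ominus> f r y)" i])
      fix x assume x: "x \<in> L"
      have t: "(\<lambda>j. c j \<otimes> f j (x \<otimes> y)) \<in> {..<Suc r} \<rightarrow> carrier R" using x y cc fc L by auto
      have t1: "(\<lambda>j. c j \<otimes> (f j y \<ominus> f r y) \<otimes> f j x) \<in> {..<Suc r} \<rightarrow> carrier R"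
        using x y cc fc by auto
      have t2: "(\<lambda>j. f r y \<otimes> (c j \<otimes> f j x)) \<in> {..<Suc r} \<rightarrow> carrier R" using x y cc fc by auto
      have "\<zero> = (\<Oplus>j\<in>{..<Suc r}. c j \<otimes> f j (x \<otimes> y))" using Suc.prems(6) x y L by simp
      also have "\<dots> = (\<Oplus>j\<in>{..<Suc r}. c j \<otimes> (f j y \<ominus> f r y) \<otimes> f j x \<oplus> f r y \<otimes> (c j \<otimes> f j x))"
      proof (intro finsum_cong')
        fix j assume "j \<in> {..<Suc r}"
        then have "c j \<in> carrier R" "f j x \<in> carrier R" "f j y \<in> carrier R" "f r y \<in> carrier R"
            "f j (x \<otimes> y) = f j x \<otimes> f j y"
          using x y cc fc fm by auto
        then show "c j \<otimes> f j (x \<otimes> y) = c j \<otimes> (f j y \<ominus> f r y) \<otimes> f j x \<oplus> f r y \<otimes> (c j \<otimes> f j x)"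
          by algebra
      qed (use t1 t2 in auto)
      also have "\<dots> = (\<Oplus>j\<in>{..<Suc r}. c j \<otimes> (f j y \<ominus> f r y) \<otimes> f j x) \<oplus> (\<Oplus>j\<in>{..<Suc r}. f r y \<otimes> (c j \<otimes> f j x))"
        by (rule finsum_addf[OF t1 t2])
      also have "(\<Oplus>j\<in>{..<Suc r}. f r y \<otimes> (c j \<otimes> f j x)) = f r y \<otimes> (\<Oplus>j\<in>{..<Suc r}. c j \<otimes> f j x)"
        using x y cc fc by (intro finsum_rdistr[symmetric]) auto
      also have "(\<Oplus>j\<in>{..<Suc r}. c j \<otimes> f j x) = \<zero>" using Suc.prems(6)[OF x] .
      also have "(\<Oplus>j\<in>{..<Suc r}. c j \<otimes> (f j y \<ominus> f r y) \<otimes> f j x) =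
          c r \<otimes> (f r y \<ominus> f r y) \<otimes> f r x \<oplus> (\<Oplus>j\<in>{..<r}. c j \<otimes> (f j y \<ominus> f r y) \<otimes> f j x)"
        using t1 by (intro finsum_lessThan_Suc) auto
      also have "c r \<otimes> (f r y \<ominus> f r y) \<otimes> f r x = \<zero>"
        using cc[of r] fc[of r] x y by (simp add: minus_eq r_neg)
      finally show "(\<Oplus>j\<in>{..<r}. c j \<otimes> (f j y \<ominus> f r y) \<otimes> f j x) = \<zero>"
        using t1 fc[of r] y by (simp add: finsum_closed Pi_iff)
    qed (use i y Suc.prems in auto)
    then have "c i = \<zero> \<or> f i y \<ominus> f r y = \<zero>" using i y cc fc by (intro integral) auto
    then show ?thesis using y i fc by simp
  qed
  moreover have "c r = \<zero>"
  proof -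
    obtain x where x: "x \<in> L" "f r x \<noteq> \<zero>" using Suc.prems(3)[of r] by auto
    have "\<zero> = c r \<otimes> f r x \<oplus> (\<Oplus>j\<in>{..<r}. c j \<otimes> f j x)"
      using Suc.prems(6)[OF x(1)] finsum_lessThan_Suc[of r "\<lambda>j. c j \<otimes> f j x"] cc fc x by auto
    also have "(\<Oplus>j\<in>{..<r}. c j \<otimes> f j x) = \<zero>" using small fc x by (intro add.finprod_one_eqI) auto
    finally have "c r \<otimes> f r x = \<zero>" using cc[of r] fc[of r] x by simp
    then show ?thesis using integral[of "c r" "f r x"] cc[of r] fc[of r] x by auto
  qed
  ultimately show ?case using Suc.prems(7) by (auto simp: less_Suc_eq)
qed

lemma combine_eq_finsum:
  assumes "set Us \<subseteq> carrier R" "\<And>j. j < length Us \<Longrightarrow> b j \<in> carrier R"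
  shows "combine (map b [0..<length Us]) Us = (\<Oplus>j\<in>{..<length Us}. b j \<otimes> Us ! j)"
  using assms
proof (induction Us arbitrary: b)
  case Nil then show ?case by simp
next
  case (Cons u Us)
  have "map b [0..<length (u # Us)] = b 0 # map (\<lambda>j. b (Suc j)) [0..<length Us]"
    by (simp add: upt_conv_Cons map_Suc_upt[symmetric] del: upt_Suc)
  then have "combine (map b [0..<length (u # Us)]) (u # Us) = b 0 \<otimes> u \<oplus> combine (map (\<lambda>j. b (Suc j)) [0..<length Us]) Us"
    by simp
  also have "combine (map (\<lambda>j. b (Suc j)) [0..<length Us]) Us = (\<Oplus>j\<in>{..<length Us}. b (Suc j) \<otimes> Us ! j)"
    using Cons.prems by (intro Cons.IH) auto
  also have "b 0 \<otimes> u \<oplus> \<dots> = (\<Oplus>j\<in>{..<length (u # Us)}. b j \<otimes> (u # Us) ! j)"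
    unfolding length_Cons using Cons.prems nth_mem[of _ Us]
    by (subst add.finprod_lessThan_Suc_shift) (auto simp: nth_Cons subset_iff split: nat.splits)
  finally show ?case .
qed

text \<open>An independent list of maximal length in \<open>E\<close> spans it, since any element
  outside its span could be prepended.\<close>

lemma dimension_le:
  assumes B: "subfield B R" and E: "subfield E R" "B \<subseteq> E"
    and bound: "\<And>Us. independent B Us \<Longrightarrow> set Us \<subseteq> E \<Longrightarrow> length Us \<le> m"
  shows "\<exists>d\<le>m. dimension d B E"
proof -
  define P where "P k \<longleftrightarrow> (\<exists>Us. independent B Us \<and> set Us \<subseteq> E \<and> length Us = k)" for k
  have "P 0" unfolding P_def by auto
  moreover have Pm: "P k \<Longrightarrow> k \<le> m" for k unfolding P_def using bound by blast
  ultimately obtain k where k: "P k" "\<And>j. P j \<Longrightarrow> j \<le> k"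
    using that[of "Greatest P"] GreatestI_nat[of P 0 m] Greatest_le_nat[of P _ m] by blast
  then obtain Us where Us: "independent B Us" "set Us \<subseteq> E" "length Us = k" unfolding P_def by blast
  have Ec: "E \<subseteq> carrier R" using subfieldE(3)[OF E(1)] .
  have "B <#> set Us \<subseteq> E"
    unfolding set_mult_def using E Us(2) subringE(6)[OF subfieldE(1)[OF E(1)]] by blast
  moreover have "subgroup E (add_monoid R)" using subring.axioms(1)[OF subfieldE(1)[OF E(1)]] .
  ultimately have "Span B Us \<subseteq> E" using Span_min[OF B, of Us E] Us(2) Ec by blast
  moreover have "u \<in> Span B Us" if u: "u \<in> E" for u
  proof (rule ccontr)
    assume "u \<notin> Span B Us"
    then have "independent B (u # Us)" using u Ec Us(1) by (intro li_Cons) auto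
    then have "P (Suc k)" unfolding P_def using u Us by (intro exI[of _ "u # Us"]) auto
    then show False using k(2) by fastforce
  qed
  ultimately have "Span B Us = E" by blast
  then have "dimension k B E" using dimensionI[OF B Us(1)] Us(3) by simp
  moreover have "k \<le> m" using bound[OF Us(1,2)] Us(3) by simp
  ultimately show ?thesis by blast
qed

end

section \<open>Endomorphisms of a field, their fixed fields and norms\<close>

locale field_endo = field R for R (structure) +
  fixes s :: "'a \<Rightarrow> 'a"
  assumes hom: "s \<in> ring_hom R R"
begin

lemma s_closed [simp]: "x \<in> carrier R \<Longrightarrow> s x \<in> carrier R"
  and s_mult: "x \<in> carrier R \<Longrightarrow> y \<in> carrier R \<Longrightarrow> s (x \<otimes> y) = s x \<otimes> s y"
  and s_add: "x \<in> carrier R \<Longrightarrow> y \<in> carrier R \<Longrightarrow> s (x \<oplus> y) = s x \<oplus> s y"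
  and s_one [simp]: "s \<one> = \<one>"
  using ring_hom_memE[OF hom] by blast+

lemma pow_hom: "s ^^ k \<in> ring_hom R R"
proof (induction k)
  case 0 then show ?case by (auto intro!: ring_hom_memI)
next
  case (Suc k) then show ?case unfolding funpow.simps using hom by (rule ring_hom_trans)
qed

lemma field_endo_pow: "field_endo R (s ^^ k)"
  by (intro field_endo.intro field_endo_axioms.intro pow_hom) (rule field_axioms)

lemma pow_closed [simp]: "x \<in> carrier R \<Longrightarrow> (s ^^ k) x \<in> carrier R"
  and pow_mult: "x \<in> carrier R \<Longrightarrow> y \<in> carrier R \<Longrightarrow> (s ^^ k) (x \<otimes> y) = (s ^^ k) x \<otimes> (s ^^ k) y"
  and pow_add: "x \<in> carrier R \<Longrightarrow> y \<in> carrier R \<Longrightarrow> (s ^^ k) (x \<oplus> y) = (s ^^ k) x \<oplus> (s ^^ k) y"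
  and pow_one [simp]: "(s ^^ k) \<one> = \<one>"
  using ring_hom_memE[OF pow_hom[of k]] by blast+

lemma s_zero [simp]: "s \<zero> = \<zero>"
  using s_add[of \<zero> \<zero>] by (metis add.r_cancel_one' s_closed zero_closed r_zero)

lemma pow_zero [simp]: "(s ^^ k) \<zero> = \<zero>"
  by (induction k) auto

lemma s_minus: "x \<in> carrier R \<Longrightarrow> s (\<ominus> x) = \<ominus> s x"
  using s_add[of "\<ominus> x" x] by (metis a_inv_closed l_neg minus_equality s_closed s_zero)

lemma s_nonzero: "x \<in> carrier R \<Longrightarrow> x \<noteq> \<zero> \<Longrightarrow> s x \<noteq> \<zero>"
proof
  assume x: "x \<in> carrier R" "x \<noteq> \<zero>" "s x = \<zero>"
  then have "x \<otimes> inv x = \<one>" "inv x \<in> carrier R" by (auto simp: field_Units)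
  then have "s x \<otimes> s (inv x) = \<one>" using x s_mult[of x "inv x"] by simp
  then show False using x \<open>inv x \<in> carrier R\<close> by simp
qed

lemma s_inj: "x \<in> carrier R \<Longrightarrow> y \<in> carrier R \<Longrightarrow> s x = s y \<Longrightarrow> x = y"
proof (rule ccontr)
  assume x: "x \<in> carrier R" "y \<in> carrier R" "s x = s y" "x \<noteq> y"
  then have "s (x \<ominus> y) \<noteq> \<zero>" by (intro s_nonzero) auto
  then show False using x by (simp add: minus_eq s_add s_minus r_neg)
qed

lemma s_inv:
  assumes "x \<in> carrier R" "x \<noteq> \<zero>"
  shows "s (inv x) = inv (s x)"
proof -
  have x: "x \<otimes> inv x = \<one>" "inv x \<in> carrier R" using assms by (auto simp: field_Units)
  then have "s x \<otimes> s (inv x) = \<one>" using assms s_mult[of x "inv x"] by simp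
  then show ?thesis using assms x by (metis comm_inv_char s_closed)
qed

lemma s_nat_pow: "x \<in> carrier R \<Longrightarrow> s (x [^] (k::nat)) = s x [^] k"
  by (induction k) (auto simp: s_mult)

lemma pow_inj: "x \<in> carrier R \<Longrightarrow> y \<in> carrier R \<Longrightarrow> (s ^^ k) x = (s ^^ k) y \<Longrightarrow> x = y"
  using field_endo.s_inj[OF field_endo_pow] .

text \<open>The injective map \<open>s ^^ i\<close> cancels from both powers and leaves
  \<open>s ^^ (j - i)\<close>, which is nontrivial on \<open>L\<close>.\<close>

lemma powers_distinct:
  assumes L: "L \<subseteq> carrier R" and distinct: "\<And>k. 0 < k \<Longrightarrow> k < r \<Longrightarrow> \<exists>x\<in>L. (s ^^ k) x \<noteq> x"
    and ij: "i < j" "j < r"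
  shows "\<exists>x\<in>L. (s ^^ i) x \<noteq> (s ^^ j) x"
proof -
  have "0 < j - i" "j - i < r" using ij by auto
  then obtain x where x: "x \<in> L" "(s ^^ (j - i)) x \<noteq> x" using distinct by blast
  have "(s ^^ (i + (j - i))) x = (s ^^ i) ((s ^^ (j - i)) x)" by (simp only: funpow_add o_apply)
  then have "(s ^^ j) x = (s ^^ i) ((s ^^ (j - i)) x)" using ij by simp
  then have "(s ^^ i) x \<noteq> (s ^^ j) x" using pow_inj[of "(s ^^ (j - i)) x" x i] x L by auto
  then show ?thesis using x by blast
qed

text \<open>For a cyclic extension of degree \<open>p ^ n\<close> with generator \<open>s\<close>,
  \<open>fixed 1\<close> is the base field F and \<open>fixed (p ^ i)\<close> the intermediate field
  K_i.\<close>

definition fixed :: "nat \<Rightarrow> 'a set" where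
  "fixed k = {x \<in> carrier R. (s ^^ k) x = x}"

lemma subfield_fixed: "subfield (fixed k) R"
proof -
  interpret p: field_endo R "s ^^ k" by (rule field_endo_pow)
  show ?thesis
  proof (rule subfieldI')
    show "subring (fixed k) R"
      by (rule subringI) (auto simp: fixed_def p.s_minus pow_add pow_mult)
    show "inv x \<in> fixed k" if "x \<in> fixed k - {\<zero>}" for x
      using that p.s_inv[of x] by (auto simp: fixed_def field_Units)
  qed
qed

lemma pow_fixed_mult:
  assumes "x \<in> fixed k"
  shows "(s ^^ (k * j)) x = x"
  using assms by (induction j) (auto simp: funpow_add fixed_def)

lemma fixed_mono: "k dvd m \<Longrightarrow> fixed k \<subseteq> fixed m"
  using pow_fixed_mult by (auto simp: fixed_def elim!: dvdE)

lemma pow_fixed_mod: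
  assumes "x \<in> fixed k"
  shows "(s ^^ i) x = (s ^^ (i mod k)) x"
proof -
  have "(s ^^ (i mod k + k * (i div k))) x = (s ^^ (i mod k)) x"
    unfolding funpow_add using pow_fixed_mult[OF assms] by simp
  then show ?thesis by simp
qed

lemma fixed_pow: "field_endo.fixed R (s ^^ k) j = fixed (k * j)"
  unfolding fixed_def field_endo.fixed_def[OF field_endo_pow] by (simp add: funpow_mult)

lemma pow_finsum:
  assumes "\<And>j. j \<in> J \<Longrightarrow> f j \<in> carrier R"
  shows "(s ^^ k) (\<Oplus>j\<in>J. f j) = (\<Oplus>j\<in>J. (s ^^ k) (f j))"
  using assms by (induction J rule: infinite_finite_induct) (auto simp: pow_add Pi_iff)

lemma iterated_norm_closed [simp]: "x \<in> carrier R \<Longrightarrow> iterated_norm R s k x \<in> carrier R"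
  by (induction k) auto

lemma iterated_norm_mult:
  "x \<in> carrier R \<Longrightarrow> y \<in> carrier R \<Longrightarrow>
    iterated_norm R s k (x \<otimes> y) = iterated_norm R s k x \<otimes> iterated_norm R s k y"
  by (induction k) (auto simp: s_mult m_ac)

lemma iterated_norm_one [simp]: "iterated_norm R s k \<one> = \<one>"
  by (induction k) auto

lemma iterated_norm_fixed:
  assumes "x \<in> fixed 1"
  shows "iterated_norm R s k x = x [^] k"
  using assms by (induction k) (auto simp: fixed_def s_nat_pow m_comm)

lemma iterated_norm_pow:
  "x \<in> carrier R \<Longrightarrow> iterated_norm R s k (x [^] (j::nat)) = iterated_norm R s k x [^] j"
  by (induction j) (auto simp: iterated_norm_mult)

lemma iterated_norm_nonzero:
  "x \<in> carrier R \<Longrightarrow> x \<noteq> \<zero> \<Longrightarrow> iterated_norm R s k x \<noteq> \<zero>"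
  by (induction k) (auto simp: s_nonzero integral_iff)

lemma iterated_norm_add:
  "x \<in> carrier R \<Longrightarrow> iterated_norm R s (j + k) x = iterated_norm R s j x \<otimes> (s ^^ j) (iterated_norm R s k x)"
  by (induction j) (auto simp: s_mult m_assoc)

text \<open>Transitivity of the norm: the exponents below \<open>j * k\<close> are those of the form
  \<open>a + j * b\<close> with \<open>a < j\<close> and \<open>b < k\<close>.\<close>

lemma iterated_norm_times:
  assumes "x \<in> carrier R"
  shows "iterated_norm R (s ^^ j) k (iterated_norm R s j x) = iterated_norm R s (j * k) x"
  using assms by (induction k) (auto simp: iterated_norm_add)

lemma iterated_norm_commute:
  assumes "x \<in> carrier R"
  shows "iterated_norm R s k (s x) = s (iterated_norm R s k x)"
  using assms by (induction k) (auto simp: s_mult)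

text \<open>Both sides multiply the same \<open>Suc k\<close> conjugates of \<open>x\<close>. If
  \<open>x\<close> is nonzero and fixed by \<open>s ^^ k\<close>, it follows that \<open>s\<close>
  fixes the norm.\<close>

lemma iterated_norm_telescope:
  assumes "x \<in> carrier R"
  shows "x \<otimes> s (iterated_norm R s k x) = iterated_norm R s k x \<otimes> (s ^^ k) x"
  using assms iterated_norm_add[of x k 1] by simp

text \<open>With fewer basis elements than distinct maps \<open>s ^^ j\<close> on \<open>L\<close>,
  some linear relation between the maps holds on a basis, hence on \<open>L\<close>, against
  independence of characters. This is Dedekind's bound.\<close>

lemma independent_length_le_fixed:
  assumes L: "subfield L R" "F \<subseteq> L" and F: "subfield F R" "F \<subseteq> fixed 1"
    and dim: "dimension d F L" and distinct: "\<And>k. 0 < k \<Longrightarrow> k < r \<Longrightarrow> \<exists>x\<in>L. (s ^^ k) x \<noteq> x"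
  shows "r \<le> d"
proof (rule ccontr)
  assume "\<not> r \<le> d"
  then have dr: "d < r" by simp
  have Lc: "L \<subseteq> carrier R" using subfieldE(3)[OF L(1)] .
  obtain Vs where Vs: "set Vs \<subseteq> carrier R" "length Vs = d" "Span F Vs = L"
    using exists_base[OF F(1) dim] by blast
  have Vsc: "Vs ! i \<in> carrier R" if "i < d" for i using Vs(1,2) nth_mem[of i Vs] that by blast
  \<comment> \<open>One equation for each basis element, one unknown for each power of
    \<open>s\<close>.\<close>
  have "\<exists>c. (\<forall>j\<in>{..<r}. c j \<in> carrier R) \<and> (\<exists>j\<in>{..<r}. c j \<noteq> \<zero>) \<and>
      (\<forall>i<d. (\<Oplus>j\<in>{..<r}. (s ^^ j) (Vs ! i) \<otimes> c j) = \<zero>)"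
    using Vsc dr by (intro homogeneous_system) auto
  then obtain c where c: "\<forall>j\<in>{..<r}. c j \<in> carrier R" "\<exists>j\<in>{..<r}. c j \<noteq> \<zero>"
    "\<forall>i<d. (\<Oplus>j\<in>{..<r}. (s ^^ j) (Vs ! i) \<otimes> c j) = \<zero>" by (elim exE conjE)
  have Ff: "(s ^^ j) k = k" if "k \<in> F" for j k
    using pow_fixed_mult[of k 1 j] that F(2) by auto
  have Fc: "F \<subseteq> carrier R" using F(2) by (auto simp: fixed_def)
  \<comment> \<open>The relation spreads from the basis to its linear combinations because the
    powers of \<open>s\<close> fix \<open>F\<close>.\<close>
  have comb: "(\<Oplus>j\<in>{..<r}. c j \<otimes> (s ^^ j) (combine Ks Us)) = \<zero>"
    if "set Ks \<subseteq> F" "set Us \<subseteq> set Vs" for Ks Us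
    using that
  proof (induction Ks Us rule: combine.induct)
    case (1 k Ks u Us)
    have k: "k \<in> F" "k \<in> carrier R" and u: "u \<in> set Vs" "u \<in> carrier R" using 1 Fc Vs by auto
    have cb: "combine Ks Us \<in> carrier R" using 1 Fc Vs by (intro combine_in_carrier) auto
    obtain i where i: "i < d" "u = Vs ! i" using u Vs by (metis in_set_conv_nth)
    have "(\<Oplus>j\<in>{..<r}. c j \<otimes> (s ^^ j) (combine (k # Ks) (u # Us))) =
        (\<Oplus>j\<in>{..<r}. k \<otimes> ((s ^^ j) u \<otimes> c j) \<oplus> c j \<otimes> (s ^^ j) (combine Ks Us))"
      using c k u cb by (intro finsum_cong') (auto simp: pow_add pow_mult Ff r_distr m_ac)
    also have "\<dots> = (\<Oplus>j\<in>{..<r}. k \<otimes> ((s ^^ j) u \<otimes> c j)) \<oplus> (\<Oplus>j\<in>{..<r}. c j \<otimes> (s ^^ j) (combine Ks Us))"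
      using c k u cb by (intro finsum_addf) auto
    also have "(\<Oplus>j\<in>{..<r}. k \<otimes> ((s ^^ j) u \<otimes> c j)) = k \<otimes> (\<Oplus>j\<in>{..<r}. (s ^^ j) u \<otimes> c j)"
      using c k u by (intro finsum_rdistr[symmetric]) auto
    also have "(\<Oplus>j\<in>{..<r}. (s ^^ j) u \<otimes> c j) = \<zero>" using c(3) i by simp
    also have "(\<Oplus>j\<in>{..<r}. c j \<otimes> (s ^^ j) (combine Ks Us)) = \<zero>" using 1 by auto
    finally show ?case using k by simp
  qed (use c in \<open>auto intro!: add.finprod_one_eqI\<close>)
  have rel: "(\<Oplus>j\<in>{..<r}. c j \<otimes> (s ^^ j) x) = \<zero>" if x: "x \<in> L" for x
  proof -
    obtain Ks where "set Ks \<subseteq> F" "x = combine Ks Vs"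
      using x Vs(3) Span_eq_combine_set[OF F(1) Vs(1)] by blast
    then show ?thesis using comb[of Ks Vs] by simp
  qed
  have one: "\<one> \<in> L" using subringE(3)[OF subfieldE(1)[OF L(1)]] .
  have "c j = \<zero>" if j: "j < r" for j
  proof (rule independence_of_characters[of L r "\<lambda>j. s ^^ j" c j])
    show "\<exists>x\<in>L. (s ^^ i) x \<noteq> (s ^^ j) x" if "i < j" "j < r" for i j
      using powers_distinct[OF Lc distinct that] .
    show "\<exists>x\<in>L. (s ^^ j) x \<noteq> \<zero>" for j using one by (intro bexI[of _ \<one>]) auto
  qed (use L Lc c rel j subringE(6)[OF subfieldE(1)[OF L(1)]] in \<open>auto simp: pow_mult subset_iff\<close>)
  then show False using c(2) by auto
qed

end

section \<open>Automorphisms of finite order: Hilbert 90 and Artin's bound\<close>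

locale field_aut = field_endo +
  fixes N :: nat
  assumes N_pos: "N > 0"
    and pow_N: "x \<in> carrier R \<Longrightarrow> (s ^^ N) x = x"
    and order: "0 < k \<Longrightarrow> k < N \<Longrightarrow> \<exists>x\<in>carrier R. (s ^^ k) x \<noteq> x"
begin

lemma powers_independent:
  assumes "\<And>j. j < N \<Longrightarrow> c j \<in> carrier R" "j < N" "c j \<noteq> \<zero>"
  shows "\<exists>x\<in>carrier R. (\<Oplus>j\<in>{..<N}. c j \<otimes> (s ^^ j) x) \<noteq> \<zero>"
proof (rule ccontr)
  assume neg: "\<not> ?thesis"
  have "c j = \<zero>"
  proof (rule independence_of_characters[of "carrier R" N "\<lambda>j. s ^^ j" c j])
    show "\<exists>x\<in>carrier R. (s ^^ i) x \<noteq> (s ^^ j) x" if "i < j" "j < N" for i j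
      using powers_distinct[OF subset_refl order that] .
    show "\<exists>x\<in>carrier R. (s ^^ j) x \<noteq> \<zero>" for j by (intro bexI[of _ \<one>]) auto
  qed (use assms neg in \<open>auto simp: pow_mult\<close>)
  then show False using assms by simp
qed

text \<open>Let \<open>l = inv x\<close>, let \<open>a k\<close> be the product of the first
  \<open>k\<close> conjugates of \<open>l\<close>, and let \<open>y\<close> be the Lagrange
  resolvent, the sum of the \<open>a j \<otimes> (s ^^ j) z\<close>. Applying \<open>s\<close> and
  multiplying by \<open>l\<close> shifts the index, and \<open>a N = \<one>\<close> closes the
  cycle, so \<open>l \<otimes> s y = y\<close>. Independence of characters provides a
  \<open>z\<close> with \<open>y\<close> nonzero.\<close>

theorem Hilbert90:
  assumes x: "x \<in> carrier R" "x \<noteq> \<zero>" and norm: "iterated_norm R s N x = \<one>"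
  obtains y where "y \<in> carrier R" "y \<noteq> \<zero>" "s y = x \<otimes> y"
proof -
  define l where "l = inv x"
  have l: "l \<in> carrier R" "x \<otimes> l = \<one>" unfolding l_def using x by (auto simp: field_Units)
  define a where "a k = iterated_norm R s k l" for k
  have ac: "a k \<in> carrier R" for k unfolding a_def using l by simp
  have "a N \<otimes> iterated_norm R s N x = iterated_norm R s N (l \<otimes> x)"
    unfolding a_def using l x by (simp add: iterated_norm_mult)
  then have aN: "a N = \<one>" using norm ac l x m_comm[of l x] by simp
  have "a 0 \<noteq> \<zero>" by (simp add: a_def)
  then obtain z where z: "z \<in> carrier R" "(\<Oplus>j\<in>{..<N}. a j \<otimes> (s ^^ j) z) \<noteq> \<zero>"
    using powers_independent[of a 0] ac N_pos by blast
  define y where "y = (\<Oplus>j\<in>{..<N}. a j \<otimes> (s ^^ j) z)"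
  have y: "y \<in> carrier R" "y \<noteq> \<zero>" unfolding y_def using z ac by (auto intro!: finsum_closed)
  have "s y = (\<Oplus>j\<in>{..<N}. s (a j) \<otimes> (s ^^ Suc j) z)"
    unfolding y_def
      using pow_finsum[of "{..<N}" "\<lambda>j. a j \<otimes> (s ^^ j) z" 1] z ac by (simp add: s_mult)
  then have "l \<otimes> s y = (\<Oplus>j\<in>{..<N}. l \<otimes> (s (a j) \<otimes> (s ^^ Suc j) z))"
    using l z ac by (auto intro!: finsum_rdistr)
  also have "\<dots> = (\<Oplus>j\<in>{..<N}. a (Suc j) \<otimes> (s ^^ Suc j) z)"
    using l z ac by (intro finsum_cong') (auto simp: a_def m_assoc)
  \<comment> \<open>The sum of \<open>Suc N\<close> terms is split at its first and at its last
    term, both equal to \<open>z\<close>.\<close>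
  finally have "a 0 \<otimes> (s ^^ 0) z \<oplus> l \<otimes> s y = (\<Oplus>j\<in>{..<Suc N}. a j \<otimes> (s ^^ j) z)"
    using z ac by (subst add.finprod_lessThan_Suc_shift) (auto simp del: funpow.simps)
  also have "\<dots> = a N \<otimes> (s ^^ N) z \<oplus> y"
    unfolding y_def using z ac by (intro finsum_lessThan_Suc) auto
  finally have "z \<oplus> l \<otimes> s y = z \<oplus> y" using aN pow_N[OF z(1)] z y by (simp add: a_def)
  then have "l \<otimes> s y = y" using z y l by simp
  then have "s y = x \<otimes> y" using l x y by (metis m_assoc s_closed l_one)
  then show thesis using that y by blast
qed

text \<open>As in Artin's theorem on fixed fields, the trace turns a relation with coefficients in the field
  into one with coefficients in the fixed field.\<close>

lemma fixed_dependent: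
  assumes J: "finite J" "m < card J" "m > 0" and x: "\<And>j. j \<in> J \<Longrightarrow> x j \<in> fixed m"
  shows "\<exists>b. (\<forall>j\<in>J. b j \<in> fixed 1) \<and> (\<exists>j\<in>J. b j \<noteq> \<zero>) \<and> (\<Oplus>j\<in>J. b j \<otimes> x j) = \<zero>"
proof -
  have xc: "x j \<in> carrier R" if "j \<in> J" for j using x[OF that] by (simp add: fixed_def)
  \<comment> \<open>\<open>m\<close> equations, one for each of the first \<open>m\<close>
    conjugates of the family \<open>x\<close>, in more than \<open>m\<close> unknowns.\<close>
  have "\<exists>c. (\<forall>j\<in>J. c j \<in> carrier R) \<and> (\<exists>j\<in>J. c j \<noteq> \<zero>) \<and> (\<forall>i<m. (\<Oplus>j\<in>J. (s ^^ i) (x j) \<otimes> c j) = \<zero>)"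
    using J xc by (intro homogeneous_system) auto
  then obtain c where c: "\<forall>j\<in>J. c j \<in> carrier R" and ex: "\<exists>j\<in>J. c j \<noteq> \<zero>"
    and cm: "\<forall>i<m. (\<Oplus>j\<in>J. (s ^^ i) (x j) \<otimes> c j) = \<zero>" by (elim exE conjE)
  obtain k where k: "k \<in> J" "c k \<noteq> \<zero>" using ex by blast
  define tr where "tr t w = (\<Oplus>i\<in>{..<t}. (s ^^ i) w)" for t w
  have trc: "tr t w \<in> carrier R"
    if "w \<in> carrier R" for t w unfolding tr_def using that by (intro finsum_closed) auto
  have tr_Suc: "tr (Suc t) w = (s ^^ t) w \<oplus> tr t w" if "w \<in> carrier R" for t w
    unfolding tr_def using that by (intro finsum_lessThan_Suc) auto
  have tr_shift: "tr (Suc t) w = w \<oplus> s (tr t w)" if "w \<in> carrier R" for t w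
    unfolding tr_def using that pow_finsum[of "{..<t}" "\<lambda>i. (s ^^ i) w" 1]
    by (subst add.finprod_lessThan_Suc_shift) auto
  have trfix: "tr N w \<in> fixed 1" if w: "w \<in> carrier R" for w
  proof -
    have "w \<oplus> s (tr N w) = w \<oplus> tr N w"
      using tr_Suc[OF w, of N] tr_shift[OF w, of N] pow_N[OF w] by simp
    then show ?thesis unfolding fixed_def using w trc by simp
  qed
  obtain z where z: "z \<in> carrier R" "(\<Oplus>i\<in>{..<N}. \<one> \<otimes> (s ^^ i) z) \<noteq> \<zero>"
    using powers_independent[of "\<lambda>_. \<one>" 0] N_pos by auto
  have "(\<Oplus>i\<in>{..<N}. \<one> \<otimes> (s ^^ i) z) = tr N z"
    unfolding tr_def using z(1) by (intro finsum_cong') auto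
  then have trz: "tr N z \<noteq> \<zero>" using z(2) by simp
  \<comment> \<open>Rescaling makes the coefficient at \<open>k\<close> equal to \<open>z\<close>,
    whose trace is nonzero, so the relation stays nontrivial after taking traces.\<close>
  define q where "q = inv (c k) \<otimes> z"
  have q: "q \<in> carrier R" "q \<otimes> c k = z"
  proof -
    have ck: "c k \<in> carrier R" "inv (c k) \<in> carrier R" "inv (c k) \<otimes> c k = \<one>"
      using k c by (auto simp: field_Units)
    then show "q \<in> carrier R" unfolding q_def using z by simp
    have "q \<otimes> c k = z \<otimes> (inv (c k) \<otimes> c k)"
      unfolding q_def using ck z(1) by (simp only: m_ac m_closed)
    then show "q \<otimes> c k = z" using ck z(1) by simp
  qed
  define e where "e j = q \<otimes> c j" for j
  have ec: "e j \<in> carrier R" if "j \<in> J" for j unfolding e_def using q c that by simp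
  \<comment> \<open>As the \<open>x j\<close> are fixed by \<open>s ^^ m\<close>, the equations for
    \<open>i < m\<close> give those for all \<open>i\<close>.\<close>
  have rel: "(\<Oplus>j\<in>J. (s ^^ i) (x j) \<otimes> e j) = \<zero>" for i
  proof -
    have "(\<Oplus>j\<in>J. (s ^^ i) (x j) \<otimes> e j) = (\<Oplus>j\<in>J. q \<otimes> ((s ^^ (i mod m)) (x j) \<otimes> c j))"
    proof (intro finsum_cong')
      fix j assume j: "j \<in> J"
      show "(s ^^ i) (x j) \<otimes> e j = q \<otimes> ((s ^^ (i mod m)) (x j) \<otimes> c j)"
        unfolding pow_fixed_mod[OF x[OF j], of i] e_def using xc[OF j] q c j by (simp add: m_lcomm)
    qed (use xc q c in auto)
    also have "\<dots> = q \<otimes> (\<Oplus>j\<in>J. (s ^^ (i mod m)) (x j) \<otimes> c j)"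
      using xc q c J(1) by (intro finsum_rdistr[symmetric]) auto
    also have "\<dots> = \<zero>" using cm[rule_format, of "i mod m"] J(3) q by simp
    finally show ?thesis .
  qed
  \<comment> \<open>Applying \<open>s ^^ i\<close> to the equation with exponent
    \<open>N - i\<close> moves the conjugation from the \<open>x j\<close> to the coefficients;
    summing over \<open>i\<close> gives the traces.\<close>
  have rel': "(\<Oplus>j\<in>J. (s ^^ i) (e j) \<otimes> x j) = \<zero>" if i: "i < N" for i
  proof -
    have "\<zero> = (s ^^ i) (\<Oplus>j\<in>J. (s ^^ (N - i)) (x j) \<otimes> e j)" unfolding rel by simp
    also have "\<dots> = (\<Oplus>j\<in>J. (s ^^ i) ((s ^^ (N - i)) (x j) \<otimes> e j))"
      using xc ec by (intro pow_finsum) auto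
    also have "\<dots> = (\<Oplus>j\<in>J. (s ^^ i) (e j) \<otimes> x j)"
    proof (intro finsum_cong')
      fix j assume j: "j \<in> J"
      have "(s ^^ i) ((s ^^ (N - i)) (x j)) = (s ^^ (i + (N - i))) (x j)"
        by (simp only: funpow_add o_apply)
      then have "(s ^^ i) ((s ^^ (N - i)) (x j)) = x j" using i pow_N[OF xc[OF j]] by simp
      then show "(s ^^ i) ((s ^^ (N - i)) (x j) \<otimes> e j) = (s ^^ i) (e j) \<otimes> x j"
        using xc[OF j] ec[OF j] by (simp add: pow_mult m_comm)
    qed (use xc ec in auto)
    finally show ?thesis by simp
  qed
  have "(\<Oplus>j\<in>J. tr t (e j) \<otimes> x j) = \<zero>" if "t \<le> N" for t
    using that
  proof (induction t)
    case 0 then show ?case unfolding tr_def using xc by (intro add.finprod_one_eqI) auto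
  next
    case (Suc t)
    have "(\<Oplus>j\<in>J. tr (Suc t) (e j) \<otimes> x j) = (\<Oplus>j\<in>J. (s ^^ t) (e j) \<otimes> x j \<oplus> tr t (e j) \<otimes> x j)"
      using xc ec trc by (intro finsum_cong') (auto simp: tr_Suc l_distr)
    also have "\<dots> = (\<Oplus>j\<in>J. (s ^^ t) (e j) \<otimes> x j) \<oplus> (\<Oplus>j\<in>J. tr t (e j) \<otimes> x j)"
      using xc ec trc by (intro finsum_addf) auto
    also have "\<dots> = \<zero>" using rel'[of t] Suc by simp
    finally show ?case .
  qed
  then have "(\<Oplus>j\<in>J. tr N (e j) \<otimes> x j) = \<zero>" by simp
  moreover have "tr N (e k) \<noteq> \<zero>" unfolding e_def q(2) by (rule trz)
  ultimately show ?thesis using trfix ec k(1) by (intro exI[of _ "\<lambda>j. tr N (e j)"]) blast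
qed

lemma dimension_fixed_le:
  assumes "m > 0"
  shows "\<exists>d\<le>m. dimension d (fixed 1) (fixed m)"
proof (rule dimension_le[OF subfield_fixed subfield_fixed])
  show "fixed 1 \<subseteq> fixed m" by (rule fixed_mono) simp
  fix Us assume Us: "independent (fixed 1) Us" "set Us \<subseteq> fixed m"
  have Uc: "set Us \<subseteq> carrier R" using Us(2) by (auto simp: fixed_def)
  show "length Us \<le> m"
  proof (rule ccontr)
    assume "\<not> length Us \<le> m"
    then have "\<exists>b. (\<forall>j\<in>{..<length Us}. b j \<in> fixed 1) \<and> (\<exists>j\<in>{..<length Us}. b j \<noteq> \<zero>) \<and>
        (\<Oplus>j\<in>{..<length Us}. b j \<otimes> Us ! j) = \<zero>"
      using assms Us(2) nth_mem by (intro fixed_dependent) auto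
    then obtain b where b: "\<forall>j\<in>{..<length Us}. b j \<in> fixed 1" "\<exists>j\<in>{..<length Us}. b j \<noteq> \<zero>"
      "(\<Oplus>j\<in>{..<length Us}. b j \<otimes> Us ! j) = \<zero>" by (elim exE conjE)
    have "combine (map b [0..<length Us]) Us = \<zero>"
      using b(1,3) Uc by (subst combine_eq_finsum) (auto simp: fixed_def)
    then have "set (take (length Us) (map b [0..<length Us])) \<subseteq> {\<zero>}"
      using b(1) by (intro independent_imp_trivial_combine[OF subfield_fixed Us(1)]) auto
    then show False using b(2) by (auto simp: image_subset_iff)
  qed
qed

end

section \<open>Cyclic extensions of prime power degree\<close>

lemma (in field_endo) iterated_norm_pow_commute:
  assumes "x \<in> carrier R"
  shows "iterated_norm R (s ^^ j) k (s x) = s (iterated_norm R (s ^^ j) k x)"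
proof -
  interpret p: field_endo R "s ^^ j" by (rule field_endo_pow)
  show ?thesis using assms by (induction k) (auto simp: s_mult funpow_swap1)
qed

lemma (in field) inverse_props:
  assumes "x \<in> carrier R" "x \<noteq> \<zero>"
  shows "inv x \<in> carrier R" "inv x \<noteq> \<zero>" "x \<otimes> inv x = \<one>" "inv x \<otimes> x = \<one>"
  using assms field_Units Units_inv_closed Units_r_inv Units_l_inv Units_inv_Units by auto

lemma (in field) nat_pow_nonzero: "x \<in> carrier R \<Longrightarrow> x \<noteq> \<zero> \<Longrightarrow> x [^] (k::nat) \<noteq> \<zero>"
  by (induction k) (auto simp: integral_iff)

section \<open>Order of the generator, intermediate fields and representatives from Hilbert
  90\<close>

locale cyclic_extension = field_endo +
  fixes p n :: nat
  assumes prime_p: "Factorial_Ring.prime p"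
    and dim: "dimension (p ^ n) (fixed 1) (carrier R)"
begin

lemma p_pos: "p ^ i > 0"
  using prime_p by (simp add: prime_gt_0_nat)

text \<open>Dedekind's bound makes the order of \<open>s\<close> at most \<open>p ^ n\<close>, and
  \<open>dimension_fixed_le\<close> makes the degree over the fixed field at most the order.\<close>

lemma field_aut: "field_aut R s (p ^ n)"
proof -
  have "\<exists>k. 0 < k \<and> k < Suc (p ^ n) \<and> (\<forall>x\<in>carrier R. (s ^^ k) x = x)"
  proof (rule ccontr)
    assume "\<not> ?thesis"
    then have "Suc (p ^ n) \<le> p ^ n"
      by (intro independent_length_le_fixed[OF carrier_is_subfield _ subfield_fixed _ dim])
        (auto simp: fixed_def)
    then show False by simp
  qed
  then obtain k where k: "0 < k" "k < Suc (p ^ n)" "\<forall>x\<in>carrier R. (s ^^ k) x = x" by blast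
  define N where "N = (LEAST N. 0 < N \<and> (\<forall>x\<in>carrier R. (s ^^ N) x = x))"
  have N: "0 < N" "\<forall>x\<in>carrier R. (s ^^ N) x = x"
    using LeastI[of "\<lambda>N. 0 < N \<and> (\<forall>x\<in>carrier R. (s ^^ N) x = x)" k] k unfolding N_def by auto
  have Nk: "N \<le> k" unfolding N_def using k by (intro Least_le) auto
  interpret field_aut R s N
  proof
    show "\<exists>x\<in>carrier R. (s ^^ k) x \<noteq> x" if "0 < k" "k < N" for k
      using that not_less_Least[of k "\<lambda>N. 0 < N \<and> (\<forall>x\<in>carrier R. (s ^^ N) x = x)"]
        unfolding N_def by auto
  qed (use N in auto)
  obtain d where d: "d \<le> N" "dimension d (fixed 1) (fixed N)"
    using dimension_fixed_le[OF N(1)] by blast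
  have "fixed N = carrier R" using N(2) unfolding fixed_def by auto
  then have "d = p ^ n" using dimension_is_inj[OF subfield_fixed d(2)] dim by simp
  then have "N = p ^ n" using d Nk k by simp
  then show ?thesis using field_aut_axioms by simp
qed

sublocale field_aut R s "p ^ n" by (rule field_aut)

lemma field_aut_pow:
  assumes "i \<le> n"
  shows "field_aut R (s ^^ (p ^ i)) (p ^ (n - i))"
proof -
  have pn: "p ^ i * p ^ (n - i) = p ^ n" using assms by (simp flip: power_add)
  interpret q: field_endo R "s ^^ (p ^ i)" by (rule field_endo_pow)
  show ?thesis
  proof
    show "0 < p ^ (n - i)" by (rule p_pos)
    show "((s ^^ p ^ i) ^^ p ^ (n - i)) x = x" if "x \<in> carrier R" for x
      using pow_N[OF that] by (simp add: funpow_mult pn)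
    show "\<exists>x\<in>carrier R. ((s ^^ p ^ i) ^^ k) x \<noteq> x" if k: "0 < k" "k < p ^ (n - i)" for k
    proof -
      have "p ^ i * k < p ^ n" using k p_pos[of i] unfolding pn[symmetric] by simp
      moreover have "0 < p ^ i * k" using k p_pos by simp
      ultimately show ?thesis using order[of "p ^ i * k"] by (simp add: funpow_mult)
    qed
  qed
qed

lemma fixed_pn: "fixed (p ^ n) = carrier R"
  unfolding fixed_def using pow_N by auto

text \<open>The two steps of the tower through \<open>fixed (p ^ i)\<close> have degrees at most
  \<open>p ^ i\<close> and \<open>p ^ (n - i)\<close>, and these degrees multiply to
  \<open>p ^ n\<close>.\<close>

lemma dimension_fixed:
  assumes i: "i \<le> n"
  shows "dimension (p ^ i) (fixed 1) (fixed (p ^ i))"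
proof -
  interpret q: field_aut R "s ^^ (p ^ i)" "p ^ (n - i)" by (rule field_aut_pow[OF i])
  have pn: "p ^ i * p ^ (n - i) = p ^ n" using i by (simp flip: power_add)
  obtain d where d: "d \<le> p ^ i" "dimension d (fixed 1) (fixed (p ^ i))"
    using dimension_fixed_le[OF p_pos] by blast
  obtain d' where d': "d' \<le> p ^ (n - i)" "dimension d' (q.fixed 1) (q.fixed (p ^ (n - i)))"
    using q.dimension_fixed_le[OF p_pos] by blast
  have "q.fixed 1 = fixed (p ^ i)" "q.fixed (p ^ (n - i)) = carrier R"
    unfolding fixed_pow pn fixed_pn by simp_all
  then have "dimension (d * d') (fixed 1) (carrier R)"
    using telescopic_base[OF subfield_fixed subfield_fixed d(2)] d'(2) by simp
  then have e: "d * d' = p ^ i * p ^ (n - i)"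
    using dimension_is_inj[OF subfield_fixed _ dim] pn by simp
  have "d = p ^ i"
  proof (rule ccontr)
    assume "d \<noteq> p ^ i"
    then have "d < p ^ i" using d by simp
    moreover have "d' > 0" using e p_pos by (cases d') auto
    ultimately have "d * d' < p ^ i * d'" by simp
    also have "\<dots> \<le> p ^ i * p ^ (n - i)" using d' by simp
    finally show False using e by simp
  qed
  then show ?thesis using d by simp
qed

text \<open>Let \<open>r\<close> be the least positive exponent for which \<open>s ^^ r\<close> is
  trivial on \<open>L\<close>. Dedekind's bound gives \<open>r \<le> p ^ i\<close>, while
  \<open>L\<close> lies in \<open>fixed r\<close>, of degree at most \<open>r\<close>; comparing
  degrees forces equality.\<close>

lemma intermediate_unique:
  assumes i: "i \<le> n" and L: "subfield L R" "fixed 1 \<subseteq> L" "dimension (p ^ i) (fixed 1) L"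
  shows "L = fixed (p ^ i)"
proof -
  have Lc: "L \<subseteq> carrier R" using subfieldE(3)[OF L(1)] .
  define P where "P r \<longleftrightarrow> 0 < r \<and> (\<forall>x\<in>L. (s ^^ r) x = x)" for r
  have "P (p ^ n)" unfolding P_def using p_pos pow_N Lc by auto
  then have Pr: "P (Least P)" by (rule LeastI)
  define r where "r = Least P"
  have r: "0 < r" "\<forall>x\<in>L. (s ^^ r) x = x" using Pr unfolding r_def P_def by auto
  have "\<exists>x\<in>L. (s ^^ k) x \<noteq> x" if "0 < k" "k < r" for k
    using not_less_Least[of k P] that unfolding r_def P_def by auto
  then have rp: "r \<le> p ^ i"
    using L by (intro independent_length_le_fixed[OF L(1,2) subfield_fixed _ L(3)]) auto
  have Lr: "L \<subseteq> fixed r" unfolding fixed_def using r Lc by auto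
  obtain d where d: "d \<le> r" "dimension d (fixed 1) (fixed r)"
    using dimension_fixed_le[OF r(1)] by blast
  obtain Vs where Vs: "independent (fixed 1) Vs" "length Vs = p ^ i" "Span (fixed 1) Vs = L"
    using exists_base[OF subfield_fixed L(3)] by blast
  have "set Vs \<subseteq> L"
    using Span_base_incl[OF subfield_fixed, of Vs] independent_in_carrier[OF Vs(1)] Vs(3) by blast
  then have VsE: "set Vs \<subseteq> fixed r" using Lr by blast
  have "p ^ i \<le> d"
    using independent_length_le_dimension[OF subfield_fixed d(2) Vs(1) VsE] Vs(2) by simp
  then have e: "d = p ^ i" "r = p ^ i" using d rp by auto
  then show ?thesis
    using independent_length_eq_dimension[OF subfield_fixed d(2) Vs(1) VsE] Vs by simp
qed

text \<open>The condition on roots of unity enters through \<open>norm\<close>, which both cases of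
  the theorem supply. Once the norm of \<open>l\<close> is \<open>\<one>\<close>, Hilbert 90 gives
  \<open>d\<close> with \<open>?s d = l \<otimes> d\<close>, and
  \<open>x \<otimes> inv (d [^] p)\<close> is fixed by \<open>?s\<close>.\<close>

lemma fixed_representative:
  assumes i: "i < n" and x: "x \<in> carrier R" "x \<noteq> \<zero>" and l: "l \<in> carrier R" "l \<noteq> \<zero>"
    and eq: "(s ^^ (p ^ i)) x = x \<otimes> l [^] p"
    and norm: "iterated_norm R (s ^^ (p ^ i)) (p ^ (n - i)) l [^] p = \<one> \<Longrightarrow>
      iterated_norm R (s ^^ (p ^ i)) (p ^ (n - i)) l = \<one>"
  obtains y d where "y \<in> fixed (p ^ i)" "y \<noteq> \<zero>" "d \<in> carrier R" "d \<noteq> \<zero>" "x = y \<otimes> d [^] p"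
proof -
  interpret q: field_aut R "s ^^ (p ^ i)" "p ^ (n - i)" using i by (intro field_aut_pow) simp
  let ?s = "s ^^ (p ^ i)" and ?N = "iterated_norm R (s ^^ (p ^ i)) (p ^ (n - i))"
  have N: "?N x \<in> carrier R" "?N x \<noteq> \<zero>" using x by (simp_all add: q.iterated_norm_nonzero)
  \<comment> \<open>The norm of \<open>x\<close> is fixed by \<open>?s\<close>, so taking norms in
    \<open>eq\<close> cancels it and leaves the \<open>p\<close>-th power of the norm of
    \<open>l\<close>.\<close>
  have "x \<otimes> ?s (?N x) = x \<otimes> ?N x"
    using q.iterated_norm_telescope[OF x(1), of "p ^ (n - i)"] q.pow_N[OF x(1)] x N
      by (simp add: m_comm)
  then have "?s (?N x) = ?N x" using x N by (simp add: m_lcancel)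
  then have "?N (x \<otimes> l [^] p) = ?N x"
    unfolding eq[symmetric] using x by (simp add: q.iterated_norm_commute)
  then have "?N x \<otimes> (?N l [^] p) = ?N x \<otimes> \<one>"
    using x l N by (simp add: q.iterated_norm_mult q.iterated_norm_pow)
  then have "?N l [^] p = \<one>" using m_lcancel[OF N(2,1), of "?N l [^] p" \<one>] l by simp
  then have "?N l = \<one>" by (rule norm)
  then obtain d where d: "d \<in> carrier R" "d \<noteq> \<zero>" "?s d = l \<otimes> d" by (rule q.Hilbert90[OF l])
  define e where "e = inv (d [^] p)"
  have dp: "d [^] p \<in> carrier R" "d [^] p \<noteq> \<zero>" using d by (simp_all add: nat_pow_nonzero)
  note ep = inverse_props[OF dp, folded e_def]
  have lp: "l [^] p \<in> carrier R" "l [^] p \<noteq> \<zero>" using l by (simp_all add: nat_pow_nonzero)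
  have "?s e = inv (?s (d [^] p))" unfolding e_def using dp by (rule q.s_inv)
  also have "?s (d [^] p) = l [^] p \<otimes> d [^] p" using d l by (simp add: q.s_nat_pow nat_pow_distrib)
  finally have "?s e \<otimes> (l [^] p \<otimes> d [^] p) = \<one>"
    using inverse_props(4)[of "l [^] p \<otimes> d [^] p"] lp dp by (simp add: integral_iff)
  moreover have "e \<otimes> d [^] p = \<one>" using ep by simp
  ultimately have "(?s e \<otimes> l [^] p) \<otimes> d [^] p = e \<otimes> d [^] p" using ep lp dp by (simp add: m_assoc)
  then have se: "?s e \<otimes> l [^] p = e"
    using m_rcancel[OF dp(2,1), of "?s e \<otimes> l [^] p" e] ep lp by simp
  have "?s (x \<otimes> e) = x \<otimes> (?s e \<otimes> l [^] p)"
    using x ep lp eq by (simp add: q.s_mult m_ac)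
  then have "x \<otimes> e \<in> fixed (p ^ i)" unfolding fixed_def se using x ep by simp
  moreover have "x \<otimes> e \<noteq> \<zero>" using x ep by (simp add: integral_iff)
  moreover have "x = (x \<otimes> e) \<otimes> d [^] p" using x ep dp by (simp add: m_assoc)
  ultimately show thesis using that d by blast
qed

text \<open>Hilbert 90 for the powers of \<open>s ^^ (p ^ (i - 1))\<close> on the whole field suffices: the elements it
  produces need not be shown to lie in \<open>fixed (p ^ i)\<close>.\<close>

lemma norm_representative:
  assumes roots: "\<And>z. z \<in> carrier R \<Longrightarrow> z [^] p = \<one> \<Longrightarrow> z = \<one>"
    and i: "1 \<le> i" "i \<le> n" and d: "d \<in> fixed (p ^ i)" "d \<noteq> \<zero>" and f: "f \<in> fixed 1" "f \<noteq> \<zero>"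
    and l: "l \<in> carrier R" "l \<noteq> \<zero>" and eq: "(s ^^ (p ^ (i - 1))) d = d \<otimes> (f \<otimes> l [^] p)"
  obtains v b where "v \<in> carrier R" "v \<noteq> \<zero>" "b \<in> carrier R" "b \<noteq> \<zero>"
    "f = iterated_norm R s (p ^ i) v \<otimes> b [^] p"
proof -
  define q where "q = p ^ (i - 1)"
  have qp: "q * p = p ^ i"
    unfolding q_def using i by (metis One_nat_def Suc_pred less_eq_Suc_le power_Suc2)
  have "field_aut R (s ^^ (p ^ (i - 1))) (p ^ (n - (i - 1)))" using i by (intro field_aut_pow) simp
  then interpret r: field_aut R "s ^^ q" "p ^ (n - (i - 1))" unfolding q_def .
  let ?r = "s ^^ q" and ?N = "iterated_norm R (s ^^ q) p"
  have dc: "d \<in> carrier R" using d unfolding fixed_def by simp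
  have fc: "f \<in> carrier R" using f unfolding fixed_def by simp
  have "f \<in> r.fixed 1" using f fixed_mono[of 1 q] unfolding fixed_pow by auto
  \<comment> \<open>\<open>f\<close> lies in the base field, so its norm over the step of degree
    \<open>p\<close> is its \<open>p\<close>-th power.\<close>
  then have Nf: "?N f = f [^] p" by (rule r.iterated_norm_fixed)
  have Nd: "?N d \<in> carrier R" "?N d \<noteq> \<zero>" using dc d by (simp_all add: r.iterated_norm_nonzero)
  have Nl: "?N l \<in> carrier R" "?N l \<noteq> \<zero>" using l by (simp_all add: r.iterated_norm_nonzero)
  have "(?r ^^ p) d = d" unfolding funpow_mult qp using d unfolding fixed_def by simp
  then have "d \<otimes> ?r (?N d) = d \<otimes> ?N d"
    using r.iterated_norm_telescope[OF dc, of p] dc Nd by (simp add: m_comm)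
  then have "?r (?N d) = ?N d" using d dc Nd by (simp add: m_lcancel)
  \<comment> \<open>Taking norms in \<open>eq\<close> cancels the norm of \<open>d\<close> and
    leaves a \<open>p\<close>-th root of unity, which is \<open>\<one>\<close> by
    \<open>roots\<close>.\<close>
  then have "?N (d \<otimes> (f \<otimes> l [^] p)) = ?N d"
    unfolding eq[folded q_def, symmetric] using dc by (simp add: r.iterated_norm_commute)
  then have "?N d \<otimes> (f \<otimes> ?N l) [^] p = ?N d \<otimes> \<one>"
    using dc fc l Nd Nl by (simp add: r.iterated_norm_mult r.iterated_norm_pow Nf nat_pow_distrib)
  then have "(f \<otimes> ?N l) [^] p = \<one>"
    using m_lcancel[OF Nd(2,1), of "(f \<otimes> ?N l) [^] p" \<one>] Nl fc by simp
  then have fN: "f \<otimes> ?N l = \<one>" using roots[of "f \<otimes> ?N l"] fc Nl by simp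
  define m where "m = inv l"
  note m = inverse_props[OF l, folded m_def]
  have "?N m \<otimes> ?N l = ?N (m \<otimes> l)" using m(1) l(1) by (simp only: r.iterated_norm_mult)
  then have "?N m \<otimes> ?N l = \<one>" unfolding m(4) r.iterated_norm_one .
  then have "?N m \<otimes> ?N l = f \<otimes> ?N l" using fN by simp
  then have Nm: "?N m = f" using m_rcancel[OF Nl(2,1), of "?N m" f] m fc by simp
  \<comment> \<open>The norm of \<open>m\<close> is \<open>f\<close>, which \<open>s\<close> fixes,
    so the quotient \<open>x\<close> of \<open>s m\<close> by \<open>m\<close> has norm
    \<open>\<one>\<close>.\<close>
  define x where "x = s m \<otimes> inv m"
  have sm: "s m \<in> carrier R" "s m \<noteq> \<zero>" using m by (simp_all add: s_nonzero)
  note im = inverse_props[OF m(1,2)]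
  have x: "x \<in> carrier R" "x \<noteq> \<zero>" "x \<otimes> m = s m"
  proof -
    show "x \<in> carrier R" unfolding x_def using sm(1) im(1) by simp
    show "x \<noteq> \<zero>" unfolding x_def using sm im integral by blast
    show "x \<otimes> m = s m" unfolding x_def using sm(1) im(1,4) m(1) by (simp only: m_assoc r_one)
  qed
  have "?N x \<otimes> f = f" 
  proof -
    have "?N x \<otimes> ?N m = ?N (x \<otimes> m)" using x(1) m(1) by (simp only: r.iterated_norm_mult)
    also have "\<dots> = ?N (s m)" by (simp only: x(3))
    also have "\<dots> = s (?N m)" using m by (simp add: iterated_norm_pow_commute)
    also have "\<dots> = f" unfolding Nm using f unfolding fixed_def by simp
    finally show ?thesis unfolding Nm .
  qed
  then have "?N x \<otimes> f = \<one> \<otimes> f" using fc by simp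
  then have "?N x = \<one>" using m_rcancel[OF f(2) fc, of "?N x" \<one>] x by simp
  \<comment> \<open>By transitivity the norm of \<open>x\<close> over the full order of
    \<open>?r\<close> is a norm of \<open>?N x = \<one>\<close>, so Hilbert 90 on the whole field
    applies.\<close>
  moreover have "n - (i - 1) = Suc (n - i)" using i by simp
  then have "p ^ (n - (i - 1)) = p * p ^ (n - i)" by simp
  ultimately have "iterated_norm R ?r (p ^ (n - (i - 1))) x = \<one>"
    using r.iterated_norm_times[OF x(1), of p "p ^ (n - i)"] field_endo.iterated_norm_one[OF r.field_endo_pow]
    by metis
  then obtain v where v: "v \<in> carrier R" "v \<noteq> \<zero>" "?r v = x \<otimes> v" by (rule r.Hilbert90[OF x(1,2)])
  \<comment> \<open>By telescoping, \<open>s\<close> multiplies \<open>w\<close> by the same factor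
    \<open>x\<close> as \<open>m\<close>, so \<open>b\<close>, the quotient of \<open>m\<close> by
    \<open>w\<close>, lies in the base field.\<close>
  define w where "w = iterated_norm R s q v"
  have w: "w \<in> carrier R" "w \<noteq> \<zero>" unfolding w_def using v by (simp_all add: iterated_norm_nonzero)
  have sw: "s w \<in> carrier R" "s w \<noteq> \<zero>" using w by (simp_all add: s_nonzero)
  have tel: "v \<otimes> s w = w \<otimes> ?r v" unfolding w_def by (rule iterated_norm_telescope[OF v(1)])
  have "(m \<otimes> s w) \<otimes> v = m \<otimes> (v \<otimes> s w)" using m sw v by (simp add: m_ac)
  also have "\<dots> = (x \<otimes> m) \<otimes> w \<otimes> v" unfolding tel v(3) using m w v x(1) by (simp add: m_ac)
  also have "\<dots> = (s m \<otimes> w) \<otimes> v" unfolding x(3) ..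
  finally have cross: "m \<otimes> s w = s m \<otimes> w"
    using m_rcancel[OF v(2,1), of "m \<otimes> s w" "s m \<otimes> w"] m sw w sm by simp
  define b where "b = m \<otimes> inv w"
  note iw = inverse_props[OF w]
  have b: "b \<in> carrier R" "b \<noteq> \<zero>" "b \<otimes> w = m"
  proof -
    show "b \<in> carrier R" unfolding b_def using m(1) iw(1) by simp
    show "b \<noteq> \<zero>" unfolding b_def using m iw integral by blast
    show "b \<otimes> w = m" unfolding b_def using m(1) iw(1,4) w(1) by (simp only: m_assoc r_one)
  qed
  have "s b \<otimes> s w = s (b \<otimes> w)" using s_mult[OF b(1) w(1)] by simp
  then have "s b \<otimes> s w \<otimes> w = (b \<otimes> w) \<otimes> s w" using cross b(3) by simp
  also have "\<dots> = b \<otimes> s w \<otimes> w" using b(1) w(1) sw(1) by (simp add: m_ac)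
  finally have "s b \<otimes> s w = b \<otimes> s w"
    using m_rcancel[OF w(2,1), of "s b \<otimes> s w" "b \<otimes> s w"] b(1) sw(1) by simp
  then have "s b = b" using m_rcancel[OF sw(2,1), of "s b" b] b(1) by simp
  then have "b \<in> fixed 1" unfolding fixed_def using b by simp
  then have "b \<in> r.fixed 1" using fixed_mono[of 1 q] unfolding fixed_pow by auto
  then have Nb: "?N b = b [^] p" by (rule r.iterated_norm_fixed)
  have "f = ?N (b \<otimes> w)" using Nm b by simp
  also have "\<dots> = b [^] p \<otimes> ?N w" using b(1) w(1) by (simp add: r.iterated_norm_mult Nb)
  also have "?N w = iterated_norm R s (p ^ i) v" unfolding w_def iterated_norm_times[OF v(1)] qp ..
  finally have "f = iterated_norm R s (p ^ i) v \<otimes> b [^] p" using b(1) v(1) by (simp add: m_comm)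
  then show thesis using that v b by blast
qed

end

section \<open>Power classes\<close>

context field
begin

lemma mult_of_comm_group: "comm_group (mult_of R)"
proof -
  have "mult_of R = units_of R" unfolding mult_of_def units_of_def field_Units ..
  then show ?thesis using units_comm_group by simp
qed

lemma power_subgroup_is_subgroup: "subgroup (power_subgroup p R) (mult_of R)"
proof -
  interpret M: comm_group "mult_of R" by (rule mult_of_comm_group)
  have "(\<lambda>x. x [^] p) \<in> hom (mult_of R) (mult_of R)"
    by (intro homI) (auto simp: nat_pow_distrib nat_pow_nonzero)
  then have "group_hom (mult_of R) (mult_of R) (\<lambda>x. x [^] p)"
    using M.is_group by (simp add: group_hom_def group_hom_axioms_def)
  then show ?thesis unfolding power_subgroup_def by (rule group_hom.img_is_subgroup)
qed

abbreviation power_class :: "nat \<Rightarrow> 'a \<Rightarrow> 'a set" where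
  "power_class p x \<equiv> power_subgroup p R #>\<^bsub>mult_of R\<^esub> x"

lemma power_class_eq: "power_class p x = {d [^] p \<otimes> x | d. d \<in> carrier R - {\<zero>}}"
  unfolding power_subgroup_def r_coset_def by auto

lemma carrier_power_class_group:
  "carrier (power_class_group p R) = power_class p ` (carrier R - {\<zero>})"
  unfolding power_class_group_def carrier_FactGroup by simp

lemma power_class_group_comm: "comm_group (power_class_group p R)"
  unfolding power_class_group_def
  by (rule comm_group.abelian_FactGroup[OF mult_of_comm_group power_subgroup_is_subgroup])

lemma power_class_mult:
  assumes "x \<in> carrier R - {\<zero>}" "y \<in> carrier R - {\<zero>}"
  shows "power_class p x \<otimes>\<^bsub>power_class_group p R\<^esub> power_class p y = power_class p (x \<otimes> y)"
proof -
  have "power_subgroup p R \<lhd> mult_of R"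
    using comm_group.subgroup_imp_normal[OF mult_of_comm_group power_subgroup_is_subgroup] .
  from normal.rcos_sum[OF this] show ?thesis
    using assms unfolding power_class_group_def by simp
qed

lemma power_class_one: "\<one>\<^bsub>power_class_group p R\<^esub> = power_class p \<one>"
proof -
  interpret M: comm_group "mult_of R" by (rule mult_of_comm_group)
  have "power_subgroup p R #>\<^bsub>mult_of R\<^esub> \<one>\<^bsub>mult_of R\<^esub> = power_subgroup p R"
    using M.coset_mult_one[of "power_subgroup p R"] subgroup.subset[OF power_subgroup_is_subgroup[of p]]
    by blast
  then show ?thesis unfolding power_class_group_def by simp
qed

lemma power_class_eq_iff:
  assumes "x \<in> carrier R - {\<zero>}" "y \<in> carrier R - {\<zero>}"
  shows "power_class p x = power_class p y \<longleftrightarrow> (\<exists>d\<in>carrier R - {\<zero>}. x = y \<otimes> d [^] p)"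
proof -
  interpret M: comm_group "mult_of R" by (rule mult_of_comm_group)
  have "power_class p x = power_class p y \<longleftrightarrow> x \<in> power_class p y"
    using M.repr_independence[of x "power_subgroup p R" y] M.rcos_self[of x "power_subgroup p R"]
      power_subgroup_is_subgroup assms by auto
  also have "\<dots> \<longleftrightarrow> (\<exists>d\<in>carrier R - {\<zero>}. x = y \<otimes> d [^] p)"
    unfolding power_class_eq using assms by (auto simp: m_comm)
  finally show ?thesis .
qed

lemma power_class_nat_pow:
  assumes "x \<in> carrier R - {\<zero>}"
  shows "power_class p x [^]\<^bsub>power_class_group p R\<^esub> (k::nat) = power_class p (x [^] k)"
proof (induction k)
  case 0 then show ?case by (simp add: power_class_one)
next
  case (Suc k)
  have "x [^] k \<in> carrier R - {\<zero>}" for k :: nat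
    using assms by (induction k) (auto simp: integral_iff)
  then show ?case using Suc assms by (simp add: power_class_mult)
qed

lemma power_class_group_exponent:
  assumes "c \<in> carrier (power_class_group p R)"
  shows "c [^]\<^bsub>power_class_group p R\<^esub> p = \<one>\<^bsub>power_class_group p R\<^esub>"
proof -
  obtain x where x: "x \<in> carrier R - {\<zero>}" "c = power_class p x"
    using assms carrier_power_class_group by auto
  have xp: "x [^] k \<in> carrier R - {\<zero>}" for k :: nat
    using x by (induction k) (auto simp: integral_iff)
  have "power_class p (x [^] p) = power_class p \<one>" using power_class_eq_iff[OF xp, of \<one> p] x by auto
  then show ?thesis using x by (simp add: power_class_nat_pow power_class_one)
qed

text \<open>\<open>g\<close> permutes the nonzero elements, hence their \<open>p\<close>-th powers,
  so the image of a coset is again a full coset.\<close>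

lemma image_power_class:
  assumes g: "g \<in> ring_iso R R" and x: "x \<in> carrier R - {\<zero>}"
  shows "g ` power_class p x = power_class p (g x)"
proof -
  interpret g: field_endo R g
    using g field_axioms
      by (intro field_endo.intro field_endo_axioms.intro) (auto simp: ring_iso_def)
  have bij: "bij_betw g (carrier R) (carrier R)" using g by (simp add: ring_iso_def)
  have im: "g ` (carrier R - {\<zero>}) = carrier R - {\<zero>}"
  proof -
    have "g ` (carrier R - {\<zero>}) = g ` carrier R - g ` {\<zero>}"
      using bij by (intro inj_on_image_set_diff[of _ "carrier R"]) (auto simp: bij_betw_def)
    then show ?thesis using bij by (simp add: bij_betw_def)
  qed
  have "g ` power_class p x = (\<lambda>d. g (d [^] p \<otimes> x)) ` (carrier R - {\<zero>})"
    unfolding power_class_eq by auto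
  also have "\<dots> = (\<lambda>d. g d [^] p \<otimes> g x) ` (carrier R - {\<zero>})"
    using x by (intro image_cong) (auto simp: g.s_mult g.s_nat_pow)
  also have "\<dots> = (\<lambda>d. d [^] p \<otimes> g x) ` (g ` (carrier R - {\<zero>}))" by auto
  also have "\<dots> = power_class p (g x)" unfolding im power_class_eq by auto
  finally show ?thesis .
qed

lemma nonzero_ring_iso: "g \<in> ring_iso R R \<Longrightarrow> x \<in> carrier R - {\<zero>} \<Longrightarrow> g x \<in> carrier R - {\<zero>}"
proof -
  assume g: "g \<in> ring_iso R R" and x: "x \<in> carrier R - {\<zero>}"
  interpret g: field_endo R g
    using g field_axioms
      by (intro field_endo.intro field_endo_axioms.intro) (auto simp: ring_iso_def)
  show ?thesis using x g.s_nonzero by auto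
qed

end

section \<open>The action of \<open>s\<close> on power classes under the hypotheses on roots of
  unity and norms\<close>

locale cyclic_extension_norm = cyclic_extension +
  assumes n_pos: "n \<ge> 1"
    and no_roots: "(\<forall>z\<in>fixed 1. z [^] p = \<one> \<longrightarrow> z = \<one>) \<or>
      (p = 2 \<and> n = 1 \<and> (\<forall>x\<in>carrier R - {\<zero>}. iterated_norm R s 2 x \<noteq> \<ominus> \<one>))"
begin

lemma s_iso: "s \<in> ring_iso R R"
proof -
  obtain m where m: "p ^ n = Suc m" using p_pos[of n] by (cases "p ^ n") auto
  have "s ((s ^^ m) x) = x" if "x \<in> carrier R" for x using pow_N[OF that] unfolding m by simp
  then have "s ` carrier R = carrier R" by (auto simp: image_iff) (metis pow_closed)
  moreover have "inj_on s (carrier R)" by (rule inj_onI) (rule s_inj)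
  ultimately show ?thesis using hom by (simp add: ring_iso_def bij_betw_def)
qed

abbreviation J where "J \<equiv> power_class_group p R"
abbreviation nonzero where "nonzero \<equiv> carrier R - {\<zero>}"

lemma J_cases:
  assumes "c \<in> carrier J"
  obtains x where "x \<in> nonzero" "c = power_class p x"
  using assms carrier_power_class_group by auto

sublocale J: elementary_abelian_auto J p "image s"
proof -
  interpret J: comm_group J by (rule power_class_group_comm)
  show "elementary_abelian_auto J p (image s)"
  proof (unfold_locales)
    show "Factorial_Ring.prime p" by (rule prime_p)
    show "c [^]\<^bsub>J\<^esub> p = \<one>\<^bsub>J\<^esub>"
      if "c \<in> carrier J" for c using that by (rule power_class_group_exponent)
    show "image s \<in> hom J J"
    proof (rule homI)
      fix c assume "c \<in> carrier J"
      then obtain x where x: "x \<in> nonzero" "c = power_class p x" by (rule J_cases)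
      show "s ` c \<in> carrier J"
        unfolding x(2) image_power_class[OF s_iso x(1)] carrier_power_class_group
        using nonzero_ring_iso[OF s_iso x(1)] by blast
      fix c' assume "c' \<in> carrier J"
      then obtain y where y: "y \<in> nonzero" "c' = power_class p y" by (rule J_cases)
      have xy: "x \<otimes> y \<in> nonzero" using x y by (auto simp: integral_iff)
      show "s ` (c \<otimes>\<^bsub>J\<^esub> c') = s ` c \<otimes>\<^bsub>J\<^esub> s ` c'"
        using x y xy nonzero_ring_iso[OF s_iso]
        by (simp add: power_class_mult image_power_class[OF s_iso] s_mult)
    qed
  qed
qed

lemma pow_nonzero: "x \<in> nonzero \<Longrightarrow> (s ^^ k) x \<in> nonzero"
  by (induction k) (auto simp: s_nonzero)

lemma Spow_class: "x \<in> nonzero \<Longrightarrow> (image s ^^ k) (power_class p x) = power_class p ((s ^^ k) x)"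
  using pow_nonzero by (induction k) (auto simp: image_power_class[OF s_iso])

lemma norm_class:
  "x \<in> nonzero \<Longrightarrow> iterated_norm J (image s) k (power_class p x) = power_class p (iterated_norm R s k x)"
proof (induction k)
  case 0 then show ?case by (simp add: power_class_one)
next
  case (Suc k)
  have N: "iterated_norm R s k x \<in> nonzero" using Suc.prems by (auto simp: iterated_norm_nonzero)
  then have "s (iterated_norm R s k x) \<in> nonzero" by (rule nonzero_ring_iso[OF s_iso])
  then show ?case using Suc N by (simp add: image_power_class[OF s_iso] power_class_mult)
qed

text \<open>The \<open>p\<close>-th roots of unity form an elementary abelian group on which \<open>s - 1\<close> is nilpotent,
  so if they are nontrivial, some nontrivial one is fixed by \<open>s\<close>.\<close>

lemma no_roots_of_unity:
  assumes F: "\<forall>z\<in>fixed 1. z [^] p = \<one> \<longrightarrow> z = \<one>" and z: "z \<in> carrier R" "z [^] p = \<one>"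
  shows "z = \<one>"
proof (rule ccontr)
  assume z1: "z \<noteq> \<one>"
  interpret M: comm_group "mult_of R" by (rule mult_of_comm_group)
  define U where "U = {x \<in> nonzero. x [^] p = \<one>}"
  have U: "subgroup U (mult_of R)"
  proof (rule M.subgroupI)
    show "U \<subseteq> carrier (mult_of R)" unfolding U_def by auto
    have "\<one> \<in> U" unfolding U_def by auto
    then show "U \<noteq> {}" by blast
    show "inv\<^bsub>mult_of R\<^esub> x \<in> U" if "x \<in> U" for x
    proof -
      have x: "x \<in> carrier (mult_of R)" "x [^]\<^bsub>mult_of R\<^esub> p = \<one>"
        using that unfolding U_def nat_pow_mult_of by auto
      then have "(inv\<^bsub>mult_of R\<^esub> x) [^]\<^bsub>mult_of R\<^esub> p = \<one>"
        using M.nat_pow_inv[of x p] monoid.inv_one[OF group.is_monoid[OF M.is_group]]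
          by (simp del: carrier_mult_of)
      then show ?thesis unfolding U_def using M.inv_closed[OF x(1)] by (simp add: nat_pow_mult_of)
    qed
    show "x \<otimes>\<^bsub>mult_of R\<^esub> y \<in> U" if "x \<in> U" "y \<in> U" for x y
      using that unfolding U_def by (auto simp: integral_iff nat_pow_distrib)
  qed
  define M where "M = mult_of R \<lparr>carrier := U\<rparr>"
  have "group M" unfolding M_def using subgroup.subgroup_is_group[OF U M.is_group] .
  then have Mg: "comm_group M"
    by (rule group.group_comm_groupI) (auto simp: M_def U_def m_comm)
  have Mpow: "x [^]\<^bsub>M\<^esub> (k::nat) = x [^] k" for x k
    unfolding M_def by (simp add: nat_pow_def mult_of_def)
  interpret V: elementary_abelian_auto M p s
  proof (intro elementary_abelian_auto.intro elementary_abelian.intro elementary_abelian_axioms.intro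
      elementary_abelian_auto_axioms.intro Mg prime_p)
    show "x [^]\<^bsub>M\<^esub> p = \<one>\<^bsub>M\<^esub>" if "x \<in> carrier M" for x
      using that unfolding Mpow by (simp add: M_def U_def)
    show "s \<in> hom M M"
    proof (rule homI)
      show "s x \<in> carrier M" if x: "x \<in> carrier M" for x
      proof -
        have "x \<in> nonzero" "x [^] p = \<one>" using x by (auto simp: M_def U_def)
        moreover from this have "s x [^] p = \<one>" using s_nat_pow[of x p] by simp
        ultimately show ?thesis using s_nonzero by (simp add: M_def U_def)
      qed
      show "s (x \<otimes>\<^bsub>M\<^esub> y) = s x \<otimes>\<^bsub>M\<^esub> s y" if "x \<in> carrier M" "y \<in> carrier M" for x y
        using that by (simp add: M_def U_def s_mult)
    qed
  qed
  have "z \<noteq> \<zero>"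
  proof
    assume "z = \<zero>"
    then have "\<zero> [^] p = \<one>" using z by simp
    moreover have "\<zero> [^] p = \<zero>" using p_pos[of 1] by (intro nat_pow_zero) auto
    ultimately show False by simp
  qed
  then have "z \<in> carrier M" "z \<noteq> \<one>\<^bsub>M\<^esub>" using z z1 by (simp_all add: M_def U_def)
  then obtain y where "y \<in> carrier M" "y \<noteq> \<one>\<^bsub>M\<^esub>" "s y = y"
    using V.S_fixed_element[of z n] pow_N[OF z(1)] by blast
  then show False using F by (auto simp: M_def U_def fixed_def)
qed

text \<open>In case (i) the field has no nontrivial \<open>p\<close>-th root of unity. In case (ii),
  \<open>i = 0\<close> and the norm is that of the quadratic extension; its square is
  \<open>\<one>\<close>, so it is \<open>\<one>\<close> or \<open>\<ominus> \<one>\<close>, and the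
  latter is not a norm.\<close>

lemma norm_eq_one:
  assumes i: "i < n" and l: "l \<in> nonzero"
    and eq: "iterated_norm R (s ^^ (p ^ i)) (p ^ (n - i)) l [^] p = \<one>"
  shows "iterated_norm R (s ^^ (p ^ i)) (p ^ (n - i)) l = \<one>"
  using no_roots
proof (elim disjE)
  interpret q: field_endo R "s ^^ (p ^ i)" by (rule field_endo_pow)
  assume "\<forall>z\<in>fixed 1. z [^] p = \<one> \<longrightarrow> z = \<one>"
  then show ?thesis using no_roots_of_unity eq l by simp
next
  assume h: "p = 2 \<and> n = 1 \<and> (\<forall>x\<in>nonzero. iterated_norm R s 2 x \<noteq> \<ominus> \<one>)"
  let ?z = "iterated_norm R s 2 l"
  have i0: "i = 0" using h i by simp
  have z: "?z \<in> carrier R" "?z \<noteq> \<ominus> \<one>" "?z [^] (2::nat) = \<one>" using h l eq i0 by auto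
  have "(?z \<ominus> \<one>) \<otimes> (?z \<oplus> \<one>) = ?z \<otimes> ?z \<ominus> \<one>" using z(1) by algebra
  also have "\<dots> = \<zero>" using z by (simp add: numeral_2_eq_2)
  finally have "?z \<ominus> \<one> = \<zero> \<or> ?z \<oplus> \<one> = \<zero>" using z(1) by (simp add: integral_iff)
  moreover have "?z \<oplus> \<one> \<noteq> \<zero>" using z(1,2) minus_equality[of ?z \<one>] by auto
  ultimately have "?z = \<one>" using z(1) by simp
  then show ?thesis using h i0 by simp
qed

text \<open>This is the harder inclusion between fixed classes and classes of the intermediate
  field. Equality of classes lifts to \<open>(s ^^ (p ^ i)) x = x \<otimes> l [^] p\<close>, where
  \<open>fixed_representative\<close> applies; for \<open>i = n\<close> the fixed field is
  everything.\<close>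

lemma fixed_class_representative:
  assumes i: "i \<le> n" and c: "c \<in> carrier J" "(image s ^^ (p ^ i)) c = c"
  obtains y where "y \<in> fixed (p ^ i) - {\<zero>}" "c = power_class p y"
proof -
  obtain x where x: "x \<in> nonzero" "c = power_class p x" using c(1) by (rule J_cases)
  show thesis
  proof (cases "i = n")
    case True
    then show ?thesis using that x fixed_pn by auto
  next
    case False
    then have i: "i < n" using i by simp
    have "power_class p ((s ^^ (p ^ i)) x) = power_class p x" using c(2) x by (simp add: Spow_class)
    then obtain l where l: "l \<in> nonzero" "(s ^^ (p ^ i)) x = x \<otimes> l [^] p"
      using power_class_eq_iff[OF pow_nonzero[OF x(1)] x(1)] by blast
    obtain y d where y: "y \<in> fixed (p ^ i)" "y \<noteq> \<zero>" "d \<in> carrier R" "d \<noteq> \<zero>" "x = y \<otimes> d [^] p"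
      using fixed_representative[OF i _ _ _ _ l(2)] norm_eq_one[OF i l(1)] x l(1) by blast
    then have "y \<in> nonzero" by (simp add: fixed_def)
    then have "power_class p x = power_class p y" using power_class_eq_iff[OF x(1)] y by blast
    then show ?thesis using that y x by blast
  qed
qed

text \<open>The hypothesis \<open>socle\<close> of \<open>cyclic_decomposition\<close>. In case (ii)
  both exponents are \<open>1\<close> and \<open>e = d\<close> works. In case (i),
  \<open>norm_representative\<close> shows that a representative in the base field is a norm up to a
  \<open>p\<close>-th power.\<close>

lemma socle_element:
  assumes i: "1 \<le> i" "i \<le> n" and d: "d \<in> carrier J" "J.shift ((J.shift ^^ (p ^ (i - 1))) d) = \<one>\<^bsub>J\<^esub>"
  shows "\<exists>e\<in>carrier J. (J.shift ^^ (p ^ i - 1)) e = (J.shift ^^ (p ^ (i - 1))) d"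
  using no_roots
proof (elim disjE)
  assume "p = 2 \<and> n = 1 \<and> (\<forall>x\<in>nonzero. iterated_norm R s 2 x \<noteq> \<ominus> \<one>)"
  then have "p ^ i - 1 = p ^ (i - 1)" using i by auto
  then show ?thesis using d(1) by auto
next
  assume F: "\<forall>z\<in>fixed 1. z [^] p = \<one> \<longrightarrow> z = \<one>"
  have p2: "2 \<le> p" using prime_p by (rule prime_ge_2_nat)
  define q where "q = p ^ (i - 1)"
  have qp: "p ^ i = p * q" unfolding q_def using i by (cases i) auto
  have q1: "1 \<le> q" unfolding q_def using p_pos[of "i - 1"] by linarith
  let ?c = "(J.shift ^^ q) d"
  have c: "?c \<in> carrier J" "J.shift ?c = \<one>\<^bsub>J\<^esub>" using d unfolding q_def by simp_all
  \<comment> \<open>\<open>J.shift ^^ Suc q\<close> kills \<open>d\<close>, hence so does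
    \<open>J.shift ^^ (p ^ i)\<close>, and \<open>d\<close> is fixed by the \<open>p ^ i\<close>-th
    power of \<open>s\<close>.\<close>
  have "Suc q \<le> p ^ i" 
  proof -
    have "Suc q \<le> 2 * q" using q1 by simp
    also have "\<dots> \<le> p ^ i" unfolding qp using p2 by simp
    finally show ?thesis .
  qed
  then have "p ^ i = (p ^ i - Suc q) + Suc q" by simp
  then have "(J.shift ^^ (p ^ i)) d = (J.shift ^^ (p ^ i - Suc q)) ((J.shift ^^ Suc q) d)"
    by (metis funpow_add o_apply)
  also have "\<dots> = \<one>\<^bsub>J\<^esub>" using c(2) by simp
  finally have "(image s ^^ (p ^ i)) d \<otimes>\<^bsub>J\<^esub> inv\<^bsub>J\<^esub> d = \<one>\<^bsub>J\<^esub>"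
    using J.shift_pow_prime_power[OF d(1)] by simp
  then have "(image s ^^ (p ^ i)) d = d" using d(1) J.Spow_closed[OF d(1)]
    by (metis J.inv_closed J.inv_equality J.inv_inv)
  then obtain x where x: "x \<in> fixed (p ^ i) - {\<zero>}" "d = power_class p x"
    using fixed_class_representative[OF i(2) d(1)] by blast
  \<comment> \<open>\<open>?c\<close> is fixed by \<open>s\<close> itself, so the case
    \<open>i = 0\<close> of \<open>fixed_class_representative\<close> puts a representative in the
    base field.\<close>
  have "(image s ^^ (p ^ 0)) ?c = ?c" using J.shift_eq_iff[OF c(1)] c(2) by simp
  then obtain f where f: "f \<in> fixed (p ^ 0) - {\<zero>}" "?c = power_class p f"
    using fixed_class_representative[of 0 ?c] c(1) by blast
  have f1: "f \<in> fixed 1" "f \<noteq> \<zero>" "f \<in> nonzero" using f by (auto simp: fixed_def)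
  have x1: "x \<in> nonzero" using x by (simp add: fixed_def)
  have "?c = (image s ^^ q) d \<otimes>\<^bsub>J\<^esub> inv\<^bsub>J\<^esub> d"
    unfolding q_def by (rule J.shift_pow_prime_power[OF d(1)])
  then have "(image s ^^ q) d = d \<otimes>\<^bsub>J\<^esub> ?c" 
    using d(1) J.Spow_closed[OF d(1)] J.m_lcomm[of d "(image s ^^ q) d" "inv\<^bsub>J\<^esub> d"] by simp
  then have "power_class p ((s ^^ q) x) = power_class p (x \<otimes> f)"
    unfolding f(2) unfolding x(2) using x1 f1 by (simp add: Spow_class power_class_mult)
  moreover have xf: "x \<otimes> f \<in> nonzero" using x1 f1 by (auto simp: integral_iff)
  ultimately obtain l where l: "l \<in> nonzero" "(s ^^ q) x = (x \<otimes> f) \<otimes> l [^] p"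
    using power_class_eq_iff[OF pow_nonzero[OF x1] xf] by blast
  have eq: "(s ^^ (p ^ (i - 1))) x = x \<otimes> (f \<otimes> l [^] p)"
    using l x1 f1 by (simp add: q_def m_assoc)
  obtain v b where v: "v \<in> carrier R" "v \<noteq> \<zero>" "b \<in> carrier R" "b \<noteq> \<zero>"
    "f = iterated_norm R s (p ^ i) v \<otimes> b [^] p"
    using norm_representative[OF no_roots_of_unity[OF F] i _ _ f1(1,2) _ _ eq] x l by blast
  have N: "iterated_norm R s (p ^ i) v \<in> nonzero" using v by (simp add: iterated_norm_nonzero)
  \<comment> \<open>The factor \<open>b [^] p\<close> disappears in the class, and on classes the
    norm is the \<open>(p ^ i - 1)\<close>-th power of \<open>J.shift\<close>.\<close>
  have "?c = power_class p (iterated_norm R s (p ^ i) v)"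
    unfolding f(2) using power_class_eq_iff[OF f1(3) N] v by blast
  also have "\<dots> = iterated_norm J (image s) (p ^ i) (power_class p v)"
    using v by (simp add: norm_class)
  also have "\<dots> = (J.shift ^^ (p ^ i - 1)) (power_class p v)"
    using v by (intro J.shift_pow_norm[symmetric]) (auto simp: carrier_power_class_group)
  finally show ?thesis using v unfolding q_def carrier_power_class_group by auto
qed

lemma shift_nilpotent:
  assumes "c \<in> carrier J"
  shows "(J.shift ^^ (p ^ n)) c = \<one>\<^bsub>J\<^esub>"
proof -
  obtain x where x: "x \<in> nonzero" "c = power_class p x" using assms by (rule J_cases)
  have "(image s ^^ (p ^ n)) c = c" using x pow_N[of x] by (simp add: Spow_class)
  then show ?thesis using J.shift_pow_prime_power[OF assms, of n] assms by simp
qed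

end

section \<open>Galois groups\<close>

context field
begin

lemma mem_galois_group:
  "g \<in> carrier (galois_group R F) \<longleftrightarrow> g \<in> ring_iso R R \<and> g \<in> extensional (carrier R) \<and> (\<forall>x\<in>F. g x = x)"
  unfolding galois_group_def by auto

lemma ring_iso_Bij: "g \<in> ring_iso R R \<Longrightarrow> g \<in> extensional (carrier R) \<Longrightarrow> g \<in> Bij (carrier R)"
  unfolding Bij_def ring_iso_def by auto

lemma galois_group_one: "\<one>\<^bsub>galois_group R F\<^esub> = (\<lambda>x\<in>carrier R. x)"
  unfolding galois_group_def BijGroup_def by simp

lemma galois_group_mult:
  assumes "g \<in> carrier (galois_group R F)" "h \<in> carrier (galois_group R F)"
  shows "g \<otimes>\<^bsub>galois_group R F\<^esub> h = compose (carrier R) g h"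
  using assms ring_iso_Bij[of g] ring_iso_Bij[of h] unfolding mem_galois_group
  unfolding galois_group_def BijGroup_def by simp

lemma galois_group_is_group:
  assumes F: "F \<subseteq> carrier R"
  shows "group (galois_group R F)"
proof -
  have "subgroup {g \<in> ring_iso R R \<inter> extensional (carrier R). \<forall>x\<in>F. g x = x} (BijGroup (carrier R))"
  proof (rule group.subgroupI[OF group_BijGroup])
    show "{g \<in> ring_iso R R \<inter> extensional (carrier R). \<forall>x\<in>F. g x = x} \<subseteq> carrier (BijGroup (carrier R))"
      using ring_iso_Bij by (auto simp: BijGroup_def)
    have "restrict (\<lambda>x. x) (carrier R) \<in> ring_iso R R"
      by (rule ring_iso_memI) (auto simp: bij_betw_def inj_on_def)
    then have "restrict (\<lambda>x. x) (carrier R) \<in> {g \<in> ring_iso R R \<inter> extensional (carrier R). \<forall>x\<in>F. g x = x}"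
      using F by auto
    then show "{g \<in> ring_iso R R \<inter> extensional (carrier R). \<forall>x\<in>F. g x = x} \<noteq> {}" by blast
  next
    fix g assume g: "g \<in> {g \<in> ring_iso R R \<inter> extensional (carrier R). \<forall>x\<in>F. g x = x}"
    then have B: "g \<in> Bij (carrier R)" using ring_iso_Bij by blast
    have inj: "inj_on g (carrier R)" using g by (auto simp: ring_iso_def bij_betw_def)
    have "inv_into (carrier R) g \<in> ring_iso R R"
      using g ring_axioms by (intro ring_iso_set_sym) auto
    then have "restrict (inv_into (carrier R) g) (carrier R) \<in> ring_iso R R"
      by (rule ring_iso_restrict) simp
    moreover have "inv_into (carrier R) g x = x" if "x \<in> F" for x
      using inv_into_f_f[OF inj, of x] g that F by auto
    ultimately show "inv\<^bsub>BijGroup (carrier R)\<^esub> g \<in> {g \<in> ring_iso R R \<inter> extensional (carrier R). \<forall>x\<in>F. g x = x}"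
      using F by (auto simp: inv_BijGroup[OF B])
  next
    fix g h assume g: "g \<in> {g \<in> ring_iso R R \<inter> extensional (carrier R). \<forall>x\<in>F. g x = x}"
      and h: "h \<in> {g \<in> ring_iso R R \<inter> extensional (carrier R). \<forall>x\<in>F. g x = x}"
    then have "g \<in> Bij (carrier R)" "h \<in> Bij (carrier R)" using ring_iso_Bij by blast+
    then have m: "g \<otimes>\<^bsub>BijGroup (carrier R)\<^esub> h = compose (carrier R) g h" by (simp add: BijGroup_def)
    have "g \<circ> h \<in> ring_iso R R" using g h by (intro ring_iso_set_trans) auto
    then have "compose (carrier R) g h \<in> ring_iso R R"
      by (rule ring_iso_restrict) (simp add: compose_def)
    then show "g \<otimes>\<^bsub>BijGroup (carrier R)\<^esub> h \<in> {g \<in> ring_iso R R \<inter> extensional (carrier R). \<forall>x\<in>F. g x = x}"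
      unfolding m using g h F by (auto simp: compose_def)
  qed
  from subgroup.subgroup_is_group[OF this group_BijGroup] show ?thesis unfolding galois_group_def .
qed

end

lemma (in field_endo) pow_ring_iso:
  assumes "s \<in> ring_iso R R"
  shows "s ^^ k \<in> ring_iso R R"
proof (induction k)
  case 0 then show ?case by (auto intro!: ring_iso_memI simp: bij_betw_def inj_on_def)
next
  case (Suc k) then show ?case unfolding funpow.simps using assms by (rule ring_iso_set_trans)
qed

section \<open>The Galois group and the intermediate fields in terms of powers of
  \<open>s\<close>\<close>

context cyclic_extension
begin

text \<open>Elements of \<open>galois_group\<close> are extensional, so a power of \<open>s\<close>
  is restricted to the carrier to become one of them.\<close>

definition gal :: "nat \<Rightarrow> 'a \<Rightarrow> 'a" where
  "gal k = restrict (s ^^ k) (carrier R)"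

lemma gal_mem:
  assumes "s \<in> ring_iso R R" "F \<subseteq> fixed k"
  shows "gal k \<in> carrier (galois_group R F)"
proof -
  have "gal k \<in> ring_iso R R"
    unfolding gal_def by (rule ring_iso_restrict[OF pow_ring_iso[OF assms(1)]]) simp
  then show ?thesis unfolding mem_galois_group using assms(2) by (auto simp: gal_def fixed_def)
qed

lemma gal_mod: "gal k = gal (k mod p ^ n)"
  unfolding gal_def using pow_fixed_mod[of _ "p ^ n" k] fixed_pn by (intro restrict_ext) simp

lemma inj_gal: "inj_on gal {..<p ^ n}"
proof -
  have "gal i \<noteq> gal j" if ij: "i < j" "j < p ^ n" for i j
  proof -
    obtain x where "x \<in> carrier R" "(s ^^ i) x \<noteq> (s ^^ j) x"
      using powers_distinct[OF subset_refl order ij] by blast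
    then have "gal i x \<noteq> gal j x" by (simp add: gal_def)
    then show ?thesis by auto
  qed
  then show ?thesis by (intro inj_onI) (metis lessThan_iff nat_neq_iff)
qed

text \<open>The powers of the generator are closed under products and inverses, and
  \<open>gal\<close> depends only on the exponent modulo \<open>p ^ n\<close>.\<close>

lemma carrier_galois_group:
  assumes s: "s \<in> ring_iso R R"
    and gen: "generate (galois_group R (fixed 1)) {gal 1} = carrier (galois_group R (fixed 1))"
  shows "carrier (galois_group R (fixed 1)) = gal ` {..<p ^ n}"
proof -
  let ?G = "galois_group R (fixed 1)"
  interpret G: group ?G using subfieldE(3)[OF subfield_fixed] by (rule galois_group_is_group)
  have mem: "gal k \<in> carrier ?G" for k using gal_mem[OF s fixed_mono[of 1 k]] by simp
  have mult: "gal j \<otimes>\<^bsub>?G\<^esub> gal k = gal (j + k)" for j k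
    unfolding galois_group_mult[OF mem mem] by (auto simp: compose_def gal_def funpow_add)
  have one: "\<one>\<^bsub>?G\<^esub> = gal 0" unfolding galois_group_one gal_def by (simp add: id_def)
  have "g \<in> range gal" if "g \<in> generate ?G {gal 1}" for g
    using that
  proof (induction rule: generate.induct)
    case one then show ?case using \<open>\<one>\<^bsub>?G\<^esub> = gal 0\<close> by blast
  next
    case (incl h) then show ?case by blast
  next
    case (inv h)
    have "gal (p ^ n - 1) \<otimes>\<^bsub>?G\<^esub> gal 1 = \<one>\<^bsub>?G\<^esub>"
      unfolding mult one using gal_mod[of "p ^ n"] p_pos[of n] by (simp add: Suc_leI)
    then have "inv\<^bsub>?G\<^esub> (gal 1) = gal (p ^ n - 1)" using mem by (intro G.inv_equality) auto
    then show ?case using inv by auto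
  next
    case (eng h1 h2) then show ?case using mult by auto
  qed
  moreover have "gal k \<in> gal ` {..<p ^ n}" for k
    using p_pos[of n] by (subst gal_mod) simp
  ultimately have "carrier ?G \<subseteq> gal ` {..<p ^ n}" unfolding gen[symmetric] by blast
  then show ?thesis using mem by blast
qed

lemma intermediate_field_eq:
  assumes "i \<le> n"
  shows "intermediate_field R (fixed 1) (p ^ i) = fixed (p ^ i)"
  unfolding intermediate_field_def
proof (rule the_equality)
  show "subfield (fixed (p ^ i)) R \<and> fixed 1 \<subseteq> fixed (p ^ i) \<and> dimension (p ^ i) (fixed 1) (fixed (p ^ i))"
    using subfield_fixed fixed_mono[of 1 "p ^ i"] dimension_fixed[OF assms] by simp
  show "L = fixed (p ^ i)" if "subfield L R \<and> fixed 1 \<subseteq> L \<and> dimension (p ^ i) (fixed 1) L" for L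
    using that intermediate_unique[OF assms] by blast
qed

end

section \<open>The module of power classes\<close>

locale cyclic_galois = cyclic_extension_norm +
  fixes F :: "'a set"
  assumes F_eq: "F = fixed 1"
    and galois: "carrier (galois_group R F) = gal ` {..<p ^ n}"
begin

abbreviation "G \<equiv> galois_group R F"
abbreviation "k\<^sub>p \<equiv> residue_ring (int p)"
abbreviation "kG \<equiv> group_ring k\<^sub>p G"
abbreviation "JM \<equiv> power_class_module p R F"

lemma finite_G: "finite (carrier G)"
  unfolding galois by simp

lemma image_pow: "(image s ^^ k) c = (s ^^ k) ` c"
  by (induction k) auto

lemma gal_image:
  assumes "c \<in> carrier J"
  shows "gal k ` c = (image s ^^ k) c"
proof -
  obtain x where x: "x \<in> nonzero" "c = power_class p x" using assms by (rule J_cases)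
  then have "c \<subseteq> carrier R" unfolding power_class_eq by auto
  then show ?thesis unfolding image_pow gal_def by (intro image_cong) auto
qed

lemma G_image:
  assumes "g \<in> carrier G" "c \<in> carrier J"
  obtains k where "g ` c = (image s ^^ k) c"
  using assms gal_image unfolding galois by blast

lemma G_image_closed: "g \<in> carrier G \<Longrightarrow> c \<in> carrier J \<Longrightarrow> g ` c \<in> carrier J"
  by (rule G_image) (auto simp: J.Spow_closed)

text \<open>Scalar multiplication with arbitrary integer coefficients, which can be added and
  negated pointwise; \<open>comb_cong_mod\<close> passes to residues.\<close>

definition comb :: "(('a \<Rightarrow> 'a) \<Rightarrow> int) \<Rightarrow> 'a set \<Rightarrow> 'a set" where
  "comb a c = finprod J (\<lambda>g. (g ` c) [^]\<^bsub>J\<^esub> a g) (carrier G)"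

lemma smult_eq: "a \<odot>\<^bsub>JM\<^esub> c = comb a c"
  unfolding power_class_module_def comb_def by simp

lemma shift_stable_S:
  assumes "subgroup N J" "\<And>y. y \<in> N \<Longrightarrow> J.shift y \<in> N" "c \<in> N"
  shows "(image s ^^ k) c \<in> N"
proof (induction k)
  case 0 then show ?case using assms by simp
next
  case (Suc k)
  have "(image s ^^ k) c \<in> carrier J" using subgroup.mem_carrier[OF assms(1) Suc] .
  then have "(image s ^^ Suc k) c = (image s ^^ k) c \<otimes>\<^bsub>J\<^esub> J.shift ((image s ^^ k) c)"
    using J.S_eq by simp
  then show ?case using subgroup.m_closed[OF assms(1) Suc assms(2)[OF Suc]] by simp
qed

text \<open>Every element of the Galois group acts as a power of \<open>image s\<close>, that is of
  1 + \<open>J.shift\<close>, and such a power preserves each \<open>J.shift\<close>-stable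
  subgroup.\<close>

lemma comb_stable:
  assumes "subgroup N J" "\<And>y. y \<in> N \<Longrightarrow> J.shift y \<in> N" "c \<in> N"
  shows "comb a c \<in> N"
  unfolding comb_def
proof (rule J.finprod_in_subgroup[OF assms(1)], rule J.subgroup_int_pow_closed[OF assms(1)])
  fix g assume "g \<in> carrier G"
  then obtain k where "g ` c = (image s ^^ k) c"
    using subgroup.mem_carrier[OF assms(1,3)] by (rule G_image)
  then show "g ` c \<in> N" using shift_stable_S[OF assms] by simp
qed

lemma comb_closed: "c \<in> carrier J \<Longrightarrow> comb a c \<in> carrier J"
  unfolding comb_def using G_image_closed by (intro J.finprod_closed) auto

lemma comb_add:
  "c \<in> carrier J \<Longrightarrow> comb (\<lambda>g. a g + b g) c = comb a c \<otimes>\<^bsub>J\<^esub> comb b c"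
proof -
  assume c: "c \<in> carrier J"
  note gc = G_image_closed[OF _ c]
  have "comb (\<lambda>g. a g + b g) c = finprod J (\<lambda>g. (g ` c) [^]\<^bsub>J\<^esub> a g \<otimes>\<^bsub>J\<^esub> (g ` c) [^]\<^bsub>J\<^esub> b g) (carrier G)"
    unfolding comb_def using gc by (intro J.finprod_cong') (auto simp: J.int_pow_mult)
  also have "\<dots> = comb a c \<otimes>\<^bsub>J\<^esub> comb b c"
    unfolding comb_def using gc by (intro J.finprod_multf) auto
  finally show ?thesis .
qed

lemma comb_zero: "comb (\<lambda>g. 0) c = \<one>\<^bsub>J\<^esub>"
  unfolding comb_def by (intro J.finprod_one_eqI) simp

lemma comb_neg:
  assumes "c \<in> carrier J"
  shows "inv\<^bsub>J\<^esub> (comb a c) = comb (\<lambda>g. - a g) c"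
proof -
  have "comb (\<lambda>g. - a g) c \<otimes>\<^bsub>J\<^esub> comb a c = \<one>\<^bsub>J\<^esub>"
    using comb_add[OF assms, of "\<lambda>g. - a g" a] by (simp add: comb_zero)
  then show ?thesis using comb_closed[OF assms] by (intro J.inv_equality)
qed

lemma comb_single:
  assumes "g \<in> carrier G" "c \<in> carrier J"
  shows "comb (\<lambda>h. if h = g then m else 0) c = (g ` c) [^]\<^bsub>J\<^esub> m"
proof -
  have "comb (\<lambda>h. if h = g then m else 0) c = finprod J (\<lambda>h. if g = h then (h ` c) [^]\<^bsub>J\<^esub> m else \<one>\<^bsub>J\<^esub>) (carrier G)"
    unfolding comb_def using G_image_closed[OF _ assms(2)] by (intro J.finprod_cong') auto
  also have "\<dots> = (g ` c) [^]\<^bsub>J\<^esub> m"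
    using J.finprod_singleton[OF assms(1) finite_G, of "\<lambda>h. (h ` c) [^]\<^bsub>J\<^esub> m"] G_image_closed[OF _ assms(2)]
    by auto
  finally show ?thesis .
qed

lemma comb_cong_mod:
  assumes c: "c \<in> carrier J" and ab: "\<And>g. g \<in> carrier G \<Longrightarrow> a g mod int p = b g mod int p"
  shows "comb a c = comb b c"
  unfolding comb_def
proof (rule J.finprod_cong')
  fix g assume g: "g \<in> carrier G"
  have gc: "g ` c \<in> carrier J" by (rule G_image_closed[OF g c])
  have "int p dvd a g - b g" using ab[OF g] by (simp add: mod_eq_dvd_iff)
  then have "(g ` c) [^]\<^bsub>J\<^esub> (a g - b g) = \<one>\<^bsub>J\<^esub>" using gc by (intro J.int_pow_dvd)
  then have "(g ` c) [^]\<^bsub>J\<^esub> b g \<otimes>\<^bsub>J\<^esub> (g ` c) [^]\<^bsub>J\<^esub> (a g - b g) = (g ` c) [^]\<^bsub>J\<^esub> b g"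
    using gc by simp
  then show "(g ` c) [^]\<^bsub>J\<^esub> a g = (g ` c) [^]\<^bsub>J\<^esub> b g" using gc by (simp flip: J.int_pow_mult)
qed (use G_image_closed c in auto)

text \<open>Each conjugate of \<open>c\<close> lies in \<open>J.T.cyc c\<close>; conversely, the
  combinations of conjugates form a \<open>J.shift\<close>-stable subgroup containing
  \<open>c\<close>. Hence \<open>J.T.cyc\<close> describes the cyclic submodules over the group
  ring.\<close>

lemma range_comb:
  assumes c: "c \<in> carrier J"
  shows "range (\<lambda>a. comb a c) = J.T.cyc c"
proof
  show "range (\<lambda>a. comb a c) \<subseteq> J.T.cyc c"
    using comb_stable[OF J.T.cyc_subgroup[OF c] J.T.cyc_T[OF c] J.T.cyc_self[OF c]] by blast
  let ?H = "range (\<lambda>a. comb a c)"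
  have H: "subgroup ?H J"
  proof (rule J.subgroupI)
    show "?H \<subseteq> carrier J" using comb_closed[OF c] by blast
    show "?H \<noteq> {}" by blast
    show "inv\<^bsub>J\<^esub> h \<in> ?H" if h: "h \<in> ?H" for h
    proof -
      obtain a where "h = comb a c" using h by blast
      then show ?thesis using comb_neg[OF c, of a] by auto
    qed
    show "h \<otimes>\<^bsub>J\<^esub> h' \<in> ?H" if h: "h \<in> ?H" "h' \<in> ?H" for h h'
    proof -
      obtain a where a: "h = comb a c" using h(1) by blast
      obtain b where b: "h' = comb b c" using h(2) by blast
      have "h \<otimes>\<^bsub>J\<^esub> h' = comb (\<lambda>g. a g + b g) c" unfolding a b using comb_add[OF c] by simp
      then show ?thesis by blast
    qed
  qed
  have SH: "(image s ^^ k) c \<in> ?H" for k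
  proof -
    have "gal k \<in> carrier G" unfolding galois using gal_mod[of k] p_pos[of n] by auto
    from comb_single[OF this c, of 1] have "(image s ^^ k) c = comb (\<lambda>h. if h = gal k then 1 else 0) c"
      using gal_image[OF c, of k] J.Spow_closed[OF c] by simp
    then show ?thesis by blast
  qed
  have Hshift: "J.shift h \<in> ?H" if h: "h \<in> ?H" for h
  proof -
    obtain a where a: "h = comb a c" using h by blast
    have "J.shift h = finprod J (\<lambda>g. J.shift ((g ` c) [^]\<^bsub>J\<^esub> a g)) (carrier G)"
      unfolding a comb_def using J.T.Tpow_finprod[of "carrier G" _ 1] G_image_closed[OF _ c] by simp
    also have "\<dots> \<in> ?H"
    proof (rule J.finprod_in_subgroup[OF H])
      fix g assume g: "g \<in> carrier G"
      obtain k where k: "g ` c = (image s ^^ k) c" using g c by (rule G_image)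
      have "J.shift (g ` c) = (image s ^^ Suc k) c \<otimes>\<^bsub>J\<^esub> inv\<^bsub>J\<^esub> ((image s ^^ k) c)"
        unfolding k J.shift_def by simp
      then have "J.shift (g ` c) \<in> ?H"
        using subgroup.m_closed[OF H SH subgroup.m_inv_closed[OF H SH]] by metis
      then show "J.shift ((g ` c) [^]\<^bsub>J\<^esub> a g) \<in> ?H"
        using J.T.T_int_pow[OF G_image_closed[OF g c]] J.subgroup_int_pow_closed[OF H] by metis
    qed
    finally show ?thesis .
  qed
  have "J.T.act f c \<in> ?H" for f
  proof (induction f)
    case 0 then show ?case using subgroup.one_closed[OF H] by simp
  next
    case (pCons a f)
    have "c \<in> ?H" using SH[of 0] by simp
    then have "c [^]\<^bsub>J\<^esub> a \<in> ?H" by (rule J.subgroup_int_pow_closed[OF H])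
    then show ?case
      unfolding J.T.act_pCons[OF c] using Hshift[OF pCons(2)] by (rule subgroup.m_closed[OF H])
  qed
  then show "J.T.cyc c \<subseteq> ?H" unfolding J.T.cyc_def by blast
qed

lemma smult_image_carrier:
  assumes c: "c \<in> carrier J"
  shows "(\<lambda>a. a \<odot>\<^bsub>JM\<^esub> c) ` carrier kG = J.T.cyc c"
proof -
  have "comb a c \<in> (\<lambda>a. a \<odot>\<^bsub>JM\<^esub> c) ` carrier kG" for a
  proof (rule image_eqI)
    \<comment> \<open>Reduction modulo \<open>p\<close> and restriction to the group turn integer
      coefficients into an element of the group ring without changing the action.\<close>
    let ?a = "\<lambda>g\<in>carrier G. a g mod int p"
    show "comb a c = ?a \<odot>\<^bsub>JM\<^esub> c" unfolding smult_eq by (rule comb_cong_mod[OF c]) simp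
    have "0 < int p" using p_pos[of 1] by simp
    then have "0 \<le> a g mod int p \<and> a g mod int p \<le> int p - 1" for g
      using pos_mod_bound[of "int p" "a g"] pos_mod_sign[of "int p" "a g"] by linarith
    then show "?a \<in> carrier kG" unfolding group_ring_def residue_ring_def by auto
  qed
  then have "range (\<lambda>a. comb a c) \<subseteq> (\<lambda>a. a \<odot>\<^bsub>JM\<^esub> c) ` carrier kG" by blast
  then show ?thesis unfolding range_comb[OF c, symmetric] by (auto simp: smult_eq)
qed

lemma carrier_JM: "carrier JM = carrier J"
  and zero_JM: "\<zero>\<^bsub>JM\<^esub> = \<one>\<^bsub>J\<^esub>"
  and add_JM: "x \<oplus>\<^bsub>JM\<^esub> y = x \<otimes>\<^bsub>J\<^esub> y"
  unfolding power_class_module_def by simp_all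

lemma finsum_JM: "finsum JM f I = finprod J f I"
  unfolding finsum_def finprod_def power_class_module_def by simp

lemma subgroup_add_monoid: "subgroup N J \<Longrightarrow> subgroup N (add_monoid JM)"
  unfolding subgroup_def m_inv_def power_class_module_def by simp

lemma submoduleI:
  assumes "subgroup N J" "\<And>y. y \<in> N \<Longrightarrow> J.shift y \<in> N"
  shows "Module.submodule N kG JM"
  by (intro Module.submodule.intro subgroup_add_monoid assms(1) submodule_axioms.intro)
    (simp add: smult_eq comb_stable[OF assms])

lemma internal_direct_sumI:
  assumes "\<And>i. i \<in> I \<Longrightarrow> subgroup (N i) J" "\<And>i y. i \<in> I \<Longrightarrow> y \<in> N i \<Longrightarrow> J.shift y \<in> N i"
    and "J.independent_family I N"
  shows "internal_direct_sum kG JM I N (generate J (\<Union>i\<in>I. N i))"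
  unfolding internal_direct_sum_def finsum_JM zero_JM
  using J.independent_family_bij_betw[OF assms(1,3)] assms(1,2) by (auto intro: submoduleI)

lemma scalar_smult:
  assumes "c \<in> carrier J"
  shows "group_ring_scalar k\<^sub>p G a \<odot>\<^bsub>JM\<^esub> c = c [^]\<^bsub>J\<^esub> a"
proof -
  interpret G: group G by (rule galois_group_is_group) (auto simp: F_eq fixed_def)
  have one: "\<one>\<^bsub>G\<^esub> = gal 0" unfolding galois_group_one gal_def by (simp add: id_def)
  have "comb (group_ring_scalar k\<^sub>p G a) c = comb (\<lambda>g. if g = \<one>\<^bsub>G\<^esub> then a else 0) c"
    by (rule comb_cong_mod[OF assms]) (simp add: group_ring_scalar_def residue_ring_def)
  also have "\<dots> = c [^]\<^bsub>J\<^esub> a"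
    using comb_single[OF G.one_closed assms, of a] gal_image[OF assms, of 0] one by simp
  finally show ?thesis by (simp add: smult_eq)
qed

text \<open>The chain of iterates of \<open>J.shift\<close> from \<open>x\<close> is a basis:
  independent by \<open>finprod_Tpow_eq_one\<close>, spanning by \<open>cyc_finprod\<close>. Scalars
  are residues acting as exponents, which matter only modulo \<open>p\<close>.\<close>

lemma cyclic_dimension:
  assumes x: "x \<in> carrier J" and d: "(J.shift ^^ d) x = \<one>\<^bsub>J\<^esub>" "(J.shift ^^ (d - 1)) x \<noteq> \<one>\<^bsub>J\<^esub>"
  shows "submodule_dim k\<^sub>p G JM (J.T.cyc x) d"
proof -
  let ?N = "J.T.cyc x" and ?T = "\<lambda>k. (J.shift ^^ k) x"
  define V where "V = underlying_space k\<^sub>p G JM ?N"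
  interpret k: residues_prime p k\<^sub>p by unfold_locales (rule prime_p)
  note N = J.T.cyc_subgroup[OF x]
  have Nc: "y \<in> carrier J" if "y \<in> ?N" for y using subgroup.mem_carrier[OF N that] .
  have carV: "carrier V = ?N" and zV: "\<zero>\<^bsub>V\<^esub> = \<one>\<^bsub>J\<^esub>" and addV: "y \<oplus>\<^bsub>V\<^esub> z = y \<otimes>\<^bsub>J\<^esub> z" for y z
    unfolding V_def underlying_space_def by (simp_all add: zero_JM add_JM)
  have smV: "a \<odot>\<^bsub>V\<^esub> y = y [^]\<^bsub>J\<^esub> a" if "y \<in> ?N" for a y
    unfolding V_def underlying_space_def using scalar_smult[OF Nc[OF that]] by simp
  have modp: "y [^]\<^bsub>J\<^esub> (a mod int p) = y [^]\<^bsub>J\<^esub> a" if y: "y \<in> carrier J" for a y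
  proof -
    have "y [^]\<^bsub>J\<^esub> a = y [^]\<^bsub>J\<^esub> (a mod int p + int p * (a div int p))" by simp
    also have "\<dots> = y [^]\<^bsub>J\<^esub> (a mod int p)"
      using J.int_pow_dvd[OF y, of "int p * (a div int p)"] y by (simp only: J.int_pow_mult) simp
    finally show ?thesis by simp
  qed
  have ab: "abelian_group V"
  proof (rule abelian_groupI)
    show "\<exists>z\<in>carrier V. z \<oplus>\<^bsub>V\<^esub> y = \<zero>\<^bsub>V\<^esub>" if "y \<in> carrier V" for y
      using that Nc subgroup.m_inv_closed[OF N] unfolding carV addV zV
      by (intro bexI[of _ "inv\<^bsub>J\<^esub> y"]) auto
  qed (use Nc subgroup.m_closed[OF N] subgroup.one_closed[OF N] in
      \<open>auto simp: carV addV zV J.m_ac\<close>)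
  have "module k\<^sub>p V"
  proof (rule moduleI[OF k.is_cring ab])
    have pw: "y [^]\<^bsub>J\<^esub> (m::int) \<in> ?N"
      if "y \<in> ?N" for y m using J.subgroup_int_pow_closed[OF N that] .
    show "a \<odot>\<^bsub>V\<^esub> y \<in> carrier V" if "y \<in> carrier V" for a y
      using that pw unfolding carV by (simp add: smV)
    show "(a \<oplus>\<^bsub>k\<^sub>p\<^esub> b) \<odot>\<^bsub>V\<^esub> y = a \<odot>\<^bsub>V\<^esub> y \<oplus>\<^bsub>V\<^esub> b \<odot>\<^bsub>V\<^esub> y"
      if "y \<in> carrier V" for a b y
      using that Nc[of y] unfolding carV by (simp add: smV addV k.res_add_eq modp J.int_pow_mult)
    show "(a \<otimes>\<^bsub>k\<^sub>p\<^esub> b) \<odot>\<^bsub>V\<^esub> y = a \<odot>\<^bsub>V\<^esub> (b \<odot>\<^bsub>V\<^esub> y)"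
      if "y \<in> carrier V" for a b y
      using that Nc[of y] pw[of y b]
        unfolding carV by (simp add: smV k.res_mult_eq modp J.int_pow_pow mult.commute)
    show "a \<odot>\<^bsub>V\<^esub> (y \<oplus>\<^bsub>V\<^esub> z) = a \<odot>\<^bsub>V\<^esub> y \<oplus>\<^bsub>V\<^esub> a \<odot>\<^bsub>V\<^esub> z"
      if "y \<in> carrier V" "z \<in> carrier V" for a y z
      using that Nc[of y] Nc[of z] subgroup.m_closed[OF N, of y z] unfolding carV
      by (simp add: smV addV J.int_pow_distrib)
    show "\<one>\<^bsub>k\<^sub>p\<^esub> \<odot>\<^bsub>V\<^esub> y = y" if "y \<in> carrier V" for y
      using that Nc[of y] unfolding carV by (simp add: smV k.res_one_eq)
  qed
  then have vs: "vectorspace k\<^sub>p V" using k.is_field by (simp add: vectorspace_def)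
  interpret V: vectorspace k\<^sub>p V by (rule vs)
  have finsumV: "finsum V f I = finprod J f I"
    if "finite I" "\<And>i. i \<in> I \<Longrightarrow> f i \<in> ?N" for f and I :: "'a set set"
    using that
  proof (induction I rule: finite_induct)
    case empty then show ?case by (simp add: zV)
  next
    case (insert i I)
    have "finsum V f (insert i I) = f i \<oplus>\<^bsub>V\<^esub> finsum V f I"
      using insert by (intro V.finsum_insert) (auto simp: carV)
    also have "\<dots> = f i \<otimes>\<^bsub>J\<^esub> finprod J f I" using insert by (simp add: addV)
    also have "\<dots> = finprod J f (insert i I)"
      using insert Nc by (intro J.finprod_insert[symmetric]) auto
    finally show ?case .
  qed
  have TN: "?T k \<in> ?N" for k by (rule J.T.Tpow_stable[OF J.T.cyc_T[OF x] J.T.cyc_self[OF x]])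
  have inj: "inj_on ?T {..<d}" by (rule J.T.inj_on_Tpow[OF x d])
  define \<beta> where "\<beta> = ?T ` {..<d}"
  have \<beta>: "finite \<beta>" "\<beta> \<subseteq> carrier V" "card \<beta> = d"
    unfolding \<beta>_def carV using TN card_image[OF inj] by auto
  have lincomb: "V.lincomb a \<beta> = finprod J (\<lambda>k. ?T k [^]\<^bsub>J\<^esub> a (?T k)) {..<d}" for a
  proof -
    have "V.lincomb a \<beta> = (\<Oplus>\<^bsub>V\<^esub>v\<in>\<beta>. v [^]\<^bsub>J\<^esub> a v)"
      unfolding V.lincomb_def using \<beta>(2) unfolding carV
      by (intro V.finsum_cong') (auto simp: smV carV intro!: J.subgroup_int_pow_closed[OF N])
    also have "\<dots> = finprod J (\<lambda>v. v [^]\<^bsub>J\<^esub> a v) \<beta>"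
      using \<beta>(2) unfolding carV by (intro finsumV \<beta>(1) J.subgroup_int_pow_closed[OF N]) auto
    also have "\<dots> = finprod J (\<lambda>k. ?T k [^]\<^bsub>J\<^esub> a (?T k)) {..<d}"
      unfolding \<beta>_def using Nc[OF TN] by (intro J.finprod_reindex[OF _ inj]) auto
    finally show ?thesis .
  qed
  have indpt: "V.lin_indpt \<beta>"
  proof (rule V.finite_lin_indpt2[OF \<beta>(1,2)], rule ballI)
    fix a v assume a: "a \<in> \<beta> \<rightarrow> carrier k\<^sub>p" and lc: "V.lincomb a \<beta> = \<zero>\<^bsub>V\<^esub>" and v: "v \<in> \<beta>"
    obtain k where k: "k < d" "v = ?T k" using v unfolding \<beta>_def by blast
    have "int p dvd a (?T k)"
      using J.T.finprod_Tpow_eq_one[OF x d _ k(1), of "\<lambda>k. a (?T k)"] lc unfolding lincomb zV .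
    then have "int p dvd a v" using k by simp
    moreover have "0 \<le> a v" "a v < int p" using a v unfolding k.res_carrier_eq by auto
    ultimately show "a v = \<zero>\<^bsub>k\<^sub>p\<^esub>"
      unfolding k.res_zero_eq using zdvd_not_zless[of "a v" "int p"] by fastforce
  qed
  have "y \<in> V.span \<beta>" if y: "y \<in> ?N" for y
  proof -
    obtain c :: "nat \<Rightarrow> int" where c: "y = finprod J (\<lambda>k. ?T k [^]\<^bsub>J\<^esub> c k) {..<d}"
      using J.T.cyc_finprod[OF x d(1) y] by blast
    \<comment> \<open>Coefficients of a linear combination are indexed by vectors, so an exponent is
      looked up through the injective numbering of the chain.\<close>
    define a where "a v = c (the_inv_into {..<d} ?T v) mod int p" for v
    have "0 < int p" using p_pos[of 1] by simp
    then have ac: "a \<in> \<beta> \<rightarrow> carrier k\<^sub>p" unfolding a_def k.res_carrier_eq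
      using pos_mod_bound[of "int p"] pos_mod_sign[of "int p"] by (auto simp: zle_diff1_eq)
    have "V.lincomb a \<beta> = y"
      unfolding lincomb a_def c using Nc[OF TN] modp[OF Nc[OF TN]] the_inv_into_f_f[OF inj]
      by (intro J.finprod_cong') auto
    then show ?thesis using ac \<beta>(1) unfolding V.span_def by blast
  qed
  then have gen: "V.gen_set \<beta>" using V.span_is_subset2[OF \<beta>(2)] unfolding carV by blast
  have "V.fin_dim" unfolding V.fin_dim_def using \<beta> gen by blast
  moreover have "V.dim = d" using V.dim_basis[OF \<beta>(1)] indpt gen \<beta> unfolding V.basis_def by simp
  ultimately show ?thesis unfolding submodule_dim_def V_def by blast
qed

theorem module_decomposition:
  "\<exists>Y. internal_direct_sum kG JM {0..n} Y (carrier JM) \<and>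
     (\<forall>i\<le>n. \<exists>C. (\<forall>N\<in>C. cyclic_submodule kG JM N \<and> submodule_dim k\<^sub>p G JM N (p ^ i)) \<and>
       internal_direct_sum kG JM C (\<lambda>N. N) (Y i))"
proof -
  show ?thesis
  proof (rule J.T.cyclic_decomposition[of n])
    show "(J.shift ^^ (p ^ n)) c = \<one>\<^bsub>J\<^esub>"
      if "c \<in> carrier J" for c using that by (rule shift_nilpotent)
    show "\<exists>e\<in>carrier J. (J.shift ^^ (p ^ i - 1)) e = (J.shift ^^ (p ^ (i - 1))) d"
      if "1 \<le> i" "i \<le> n" "d \<in> carrier J" "J.shift ((J.shift ^^ (p ^ (i - 1))) d) = \<one>\<^bsub>J\<^esub>" for i d
      using that by (rule socle_element)
  next
    fix B assume B: "\<And>i. i \<le> n \<Longrightarrow> B i \<subseteq> carrier J"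
      "\<And>i x. \<lbrakk>i \<le> n; x \<in> B i\<rbrakk> \<Longrightarrow> (J.shift ^^ (p ^ i)) x = \<one>\<^bsub>J\<^esub> \<and> (J.shift ^^ (p ^ i - 1)) x \<noteq> \<one>\<^bsub>J\<^esub>"
      "\<And>i. i \<le> n \<Longrightarrow> J.independent_family (B i) J.T.cyc"
      "J.independent_family {0..n} (\<lambda>i. generate J (\<Union>x\<in>B i. J.T.cyc x))"
      "generate J (\<Union>i\<in>{0..n}. generate J (\<Union>x\<in>B i. J.T.cyc x)) = carrier J"
    define Y where "Y i = generate J (\<Union>x\<in>B i. J.T.cyc x)" for i
    have cyc: "subgroup (J.T.cyc x) J" "\<And>y. y \<in> J.T.cyc x \<Longrightarrow> J.shift y \<in> J.T.cyc x"
      if "i \<le> n" "x \<in> B i" for i x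
      using J.T.cyc_subgroup J.T.cyc_T B(1) that by blast+
    have cycc: "(\<Union>x\<in>B i. J.T.cyc x) \<subseteq> carrier J" if "i \<le> n" for i
      using subgroup.subset[OF cyc(1)[OF that]] by blast
    have Y: "subgroup (Y i) J" "\<And>y. y \<in> Y i \<Longrightarrow> J.shift y \<in> Y i" if i: "i \<le> n" for i
      unfolding Y_def
        using J.generate_is_subgroup[OF cycc[OF i]] J.T.generate_T_stable[OF cycc[OF i]] cyc(2)[OF i] by blast+
    have "internal_direct_sum kG JM {0..n} Y (carrier JM)"
      using internal_direct_sumI[of "{0..n}" Y] Y B(4,5) unfolding Y_def carrier_JM by auto
    moreover have "\<exists>C. (\<forall>N\<in>C. cyclic_submodule kG JM N \<and> submodule_dim k\<^sub>p G JM N (p ^ i)) \<and>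
         internal_direct_sum kG JM C (\<lambda>N. N) (Y i)" if i: "i \<le> n" for i
    proof (intro exI conjI ballI)
      let ?C = "J.T.cyc ` B i"
      fix N assume "N \<in> ?C"
      then obtain x where x: "x \<in> B i" "N = J.T.cyc x" by blast
      have xc: "x \<in> carrier J" using B(1)[OF i] x by blast
      show "cyclic_submodule kG JM N"
        unfolding cyclic_submodule_def carrier_JM x(2) using xc smult_image_carrier[OF xc] by blast
      show "submodule_dim k\<^sub>p G JM N (p ^ i)"
        unfolding x(2) using B(2)[OF i x(1)] by (intro cyclic_dimension[OF xc]) auto
    next
      let ?C = "J.T.cyc ` B i"
      \<comment> \<open>With nontrivial summands, distinct generators give distinct summands, so the
        direct sum can be indexed by the set of its members.\<close>
      have nontrivial: "\<exists>y\<in>J.T.cyc x. y \<noteq> \<one>\<^bsub>J\<^esub>" if x: "x \<in> B i" for x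
      proof (rule bexI)
        show "x \<noteq> \<one>\<^bsub>J\<^esub>" using B(2)[OF i x] J.T.Tpow_one by metis
        show "x \<in> J.T.cyc x" using B(1)[OF i] x by (intro J.T.cyc_self) blast
      qed
      have inj: "inj_on J.T.cyc (B i)"
        using cyc(1)[OF i] nontrivial B(3)[OF i] by (rule J.independent_family_inj_on)
      have "J.independent_family ?C (\<lambda>N. N)"
        using subgroup.subset[OF cyc(1)[OF i]]
          by (rule J.independent_family_image[OF B(3)[OF i] inj])
      then have "internal_direct_sum kG JM ?C (\<lambda>N. N) (generate J (\<Union>N\<in>?C. N))"
        using internal_direct_sumI[of ?C "\<lambda>N. N"] cyc[OF i] by blast
      then show "internal_direct_sum kG JM ?C (\<lambda>N. N) (Y i)" unfolding Y_def by simp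
    qed
    ultimately show ?thesis by blast
  qed
qed

text \<open>Automorphisms over \<open>fixed (p ^ i)\<close> fix the representatives taken from it.
  Conversely \<open>gal (p ^ i)\<close> is such an automorphism, and invariance under it already
  yields a representative in \<open>fixed (p ^ i)\<close>.\<close>

lemma classes_eq_fixed_classes:
  assumes i: "i \<le> n"
  shows "classes_of p R (fixed (p ^ i)) = fixed_classes p R (carrier (galois_group R (fixed (p ^ i))))"
proof
  have "fixed (p ^ i) - {\<zero>} \<subseteq> nonzero" unfolding fixed_def by auto
  moreover have "h ` power_class p x = power_class p x"
    if "x \<in> fixed (p ^ i) - {\<zero>}" "x \<in> nonzero" "h \<in> carrier (galois_group R (fixed (p ^ i)))" for x h
    using that image_power_class[of h x p] unfolding mem_galois_group by auto
  ultimately show "classes_of p R (fixed (p ^ i)) \<subseteq> fixed_classes p R (carrier (galois_group R (fixed (p ^ i))))"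
    unfolding classes_of_def fixed_classes_def carrier_power_class_group by blast
  show "fixed_classes p R (carrier (galois_group R (fixed (p ^ i)))) \<subseteq> classes_of p R (fixed (p ^ i))"
  proof
    fix c assume c: "c \<in> fixed_classes p R (carrier (galois_group R (fixed (p ^ i))))"
    then have cc: "c \<in> carrier J" unfolding fixed_classes_def by blast
    have "gal (p ^ i) ` c = c"
      using c gal_mem[OF s_iso, of "fixed (p ^ i)" "p ^ i"] unfolding fixed_classes_def by blast
    then have "(image s ^^ (p ^ i)) c = c" using gal_image[OF cc] by simp
    then obtain y where "y \<in> fixed (p ^ i) - {\<zero>}" "c = power_class p y"
      by (rule fixed_class_representative[OF i cc])
    then show "c \<in> classes_of p R (fixed (p ^ i))" unfolding classes_of_def by blast
  qed
qed

end

section \<open>Translation of the hypotheses on \<open>K\<close> and \<open>F\<close> into the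
  setting of a generator\<close>

theorem theorem1:
  fixes K :: "('a, 'b) ring_scheme" and F :: "'a set"
    and p n :: nat and \<sigma> :: "'a \<Rightarrow> 'a"
  defines "G \<equiv> galois_group K F"
    and "\<F> \<equiv> residue_ring (int p)"
    and "J \<equiv> power_class_module p K F"
  assumes "Factorial_Ring.prime p" and "n \<ge> 1"
    and "galois_extension K F"
    and "ring.dimension K (p ^ n) F (carrier K)"
    and "\<sigma> \<in> carrier G" and "generate G {\<sigma>} = carrier G"
    and "(\<not> (\<exists>\<xi>\<in>F. primitive_root_of_unity K p \<xi>)) \<or>
         (p = 2 \<and> n = 1 \<and> \<ominus>\<^bsub>K\<^esub> \<one>\<^bsub>K\<^esub> \<notin> galois_norm K F ` (carrier K - {\<zero>\<^bsub>K\<^esub>}))"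
  shows "(\<exists>Y. internal_direct_sum (group_ring \<F> G) J {0..n} Y (carrier J) \<and>
            (\<forall>i\<le>n. \<exists>C.
               (\<forall>N\<in>C. cyclic_submodule (group_ring \<F> G) J N \<and>
                 submodule_dim \<F> G J N (p ^ i)) \<and>
               internal_direct_sum (group_ring \<F> G) J C (\<lambda>N. N) (Y i))) \<and>
         (\<forall>i\<le>n. classes_of p K (intermediate_field K F (p ^ i)) =
            fixed_classes p K (carrier (galois_group K (intermediate_field K F (p ^ i)))))"
proof -
  note \<sigma> = assms(8)[unfolded G_def] and gen = assms(9)[unfolded G_def]
  have K: "field K" and Fsub: "subfield F K"
    and fixF: "{x \<in> carrier K. \<forall>g\<in>carrier (galois_group K F). g x = x} = F"
    using assms(6) unfolding galois_extension_def by auto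
  interpret field K by (rule K)
  have Fc: "F \<subseteq> carrier K" using subfieldE(3)[OF Fsub] .
  interpret G: group "galois_group K F" by (rule galois_group_is_group[OF Fc])
  have iso: "\<sigma> \<in> ring_iso K K" and ext: "\<sigma> \<in> extensional (carrier K)"
    using \<sigma> unfolding mem_galois_group by auto
  interpret field_endo K \<sigma> by unfold_locales (use iso in \<open>simp add: ring_iso_def\<close>)
  \<comment> \<open>\<open>\<sigma>\<close> generates the group, so an element it fixes is fixed by
    every automorphism over \<open>F\<close>.\<close>
  have F: "fixed 1 = F"
  proof
    show "F \<subseteq> fixed 1" using \<sigma> Fc unfolding mem_galois_group fixed_def by auto
    show "fixed 1 \<subseteq> F"
    proof
      fix x assume x: "x \<in> fixed 1"
      then have xc: "x \<in> carrier K" "\<sigma> x = x" unfolding fixed_def by auto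
      have "g \<in> carrier (galois_group K F) \<and> g x = x" if "g \<in> generate (galois_group K F) {\<sigma>}" for g
        using that
      proof (induction rule: generate.induct)
        case one then show ?case
          using xc by (simp add: galois_group_one[symmetric] del: restrict_apply)
            (simp add: galois_group_one)
      next
        case (incl h) then show ?case using xc \<sigma> by auto
      next
        case (inv h)
        then have h: "h \<in> carrier (galois_group K F)" "h x = x" using xc \<sigma> by auto
        have "compose (carrier K) (inv\<^bsub>galois_group K F\<^esub> h) h = (\<lambda>x\<in>carrier K. x)"
          using G.l_inv[OF h(1)] galois_group_mult[OF G.inv_closed[OF h(1)] h(1)] galois_group_one
            by metis
        from fun_cong[OF this, of x] show ?case using xc h by (simp add: compose_def)
      next
        case (eng h1 h2)
        then have h: "h1 \<in> carrier (galois_group K F)" "h2 \<in> carrier (galois_group K F)" "h1 x = x" "h2 x = x"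
          by auto
        then have "(h1 \<otimes>\<^bsub>galois_group K F\<^esub> h2) x = x"
          unfolding galois_group_mult[OF h(1,2)] using xc by (simp add: compose_def)
        then show ?case using G.m_closed[OF h(1,2)] by simp
      qed
      then show "x \<in> F" using gen fixF xc by blast
    qed
  qed
  interpret cyclic_extension K \<sigma> p n
    by unfold_locales (use assms(4,7) F in simp_all)
  have gal1: "gal 1 = \<sigma>" unfolding gal_def using ext by (simp add: extensional_restrict)
  have carG: "carrier (galois_group K F) = gal ` {..<p ^ n}"
    using carrier_galois_group[OF iso] gen unfolding F gal1 .
  have "(\<forall>z\<in>fixed 1. z [^]\<^bsub>K\<^esub> p = \<one>\<^bsub>K\<^esub> \<longrightarrow> z = \<one>\<^bsub>K\<^esub>) \<or>
      (p = 2 \<and> n = 1 \<and> (\<forall>x\<in>carrier K - {\<zero>\<^bsub>K\<^esub>}. iterated_norm K \<sigma> 2 x \<noteq> \<ominus>\<^bsub>K\<^esub> \<one>\<^bsub>K\<^esub>))"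
    using assms(10)
  proof (elim disjE)
    assume no: "\<not> (\<exists>\<xi>\<in>F. primitive_root_of_unity K p \<xi>)"
    \<comment> \<open>As \<open>z\<close> is not primitive, \<open>z [^] k = \<one>\<close> for some
      \<open>k\<close> with \<open>0 < k < p\<close>; since \<open>k\<close> is prime to
      \<open>p\<close>, a Bezout relation gives \<open>z = \<one>\<close>.\<close>
    have "z = \<one>\<^bsub>K\<^esub>" if z: "z \<in> F" "z [^]\<^bsub>K\<^esub> p = \<one>\<^bsub>K\<^esub>" for z
    proof -
      have zc: "z \<in> carrier K" using z Fc by blast
      obtain k where k: "0 < k" "k < p" "z [^]\<^bsub>K\<^esub> k = \<one>\<^bsub>K\<^esub>"
        using no z zc unfolding primitive_root_of_unity_def by blast
      have "coprime k p" using prime_p k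
        by (metis coprime_commute nat_dvd_not_less prime_imp_coprime)
      moreover obtain x y where "k * x = p * y + gcd k p" using bezout_nat[of k p] k by auto
      ultimately have xy: "k * x = p * y + 1" by simp
      have "\<one>\<^bsub>K\<^esub> = z [^]\<^bsub>K\<^esub> (k * x)" using k zc by (simp flip: nat_pow_pow)
      also have "\<dots> = z" unfolding xy using z zc by (simp flip: nat_pow_pow nat_pow_mult)
      finally show ?thesis by simp
    qed
    then show ?thesis unfolding F by blast
  next
    assume h: "p = 2 \<and> n = 1 \<and> \<ominus>\<^bsub>K\<^esub> \<one>\<^bsub>K\<^esub> \<notin> galois_norm K F ` (carrier K - {\<zero>\<^bsub>K\<^esub>})"
    have "galois_norm K F x = iterated_norm K \<sigma> 2 x" if x: "x \<in> carrier K" for x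
    proof -
      \<comment> \<open>The group consists of the identity and \<open>\<sigma>\<close>, so the norm
        of \<open>x\<close> is \<open>x \<otimes> \<sigma> x\<close>.\<close>
      have two: "{..<p ^ n} = {0, 1}" using h by auto
      have "gal k x = (\<sigma> ^^ k) x" for k using x by (simp add: gal_def)
      moreover have "gal 0 \<noteq> gal 1" using inj_gal unfolding two by (simp add: inj_on_def)
      ultimately show ?thesis
        unfolding galois_norm_def carG two using x by (simp add: numeral_2_eq_2)
    qed
    then show ?thesis using h by (metis DiffD1 imageI)
  qed
  then interpret cyclic_galois K \<sigma> p n F
    using assms(5) carG F by unfold_locales simp_all
  show ?thesis
    using module_decomposition classes_eq_fixed_classes intermediate_field_eq[unfolded F]
    unfolding G_def \<F>_def J_def by simp
qed

end
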